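(* Let $p$ be a power of $2$ and $f(x)=\sum_{i=0}^eb_ix^i\in\mathbb{F}_p[x]$ with $b_0b_e\ne0$, $f(1)=0$, and all roots of $f$ simple. Write $g(x):=x^ef(x)f(x^{-1})=a_ex^{2e}+\dots+a_1x^{e+1}+a_1x^{e-1}+\dots+a_e$ (with $a_i\in\mathbb{F}_p$; the coefficient of $x^e$ is $0$), and set $R(x):=\sum_{i=1}^ea_ix^{p^i}$, $E(x):=R(x)+\sum_{i=1}^e(a_ix)^{p^{-i}}$. Let $n$ be the smallest integer $\ge1$ with $g(x)\mid x^n+1$. For $q$ a power of $p$ and $a\in\mathbb{F}_q$, let $C_a$ be the curve $y^p+y=x(R(x)+ax)$, and set $\widetilde\alpha(u):=\sqrt{R(1)}+f'(1)+E(u)$. Then: (1) if $C_a$ is $\mathbb{F}_q$-extremal for some $a\in\mathbb{F}_q$, then $\mathbb{F}_{p^n}\subset\mathbb{F}_q$; (2) if $\mathbb{F}_{p^n}\subset\mathbb{F}_q$ and $q=p^{ns}$, then $C_a$ is $\mathbb{F}_q$-extremal if and only if $a=\widetilde\alpha(u)^2$ for some $u\in\mathbb{F}_q$, and $C_a$ is $\mathbb{F}_q$-maximal if and only if $a=\widetilde\alpha(u)^2$ for some $u\in\mathbb{F}_q$ with $\mathrm{Tr}_{\mathbb{F}_q/\mathbb{F}_2}(uR(u)+\widetilde\alpha(0)u)\equiv s+1\pmod 2$.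
   Context: $\sqrt{R(1)}$ is the unique square root in $\mathbb{F}_p$. An affine curve is $\mathbb{F}_q$-maximal (resp. minimal) if its smooth compactification, of genus $g$, has $q+1+2g\sqrt q$ (resp. $q+1-2g\sqrt q$) $\mathbb{F}_q$-points; extremal means one of these. *)

theory Defs
  imports
    Complex_Main
    "HOL-Library.Z2"
    "HOL-Algebra.Generated_Fields"
    "HOL-Algebra.Algebraic_Closure_Type"
    "HOL-Computational_Algebra.Polynomial"
    "HOL-Computational_Algebra.Fraction_Field"
begin

text \<open>
  All fields live inside one algebraically closed field of characteristic 2, the algebraic
  closure of the rational function field in one variable over the field with two elements.
  It contains every finite field of characteristic 2 (exactly once) and, being of transcendence
  degree 1 over its prime field, also the function field of every irreducible plane curve over
  such a finite field.
\<close>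

type_synonym universe = "bit poly fract alg_closure"

text \<open>The subfield with \<open>q\<close> elements, for \<open>q\<close> a power of the characteristic.\<close>

definition GF :: "nat \<Rightarrow> 'a :: field set" where
  "GF q = {x. x ^ q = x}"

text \<open>The unique \<open>m\<close>-th root, for \<open>m\<close> a power of 2.\<close>

definition inv_frobenius :: "nat \<Rightarrow> universe \<Rightarrow> universe" where
  "inv_frobenius m z = (THE w. w ^ m = z)"

text \<open>
  Absolute trace from the field with \<open>q = 2 ^ m\<close> elements to the field with two elements,
  as the sum of the \<open>m\<close> conjugates.
\<close>

definition trace_GF2 :: "nat \<Rightarrow> 'a :: field \<Rightarrow> 'a" where
  "trace_GF2 q z = (\<Sum>i | (2::nat) ^ i < q. z ^ (2 ^ i))"


section \<open>Function fields: places, divisors, genus\<close>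

text \<open>
  \<open>F\<close> is a function field of one variable over its subfield \<open>k\<close>.  The closed points of
  the smooth projective curve with function field \<open>F\<close> are the places of \<open>F / k\<close>; a place
  is represented by its valuation ring.
\<close>

definition places :: "'a :: field set \<Rightarrow> 'a set \<Rightarrow> 'a set set" where
  "places k F = {V. k \<subseteq> V \<and> V \<subset> F \<and>
     (\<forall>x\<in>V. \<forall>y\<in>V. x - y \<in> V \<and> x * y \<in> V) \<and>
     (\<forall>z\<in>F. z \<in> V \<or> inverse z \<in> V)}"

definition max_ideal :: "'a :: field set \<Rightarrow> 'a set" where
  "max_ideal V = {z \<in> V. z = 0 \<or> inverse z \<notin> V}"

text \<open>
  \<open>dim_quot k V W\<close> is the dimension of \<open>V / W\<close> over \<open>k\<close>, for \<open>k\<close>-subspaces \<open>W \<subseteq> V\<close> of the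
  ambient field with finite-dimensional quotient.
\<close>

definition indep_mod :: "'a :: field set \<Rightarrow> 'a set \<Rightarrow> 'a set \<Rightarrow> bool" where
  "indep_mod k W B \<longleftrightarrow>
     (\<forall>c. (\<forall>b\<in>B. c b \<in> k) \<and> (\<Sum>b\<in>B. c b * b) \<in> W \<longrightarrow> (\<forall>b\<in>B. c b = 0))"

definition dim_quot :: "'a :: field set \<Rightarrow> 'a set \<Rightarrow> 'a set \<Rightarrow> nat" where
  "dim_quot k V W = (GREATEST n. \<exists>B\<subseteq>V. finite B \<and> card B = n \<and> indep_mod k W B)"

definition place_degree :: "'a :: field set \<Rightarrow> 'a set \<Rightarrow> nat" where
  "place_degree k P = dim_quot k P (max_ideal P)"

text \<open>The \<open>k\<close>-rational points of the smooth projective curve are the places of degree one.\<close>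

definition rational_places :: "'a :: field set \<Rightarrow> 'a set \<Rightarrow> 'a set set" where
  "rational_places k F = {P \<in> places k F. place_degree k P = 1}"

text \<open>
  Normalised valuation of \<open>z \<noteq> 0\<close> at a place \<open>P\<close> (a discrete valuation ring): the \<open>n\<close> such
  that \<open>z\<close> is a unit of \<open>P\<close> times \<open>t\<^sup>n\<close> for every generator \<open>t\<close> of the maximal ideal.
\<close>

definition valuation :: "'a :: field set \<Rightarrow> 'a \<Rightarrow> int" where
  "valuation P z =
     (THE n. \<forall>t. max_ideal P = (\<lambda>v. t * v) ` P \<longrightarrow> z * t powi (- n) \<in> P - max_ideal P)"

definition is_divisor :: "'a :: field set \<Rightarrow> 'a set \<Rightarrow> ('a set \<Rightarrow> int) \<Rightarrow> bool" where
  "is_divisor k F D \<longleftrightarrow> finite {P. D P \<noteq> 0} \<and> {P. D P \<noteq> 0} \<subseteq> places k F"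

definition divisor_degree :: "'a :: field set \<Rightarrow> ('a set \<Rightarrow> int) \<Rightarrow> int" where
  "divisor_degree k D = (\<Sum>P | D P \<noteq> 0. D P * int (place_degree k P))"

definition riemann_roch_space ::
    "'a :: field set \<Rightarrow> 'a set \<Rightarrow> ('a set \<Rightarrow> int) \<Rightarrow> 'a set" where
  "riemann_roch_space k F D =
     {z \<in> F. z = 0 \<or> (\<forall>P\<in>places k F. valuation P z \<ge> - D P)}"

text \<open>Riemann's definition: the maximum of \<open>deg D - l(D) + 1\<close> over all divisors \<open>D\<close>.\<close>

definition genus :: "'a :: field set \<Rightarrow> 'a set \<Rightarrow> int" where
  "genus k F = (GREATEST g. \<exists>D. is_divisor k F D \<and>
     g = divisor_degree k D - int (dim_quot k (riemann_roch_space k F D) {0}) + 1)"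


section \<open>Affine plane curves\<close>

text \<open>
  A bivariate polynomial is an element \<open>H\<close> of \<open>k[x][y]\<close>: the outer variable is \<open>y\<close>, so that
  its value at \<open>(x, y)\<close> is \<open>poly (poly H [:y:]) x\<close>.
\<close>

definition poly2_over :: "'a :: field set \<Rightarrow> 'a poly poly set" where
  "poly2_over k = {H. \<forall>i j. coeff (coeff H i) j \<in> k}"

text \<open>
  A generic point over \<open>k\<close> of the curve \<open>H = 0\<close>, for \<open>H\<close> irreducible over \<open>k\<close>: evaluation at
  \<open>(x, y)\<close> has kernel the ideal generated by \<open>H\<close>, i.e. it identifies the coordinate ring
  \<open>k[x,y] / (H)\<close> with the subring generated by \<open>x\<close> and \<open>y\<close> over \<open>k\<close>, and hence the function
  field of the curve with \<open>k(x, y)\<close>.  The latter is unique up to isomorphism over \<open>k\<close>.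
\<close>

definition generic_point :: "'a :: field set \<Rightarrow> 'a poly poly \<Rightarrow> 'a \<Rightarrow> 'a \<Rightarrow> bool" where
  "generic_point k H x y \<longleftrightarrow>
     (\<forall>G\<in>poly2_over k. poly (poly G [:y:]) x = 0 \<longleftrightarrow> (\<exists>Q\<in>poly2_over k. G = H * Q))"

definition function_field :: "universe set \<Rightarrow> universe poly poly \<Rightarrow> universe set" where
  "function_field k H =
     (let (x, y) = (SOME (x, y). generic_point k H x y)
      in generate_field ring_of_type_algebra (k \<union> {x, y}))"

definition maximal_curve :: "nat \<Rightarrow> universe poly poly \<Rightarrow> bool" where
  "maximal_curve q H \<longleftrightarrow>
     (let F = function_field (GF q) H in
      real (card (rational_places (GF q) F))
        = real q + 1 + 2 * real_of_int (genus (GF q) F) * sqrt (real q))"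

definition minimal_curve :: "nat \<Rightarrow> universe poly poly \<Rightarrow> bool" where
  "minimal_curve q H \<longleftrightarrow>
     (let F = function_field (GF q) H in
      real (card (rational_places (GF q) F))
        = real q + 1 - 2 * real_of_int (genus (GF q) F) * sqrt (real q))"

definition extremal_curve :: "nat \<Rightarrow> universe poly poly \<Rightarrow> bool" where
  "extremal_curve q H \<longleftrightarrow> maximal_curve q H \<or> minimal_curve q H"

text \<open>The polynomial \<open>y\<^sup>p + y - x (R(x) + a x)\<close>.\<close>

definition curve_poly :: "nat \<Rightarrow> 'a :: field poly \<Rightarrow> 'a \<Rightarrow> 'a poly poly" where
  "curve_poly p R a = monom 1 p + monom 1 1 - [:[:0, 1:] * (R + [:0, a:]):]"

end

theory Submission
  imports Defs
begin

text \<open>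
  Write \<open>Q\<^sub>c(x)\<close> for the trace of \<open>x (R(x) + c x)\<close> and \<open>S(c)\<close> for the sum of the signs
  \<open>(-1)\<close> to the power \<open>Q\<^sub>c(x)\<close> over the field with \<open>q\<close> elements.  The curve has \<open>q + 1 + (p - 1) S(c)\<close> points and
  genus \<open>(p - 1) p\<^sup>e / 2\<close>, so it is extremal iff \<open>S(c)\<^sup>2 = q p\<^sup>2\<^sup>e\<close>, that is, iff all \<open>p\<^sup>2\<^sup>e\<close> zeros
  of \<open>E\<close> are rational and \<open>Q\<^sub>c\<close> vanishes on them.  The zeros of \<open>E\<close> are those of the linearized
  polynomial of \<open>g\<close>, and they are rational iff \<open>g\<close> divides \<open>x\<^sup>r + 1\<close>.
  With \<open>f = (x + 1) f\<^sub>1\<close> and \<open>F\<^sub>1\<close> the linearized polynomial of \<open>f\<^sub>1\<close>, the form for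
  \<open>c = \<alpha>(0)\<^sup>2\<close> is the trace of \<open>F\<^sub>1(x)\<close> to the power \<open>p + 1\<close>.  The space \<open>U\<close> of all \<open>x\<close> for which
  \<open>F\<^sub>1(x)\<close> lies in the subfield with \<open>\<surd>q\<close> elements is totally singular, and on its orthogonal space the form is
  either zero or the anisotropic norm form of the quadratic extension of the field with \<open>p\<close>
  elements; this gives the sign of \<open>S(\<alpha>(0)\<^sup>2)\<close>.

  For the genus, every affine place is unramified over the \<open>x\<close>-line, with \<open>x\<^sup>N - x\<close> for
  a suitable power \<open>N\<close> of \<open>q\<close> as uniformizer, and the pole orders at infinity form the
  semigroup generated by \<open>p\<close> and \<open>p\<^sup>e + 1\<close>; the genus is its number of gaps.
\<close>

text \<open>The parity of \<open>s\<close> enters through \<open>n\<close>. The double zero of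
  \<open>g\<close> at 1 forces \<open>n\<close> to be even, and since \<open>f\<close> is squarefree
  it divides \<open>x^j + 1\<close> as soon as it divides the square of \<open>x^j + 1\<close>,
  which makes \<open>n / 2\<close> odd. Writing \<open>n * s = 2 * t\<close>, the number
  \<open>t\<close> has the parity of \<open>s\<close>. The constant \<open>c0\<close>, the value of
  \<alpha> at 0, is what is left over when the trace of \<open>F1(x)^(p+1)\<close> is expanded and
  compared with the trace of \<open>x R(x)\<close>. The other values of \<alpha> come from
  translating \<open>x\<close> by \<open>u\<close>, which multiplies the sum by a sign. On the
  geometric side places, degrees and genus are used as literally defined, and the function field
  belongs to an arbitrarily chosen generic point. As the constant field is finite, dimensions are
  read off from cardinalities and finiteness arguments are pigeonhole arguments. The hard half of
  the genus is the upper bound over all divisors: every divisor lies below a multiple of the sum of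
  the place at infinity and of all zeros of one function \<open>x^N - x\<close>, and for such a
  divisor explicit sections are available.\<close>

lemma two_eq_0_universe: "(2::universe) = 0"
proof -
  have "(1::bit poly) + 1 = 0" unfolding one_pCons by simp
  hence "Fract (1::bit poly) 1 + Fract 1 1 = Fract 0 1" by (simp add: eq_fract)
  hence "(1::bit poly fract) + 1 = 0"
    by (simp only: One_fract_def Zero_fract_def)
  hence "to_ac (1::bit poly fract) + to_ac 1 = 0" by (metis to_ac_add to_ac_0)
  thus ?thesis by simp
qed

lemma add_self_universe [simp]: "(z::universe) + z = 0"
  by (metis mult_2 mult_zero_left two_eq_0_universe)

lemma uminus_universe [simp]: "- (z::universe) = z"
  by (rule minus_unique) simp

lemma diff_universe [simp]: "(z::universe) - w = z + w"
  by (metis diff_conv_add_uminus uminus_universe)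

lemma add_self_left_universe [simp]: "(z::universe) + (z + w) = w"
  by (simp flip: add.assoc)

lemma add_eq_0_universe [simp]: "(z::universe) + w = 0 \<longleftrightarrow> z = w"
  by (metis add_self_universe add_self_left_universe add.right_neutral)

lemma CHAR_universe: "CHAR(universe) = 2"
proof -
  have "CHAR(universe) dvd 2"
    using two_eq_0_universe of_nat_eq_0_iff_char_dvd[where 'a = universe, of 2] by simp
  moreover have "CHAR(universe) \<noteq> 1" by simp
  ultimately show ?thesis using two_is_prime_nat by (metis prime_nat_iff)
qed

lemma frob_add: "((a::universe) + b) ^ (2 ^ n) = a ^ (2 ^ n) + b ^ (2 ^ n)"
  by (rule freshmans_dream'[where 'a = universe]) (simp_all only: CHAR_universe two_is_prime_nat)

lemma frob_sum: "(sum (f :: 'b \<Rightarrow> universe) A) ^ (2 ^ n) = (\<Sum>i\<in>A. f i ^ (2 ^ n))"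
  by (rule freshmans_dream_sum'[where 'a = universe]) (simp_all only: CHAR_universe two_is_prime_nat)

lemma frob_inj: "(a::universe) ^ (2 ^ n) = b ^ (2 ^ n) \<longleftrightarrow> a = b"
proof
  assume "a ^ (2 ^ n) = b ^ (2 ^ n)"
  hence "(a + b) ^ (2 ^ n) = 0" by (simp add: frob_add)
  thus "a = b" by simp
qed simp

section \<open>Separable polynomials over an algebraically closed field\<close>

lemma card_roots_rsquarefree:
  fixes P :: "'a :: alg_closed_field poly"
  assumes "rsquarefree P"
  shows "card {x. poly P x = 0} = degree P"
proof -
  have P0: "P \<noteq> 0" using assms by (auto simp: rsquarefree_def)
  obtain A where A: "size A = degree P" "P = smult (lead_coeff P) (\<Prod>x\<in>#A. [:- x, 1:])"
    using alg_closed_imp_factorization[OF P0] by auto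
  have prod0: "(\<Prod>x\<in>#A. [:- x, 1:]) \<noteq> 0" using A(2) P0 by auto
  have roots: "{x. poly P x = 0} = set_mset A"
  proof -
    have "poly P x = 0 \<longleftrightarrow> x \<in># A" for x
    proof -
      have "poly P x = 0 \<longleftrightarrow> (\<Prod>y\<in>#A. (x - y)) = 0"
        apply (subst A(2)) using P0 by (simp add: poly_prod_mset)
      thus ?thesis by (auto simp: prod_mset_zero_iff)
    qed
    thus ?thesis by auto
  qed
  have "count A x \<le> 1" for x
  proof (rule ccontr)
    assume "\<not> count A x \<le> 1"
    hence "{#x, x#} \<subseteq># A"
      by (auto simp: subseteq_mset_def)
    then obtain B where B: "A = {#x, x#} + B" by (metis subset_mset.add_diff_inverse)
    have "P = [:-x,1:]^2 * smult (lead_coeff P) (\<Prod>x\<in>#B. [:- x, 1:])"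
      by (subst A(2)) (simp only: B power2_eq_square mult_smult_right image_mset_union
        prod_mset.union image_mset_add_mset prod_mset.add_mset image_mset_empty prod_mset.empty mult.assoc mult_1)
    hence "[:-x,1:]^2 dvd P" by (metis dvdI)
    hence "order x P \<ge> 2" using P0 order_divides by blast
    thus False using assms by (auto simp: rsquarefree_def) (metis One_nat_def Suc_1 not_numeral_le_zero order_refl Suc_n_not_le_n)
  qed
  hence "A = mset_set (set_mset A)"
    by (intro multiset_eqI) (metis count_mset_set(1,3) finite_set_mset le_antisym less_one linorder_not_less count_greater_eq_one_iff)
  hence "size A = card (set_mset A)" by (metis size_mset_set)
  thus ?thesis using A(1) roots by simp
qed

lemma rsquarefree_if_separable:
  fixes P :: "'a :: field poly"
  assumes "P \<noteq> 0" and sep: "\<And>a. poly P a = 0 \<Longrightarrow> poly (pderiv P) a \<noteq> 0"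
  shows "rsquarefree P"
proof -
  have "order a P = 0 \<or> order a P = 1" for a
  proof (rule ccontr)
    assume "\<not> ?thesis"
    hence "[:-a,1:]^2 dvd P" using order_divides[of a 2 P] by auto
    then obtain Q where "P = [:-a,1:]^2 * Q" by (rule dvdE)
    moreover define L where "L = [:-a,1:]"
    ultimately have "P = L * (L * Q)" "poly L a = 0" by (simp_all only: power2_eq_square mult.assoc) simp
    hence "poly P a = 0" "poly (pderiv P) a = 0" by (simp_all add: pderiv_mult)
    thus False using sep by blast
  qed
  thus ?thesis using assms(1) by (auto simp: rsquarefree_def)
qed

section \<open>Finite fields\<close>

lemma GF_0 [simp]: "q > 0 \<Longrightarrow> 0 \<in> GF q" by (simp add: GF_def)
lemma GF_1 [simp]: "1 \<in> GF q" by (simp add: GF_def)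
lemma GF_mult: "a \<in> GF q \<Longrightarrow> b \<in> GF q \<Longrightarrow> a * b \<in> GF q" by (simp add: GF_def power_mult_distrib)
lemma GF_inverse: "a \<in> GF q \<Longrightarrow> inverse a \<in> GF q" by (simp add: GF_def power_inverse)
lemma GF_power: "a \<in> GF q \<Longrightarrow> a ^ n \<in> GF q" by (simp add: GF_def) (metis mult.commute power_mult)
lemma GF_add: "a \<in> GF (2^n) \<Longrightarrow> b \<in> GF (2^n) \<Longrightarrow> (a::universe) + b \<in> GF (2^n)" by (simp add: GF_def frob_add)
lemma GF_sum: "(\<And>i. i \<in> I \<Longrightarrow> (f i::universe) \<in> GF (2^n)) \<Longrightarrow> sum f I \<in> GF (2^n)"
  by (induction I rule: infinite_finite_induct) (auto intro: GF_add)
lemma GF_mono: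
  assumes "a dvd b" shows "(GF (m ^ a) :: 'a::field set) \<subseteq> GF (m ^ b)"
proof -
  obtain c where b: "b = a * c" using assms by auto
  have "z ^ (m ^ (a * c)) = z" if z: "z ^ (m ^ a) = z" for z :: 'a
  proof (induction c)
    case (Suc c)
    have "z ^ (m ^ (a * Suc c)) = (z ^ (m ^ a)) ^ (m ^ (a*c))" by (simp add: power_add power_mult)
    thus ?case using Suc z by simp
  qed simp
  thus ?thesis by (auto simp: GF_def b)
qed

lemma card_GF:
  assumes "n \<ge> 1"
  shows "card (GF (2 ^ n) :: universe set) = 2 ^ n" "finite (GF (2 ^ n) :: universe set)"
proof -
  define P :: "universe poly" where "P = monom 1 (2^n) + monom 1 1"
  have n2: "(2::nat) ^ n > 1" using one_less_power[of "2::nat" n] assms by auto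
  have eq: "GF (2^n) = {x. poly P x = 0}"
    by (auto simp: P_def poly_monom GF_def)
  have deg: "degree P = 2 ^ n" unfolding P_def using n2
    by (subst degree_add_eq_left) (simp_all add: degree_monom_eq)
  have "pderiv P = 1"
    using assms unfolding P_def by (simp add: pderiv_add pderiv_monom two_eq_0_universe power_0_left)
  hence "rsquarefree P" by (intro rsquarefree_if_separable) auto
  from card_roots_rsquarefree[OF this] show "card (GF (2 ^ n) :: universe set) = 2 ^ n"
    by (simp add: eq deg)
  thus "finite (GF (2 ^ n) :: universe set)" by (metis card.infinite power_not_zero zero_neq_numeral)
qed

section \<open>Trace and additive characters\<close>

lemma trace_GF2_eq: "trace_GF2 (2 ^ m) z = (\<Sum>i<m. z ^ (2 ^ i))"
  unfolding trace_GF2_def by (rule sum.cong) auto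

lemma trace_add: "trace_GF2 (2^m) ((a::universe) + b) = trace_GF2 (2^m) a + trace_GF2 (2^m) b"
  by (simp add: trace_GF2_eq frob_add sum.distrib)

lemma trace_0 [simp]: "trace_GF2 (2^m) 0 = 0"
  by (simp add: trace_GF2_eq power_0_left)

lemma trace_sum: "trace_GF2 (2^m) (sum (f :: 'b \<Rightarrow> universe) A) = (\<Sum>i\<in>A. trace_GF2 (2^m) (f i))"
  by (induction A rule: infinite_finite_induct) (auto simp: trace_add)

lemma trace_square:
  assumes "z \<in> GF (2^m)" shows "trace_GF2 (2^m) ((z::universe) ^ 2) = trace_GF2 (2^m) z"
proof (cases m)
  case (Suc l)
  have "(\<Sum>i<m. (z\<^sup>2) ^ (2 ^ i)) = (\<Sum>i<m. z ^ (2 ^ Suc i))"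
    by (simp add: power_mult[symmetric])
  also have "\<dots> = (\<Sum>i<l. z ^ (2 ^ Suc i)) + z ^ (2 ^ m)" by (simp add: Suc)
  also have "\<dots> = (\<Sum>i<m. z ^ (2 ^ i))" using assms
    by (simp add: GF_def Suc sum.lessThan_Suc_shift del: sum.lessThan_Suc power_Suc)
  finally show ?thesis by (simp add: trace_GF2_eq)
next
  case 0
  show ?thesis unfolding trace_GF2_eq by (simp add: 0)
qed

lemma trace_frob:
  assumes "z \<in> GF (2^m)" shows "trace_GF2 (2^m) ((z::universe) ^ (2^i)) = trace_GF2 (2^m) z"
proof (induction i)
  case (Suc i)
  have "z ^ 2 ^ Suc i = (z ^ 2^i)^2" by (simp add: power_mult[symmetric] mult.commute)
  thus ?case using Suc trace_square GF_power[OF assms] by simp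
qed simp

lemma trace_cases:
  assumes "(z::universe) \<in> GF (2^m)"
  obtains "trace_GF2 (2^m) z = 0" | "trace_GF2 (2^m) z = 1"
proof -
  have "trace_GF2 (2^m) z ^ 2 = trace_GF2 (2^m) (z^2)"
    using frob_sum[of "\<lambda>i. z ^ 2^i" "{..<m}" 1]
    by (simp add: trace_GF2_eq power_mult[symmetric] mult.commute)
  hence "trace_GF2 (2^m) z * (trace_GF2 (2^m) z + 1) = 0"
    using trace_square[OF assms] by (simp add: power2_eq_square algebra_simps)
  thus ?thesis using that by auto
qed

text \<open>Each exponent below \<open>k * r\<close> is uniquely \<open>i * k + j\<close> with
  \<open>j < k\<close>; grouping by \<open>i\<close> is transitivity of the trace.\<close>

lemma trace_tower:
  "trace_GF2 (2^(k*r)) (z::universe) = trace_GF2 (2^k) (\<Sum>i<r. z ^ ((2^k)^i))"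
proof -
  have "(\<Sum>j<k. (\<Sum>i<r. z ^ ((2^k)^i)) ^ (2^j)) = (\<Sum>j<k. \<Sum>i<r. z ^ (2^(i*k+j)))"
    by (simp add: frob_sum power_mult[symmetric] power_add mult_ac)
  also have "\<dots> = (\<Sum>i<r. \<Sum>j<k. z ^ (2^(i*k+j)))" by (rule sum.swap)
  also have "\<dots> = (\<Sum>i<r. \<Sum>l\<in>{i*k..<i*k+k}. z ^ (2^l))"
  proof (rule sum.cong, rule refl)
    fix i
    show "(\<Sum>j<k. z ^ (2^(i*k+j))) = (\<Sum>l\<in>{i*k..<i*k+k}. z ^ (2^l))"
      by (rule sum.reindex_bij_witness[of _ "\<lambda>l. l - i * k" "\<lambda>j. i * k + j"]) auto
  qed
  also have "\<dots> = (\<Sum>l<r*k. z ^ (2^l))" by (rule sum.nat_group)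
  finally show ?thesis by (simp add: trace_GF2_eq mult.commute)
qed

text \<open>As a polynomial the trace has degree at most \<open>2 ^ (m - 1)\<close>, too small to
  vanish on the whole field.\<close>

lemma ex_trace_ne_0:
  assumes "m \<ge> 1"
  shows "\<exists>z\<in>GF (2^m). trace_GF2 (2^m) (z::universe) \<noteq> 0"
proof (rule ccontr)
  assume *: "\<not> ?thesis"
  define P :: "universe poly" where "P = (\<Sum>i<m. monom 1 (2^i))"
  have "coeff P 1 = 1"
  proof -
    have "coeff P 1 = (\<Sum>i<m. if i = 0 then 1 else 0)" unfolding P_def coeff_sum
      by (rule sum.cong) auto
    thus ?thesis using assms by simp
  qed
  hence P0: "P \<noteq> 0" by auto
  have "degree P \<le> 2^(m-1)" unfolding P_def
    by (rule degree_sum_le) (auto intro!: order.trans[OF degree_monom_le])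
  moreover have "GF (2^m) \<subseteq> {x. poly P x = 0}"
    using * by (auto simp: P_def poly_sum poly_monom trace_GF2_eq)
  hence "card (GF (2^m) :: universe set) \<le> card {x. poly P x = 0}"
    by (rule card_mono[OF poly_roots_finite[OF P0]])
  ultimately have "2^m \<le> (2::nat)^(m-1)"
    using card_poly_roots_bound[OF P0] card_GF(1)[OF assms] by linarith
  thus False using assms by (cases m) auto
qed

text \<open>Integer values make the sign of a character sum meaningful; maximal and minimal curves
  are told apart by that sign.\<close>

definition chi :: "nat \<Rightarrow> universe \<Rightarrow> int" where
  "chi m z = (if trace_GF2 (2^m) z = 0 then 1 else - 1)"

lemma chi_0 [simp]: "chi m 0 = 1" by (simp add: chi_def)
lemma chi_cases: "chi m z = 1 \<or> chi m z = -1" by (simp add: chi_def)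
lemma chi_add:
  assumes "a \<in> GF (2^m)" "b \<in> GF (2^m)" shows "chi m (a + b) = chi m a * chi m b"
  by (rule trace_cases[OF assms(1)]; rule trace_cases[OF assms(2)]; simp add: chi_def trace_add)
lemma chi_cong: "trace_GF2 (2^m) a = trace_GF2 (2^m) b \<Longrightarrow> chi m a = chi m b"
  by (simp add: chi_def)

text \<open>Translation by an element of value -1 turns the sum into its negative. It serves for
  additive characters and also for the sign of a quadratic form restricted to its radical, where the
  form is additive.\<close>

lemma sum_sign_character:
  fixes f :: "universe \<Rightarrow> int"
  assumes "finite U" and U: "\<And>a b. a \<in> U \<Longrightarrow> b \<in> U \<Longrightarrow> a + b \<in> U"
    and f: "\<And>a b. a \<in> U \<Longrightarrow> b \<in> U \<Longrightarrow> f (a + b) = f a * f b"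
    and sgn: "\<And>a. a \<in> U \<Longrightarrow> f a = 1 \<or> f a = - 1"
  shows "sum f U = (if \<forall>u\<in>U. f u = 1 then int (card U) else 0)"
proof (cases "\<forall>u\<in>U. f u = 1")
  case False
  then obtain u where u: "u \<in> U" "f u = -1" using sgn by blast
  have "sum f U = (\<Sum>a\<in>U. f (u + a))"
    by (rule sum.reindex_bij_witness[of _ "\<lambda>a. u + a" "\<lambda>a. u + a"]) (auto simp: U u)
  also have "\<dots> = - sum f U" by (simp add: f u flip: sum_negf)
  finally show ?thesis using False by auto
qed simp

lemma sum_chi_mult:
  assumes "m \<ge> 1" "a \<in> GF (2^m)"
  shows "(\<Sum>z\<in>GF (2^m). chi m (a * z)) = (if a = 0 then 2^m else 0)"
proof -
  have "(\<Sum>z\<in>GF (2^m). chi m (a * z)) =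
    (if \<forall>u\<in>GF (2^m). chi m (a * u) = 1 then int (card (GF (2^m) :: universe set)) else 0)"
    by (rule sum_sign_character)
       (auto simp: card_GF(2)[OF assms(1)] assms GF_add GF_mult distrib_left chi_add chi_cases)
  moreover have "(\<forall>u\<in>GF (2^m). chi m (a * u) = 1) \<longleftrightarrow> a = 0"
  proof (intro iffI ballI)
    assume *: "\<forall>u\<in>GF (2^m). chi m (a * u) = 1"
    show "a = 0"
    proof (rule ccontr)
      assume "a \<noteq> 0"
      obtain z :: universe where z: "z \<in> GF (2^m)" "trace_GF2 (2^m) z \<noteq> 0" using ex_trace_ne_0[OF assms(1)] by blast
      have "chi m (a * (inverse a * z)) = 1" using * GF_mult GF_inverse assms(2) z(1) by blast
      thus False using z(2) \<open>a \<noteq> 0\<close> by (simp add: chi_def mult.assoc[symmetric] split: if_splits)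
    qed
  qed simp
  ultimately show ?thesis using card_GF[OF assms(1)] by simp
qed

text \<open>The indicator of \<open>A x = v\<close> is an average of the characters of
  \<open>(A x + v) * l\<close> over \<open>l\<close>. Moving \<open>A\<close> to the other side of
  the trace pairing and summing over \<open>x\<close> first leaves only those \<open>l\<close> that
  \<open>A'\<close> kills.\<close>

lemma card_fibre_eq_char_sum:
  fixes A A' :: "universe \<Rightarrow> universe"
  assumes m: "m \<ge> 1"
    and A: "\<And>x. x \<in> GF (2^m) \<Longrightarrow> A x \<in> GF (2^m)"
    and A': "\<And>x. x \<in> GF (2^m) \<Longrightarrow> A' x \<in> GF (2^m)"
    and adj: "\<And>x l. x \<in> GF (2^m) \<Longrightarrow> l \<in> GF (2^m) \<Longrightarrow>
       trace_GF2 (2^m) (A x * l) = trace_GF2 (2^m) (x * A' l)"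
    and v: "v \<in> GF (2^m)"
  shows "int (card {x\<in>GF (2^m). A x = v}) = (\<Sum>l | l \<in> GF (2^m) \<and> A' l = 0. chi m (l * v))"
proof -
  let ?K = "GF (2^m) :: universe set"
  note fin = card_GF(2)[OF m]
  have chiA: "chi m (A x * l) = chi m (x * A' l)" if "x \<in> ?K" "l \<in> ?K" for x l
    using adj that by (auto intro: chi_cong)
  have "2^m * int (card {x\<in>?K. A x = v}) = (\<Sum>x\<in>?K. if A x = v then 2^m else 0)"
    using fin by (simp add: sum.If_cases Int_def)
  also have "\<dots> = (\<Sum>x\<in>?K. \<Sum>l\<in>?K. chi m ((A x + v) * l))"
    by (intro sum.cong refl, subst sum_chi_mult[OF m]) (auto simp: A v GF_add)
  also have "\<dots> = (\<Sum>x\<in>?K. \<Sum>l\<in>?K. chi m (l * v) * chi m (x * A' l))"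
  proof (intro sum.cong refl)
    fix x l assume *: "x \<in> ?K" "l \<in> ?K"
    have "chi m ((A x + v) * l) = chi m (l * v + A x * l)" by (simp add: algebra_simps)
    also have "\<dots> = chi m (l * v) * chi m (A x * l)" by (intro chi_add GF_mult A v *)
    finally show "chi m ((A x + v) * l) = chi m (l * v) * chi m (x * A' l)" by (simp add: chiA *)
  qed
  also have "\<dots> = (\<Sum>l\<in>?K. \<Sum>x\<in>?K. chi m (l * v) * chi m (x * A' l))" by (rule sum.swap)
  also have "\<dots> = (\<Sum>l\<in>?K. chi m (l * v) * (\<Sum>x\<in>?K. chi m (A' l * x)))"
    by (simp add: sum_distrib_left mult.commute)
  also have "\<dots> = (\<Sum>l\<in>?K. if A' l = 0 then chi m (l * v) * 2^m else 0)"
    by (intro sum.cong refl, subst sum_chi_mult[OF m]) (auto simp: A')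
  also have "\<dots> = 2^m * (\<Sum>l | l \<in> ?K \<and> A' l = 0. chi m (l * v))"
    using fin by (simp add: sum.If_cases Int_def sum_distrib_left mult.commute)
  finally show ?thesis by simp
qed

text \<open>The image of an operator is the orthogonal space of the kernel of its adjoint. All
  existence statements about additive equations below are instances, each with an explicit
  adjoint.\<close>

lemma mem_image_if_orthogonal:
  fixes A A' :: "universe \<Rightarrow> universe"
  assumes "m \<ge> 1"
    and "\<And>x. x \<in> GF (2^m) \<Longrightarrow> A x \<in> GF (2^m)"
    and "\<And>x. x \<in> GF (2^m) \<Longrightarrow> A' x \<in> GF (2^m)"
    and "\<And>x l. x \<in> GF (2^m) \<Longrightarrow> l \<in> GF (2^m) \<Longrightarrow>
       trace_GF2 (2^m) (A x * l) = trace_GF2 (2^m) (x * A' l)"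
    and "v \<in> GF (2^m)" and A'0: "A' 0 = 0"
    and orth: "\<And>l. l \<in> GF (2^m) \<Longrightarrow> A' l = 0 \<Longrightarrow> chi m (l * v) = 1"
  shows "\<exists>x\<in>GF (2^m). A x = v"
proof -
  let ?S = "{l. l \<in> GF (2^m) \<and> A' l = 0}"
  have "int (card {x\<in>GF (2^m). A x = v}) = (\<Sum>l\<in>?S. chi m (l * v))"
    by (rule card_fibre_eq_char_sum) fact+
  also have "\<dots> = int (card ?S)" using orth by simp
  also have "\<dots> > 0"
    using card_GF(2)[OF assms(1)] A'0
    by (subst of_nat_0_less_iff, subst card_gt_0_iff) (auto intro!: exI[of _ 0])
  finally have "card {x\<in>GF (2^m). A x = v} > 0" by simp
  thus ?thesis by (auto simp: card_gt_0_iff)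
qed

section \<open>Linearized polynomials\<close>

text \<open>The linearized polynomial attached to \<open>h\<close>: the variable of \<open>h\<close>
  acts as the Frobenius map \<open>z ^ p\<close>.\<close>

definition act :: "nat \<Rightarrow> universe poly \<Rightarrow> universe \<Rightarrow> universe" where
  "act p h z = (\<Sum>i\<le>degree h. coeff h i * z ^ (p ^ i))"

lemma act_bound: "degree h \<le> N \<Longrightarrow> act p h z = (\<Sum>i\<le>N. coeff h i * z ^ (p ^ i))"
  unfolding act_def by (rule sum.mono_neutral_left) (auto simp: coeff_eq_0)

lemma act_0 [simp]: "act p 0 z = 0" by (simp add: act_def)

lemma act_pCons: "act p (pCons c h) z = c * z + act p h (z ^ p)"
proof -
  have "act p (pCons c h) z = (\<Sum>i\<le>Suc (degree h). coeff (pCons c h) i * z ^ (p ^ i))"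
    by (rule act_bound) (simp add: degree_pCons_le)
  also have "\<dots> = c * z + (\<Sum>i\<le>degree h. coeff h i * z ^ (p ^ Suc i))"
    by (subst sum.atMost_Suc_shift) simp
  finally show ?thesis by (simp add: act_def power_mult[symmetric])
qed

lemma act_add_poly: "act p (h + h') z = act p h z + act p h' z"
proof -
  let ?N = "max (degree h) (degree h')"
  have "act p (h + h') z = (\<Sum>i\<le>?N. coeff (h + h') i * z ^ (p ^ i))"
    by (rule act_bound) (simp add: degree_add_le_max)
  thus ?thesis by (simp add: act_bound[of h ?N] act_bound[of h' ?N] distrib_right sum.distrib)
qed

lemma act_smult: "act p (smult c h) z = c * act p h z"
  by (simp add: act_bound[of "smult c h" "degree h"] act_def sum_distrib_left mult.assoc)

lemma act_monom_Suc_0: "act p (monom 1 n) z = z ^ (p ^ n)"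
  by (subst act_bound[of _ n]) (simp_all add: degree_monom_le sum.delta if_distrib[of "\<lambda>c. c * _"] cong: if_cong)

lemma act_1 [simp]: "act p 1 z = z"
  using act_monom_Suc_0[of p 0 z] by (simp add: monom_0 one_pCons)

lemma pderiv_sum: "pderiv (sum f A) = (\<Sum>i\<in>A. pderiv (f i))"
  by (induction A rule: infinite_finite_induct) (auto simp: pderiv_add)

context
  fixes k p :: nat
  assumes p: "p = 2 ^ k"
begin

lemma frob_add_p: "((a::universe) + b) ^ (p ^ i) = a ^ (p ^ i) + b ^ (p ^ i)"
  by (simp add: p power_mult[symmetric] frob_add)

lemma frob_sum_p: "(sum (f :: 'b \<Rightarrow> universe) A) ^ (p ^ n) = (\<Sum>i\<in>A. f i ^ (p ^ n))"
  by (simp add: p power_mult[symmetric] frob_sum)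

lemma frob_inj_p: "(a::universe) ^ (p ^ n) = b ^ (p ^ n) \<longleftrightarrow> a = b"
  by (simp add: p power_mult[symmetric] frob_inj)

lemma frob_0_p: "(0::universe) ^ (p ^ n) = 0"
  by (simp add: p)

lemma act_add: "act p h (x + y) = act p h x + act p h y"
  by (simp add: act_def frob_add_p distrib_left sum.distrib)

lemma act_zero [simp]: "act p h 0 = 0"
  by (simp add: act_def frob_0_p)

lemma GF_p_power: "c \<in> GF p \<Longrightarrow> c ^ (p ^ i) = (c::universe)"
  by (induction i) (auto simp: GF_def power_mult)

lemma act_frob:
  assumes "\<And>i. coeff h i \<in> GF p"
  shows "act p h (z ^ (p ^ j)) = act p h z ^ (p ^ j)"
  by (simp add: act_def frob_sum_p power_mult_distrib GF_p_power[OF assms] power_mult[symmetric] mult.commute)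

text \<open>Products become compositions because coefficients in \<open>GF p\<close> commute with
  the Frobenius map.\<close>

lemma act_mult:
  assumes "\<And>i. coeff h i \<in> GF p"
  shows "act p (h' * h) z = act p h' (act p h z)"
proof (induction h' arbitrary: z)
  case (pCons c h')
  have "act p h (z ^ p) = act p h z ^ p" using act_frob[OF assms, of z 1] by simp
  thus ?case using pCons.IH[of "z ^ p"] by (simp add: act_add_poly act_smult act_pCons)
qed simp

lemma act_GF:
  assumes "\<And>i. coeff h i \<in> GF (p ^ r)" "z \<in> GF (p ^ r)"
  shows "act p h z \<in> GF (p ^ r)"
  using assms unfolding act_def p power_mult[symmetric]
  by (intro GF_sum GF_mult GF_power)

lemma coeff_reflect: "i \<le> degree h \<Longrightarrow> coeff (reflect_poly h) i = coeff h (degree h - i)"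
  by (simp add: coeff_reflect_poly)

lemma trace_frob_p:
  assumes "z \<in> GF (p^r)" shows "trace_GF2 (p^r) ((z::universe) ^ (p^i)) = trace_GF2 (p^r) z"
  using assms trace_frob[of z "k*r" "k*i"] by (simp add: p power_mult[symmetric])

lemma trace_sum_p: "trace_GF2 (p^r) (sum (f :: 'b \<Rightarrow> universe) A) = (\<Sum>i\<in>A. trace_GF2 (p^r) (f i))"
  using trace_sum[of "k*r" f A] by (simp add: p power_mult[symmetric])

lemma trace_add_p: "trace_GF2 (p^r) ((a::universe) + b) = trace_GF2 (p^r) a + trace_GF2 (p^r) b"
  using trace_add[of "k*r"] by (simp add: p power_mult[symmetric])

lemma GF_p_subset: "r \<ge> 1 \<Longrightarrow> (GF p :: universe set) \<subseteq> GF (p ^ r)"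
  using GF_mono[of 1 r p] by simp

lemma GF_add_p: "a \<in> GF (p^n) \<Longrightarrow> b \<in> GF (p^n) \<Longrightarrow> (a::universe) + b \<in> GF (p^n)"
  using GF_add[of a "k*n" b] by (simp add: p power_mult[symmetric])

text \<open>The adjoint of the power \<open>p ^ i\<close> is its inverse. Raising the second
  argument to the power \<open>p ^ degree h\<close> clears these inverses, and what remains has the
  coefficients of \<open>h\<close> in reverse order.\<close>

lemma act_adjoint:
  assumes r: "r \<ge> 1" and h: "\<And>i. coeff h i \<in> GF p" and x: "x \<in> GF (p^r)" and y: "y \<in> GF (p^r)"
  shows "trace_GF2 (p^r) (act p h x * y ^ (p ^ degree h)) = trace_GF2 (p^r) (x * act p (reflect_poly h) y)"
proof -
  let ?d = "degree h"
  have hr: "coeff h i \<in> GF (p ^ r)" for i using h GF_p_subset[OF r] by auto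
  have "trace_GF2 (p^r) (act p h x * y ^ (p ^ ?d))
      = (\<Sum>i\<le>?d. trace_GF2 (p^r) (coeff h i * x ^ (p ^ i) * y ^ (p ^ ?d)))"
    by (simp add: act_def sum_distrib_right trace_sum_p)
  also have "\<dots> = (\<Sum>i\<le>?d. trace_GF2 (p^r) (x * (coeff h i * y ^ (p ^ (?d - i)))))"
  proof (rule sum.cong, rule refl)
    fix i assume "i \<in> {..?d}"
    hence i: "p ^ ?d = p ^ (?d - i) * p ^ i" by (simp flip: power_add)
    have "coeff h i * x ^ (p ^ i) * y ^ (p ^ ?d) = (x * (coeff h i * y ^ (p ^ (?d - i)))) ^ (p ^ i)"
      unfolding i by (simp add: power_mult_distrib GF_p_power[OF h] power_mult)
    thus "trace_GF2 (p^r) (coeff h i * x ^ (p ^ i) * y ^ (p ^ ?d)) = trace_GF2 (p^r) (x * (coeff h i * y ^ (p ^ (?d - i))))"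
      by (simp only:) (intro trace_frob_p GF_mult GF_power x y hr)
  qed
  also have "\<dots> = (\<Sum>i\<le>?d. trace_GF2 (p^r) (x * (coeff h (?d - i) * y ^ (p ^ i))))"
    by (rule sum.reindex_bij_witness[of _ "\<lambda>i. ?d - i" "\<lambda>i. ?d - i"]) auto
  also have "\<dots> = trace_GF2 (p^r) (x * (\<Sum>i\<le>?d. coeff (reflect_poly h) i * y ^ (p ^ i)))"
    by (simp add: sum_distrib_left trace_sum_p coeff_reflect)
  also have "(\<Sum>i\<le>?d. coeff (reflect_poly h) i * y ^ (p ^ i)) = act p (reflect_poly h) y"
    by (rule act_bound[symmetric]) (rule degree_reflect_poly_le)
  finally show ?thesis .
qed

text \<open>The derivative of a linearized polynomial is constant, so it is separable.\<close>

lemma card_kernel_act: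
  assumes "k \<ge> 1" "coeff h 0 \<noteq> 0"
  shows "card {z. act p h z = 0} = p ^ degree h" "finite {z. act p h z = 0}"
proof -
  define P where "P = (\<Sum>i\<le>degree h. monom (coeff h i) (p ^ i))"
  have p2: "even p" "p > 1" using assms(1) one_less_power[of "2::nat" k] by (simp_all add: p)
  have P: "poly P z = act p h z" for z by (simp add: P_def poly_sum poly_monom act_def)
  have coeff_P: "coeff P (p ^ j) = coeff h j" for j
  proof -
    have "coeff P (p ^ j) = (\<Sum>i\<le>degree h. if i = j then coeff h i else 0)"
      unfolding P_def coeff_sum using p2 by (intro sum.cong) auto
    thus ?thesis by (simp add: coeff_eq_0)
  qed
  have h0: "h \<noteq> 0" using assms(2) by auto
  have "degree P \<le> p ^ degree h" unfolding P_def
    using p2 by (intro degree_sum_le) (auto intro!: order.trans[OF degree_monom_le] power_increasing)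
  moreover have "degree P \<ge> p ^ degree h" using h0 by (intro le_degree) (simp add: coeff_P)
  ultimately have deg: "degree P = p ^ degree h" by simp
  have P0: "P \<noteq> 0" using coeff_P[of 0] assms(2) by auto
  have "pderiv P = (\<Sum>i\<le>degree h. if i = 0 then [:coeff h 0:] else 0)" unfolding P_def pderiv_sum
  proof (rule sum.cong, rule refl)
    fix i
    have "(of_nat (p ^ i) :: universe) = 0" if "i > 0"
    proof -
      have "even (p ^ i)" using p2 that by simp
      then obtain c where "p ^ i = 2 * c" by blast
      thus ?thesis by (simp add: two_eq_0_universe)
    qed
    thus "pderiv (monom (coeff h i) (p ^ i)) = (if i = 0 then [:coeff h 0:] else 0)"
      by (auto simp: pderiv_monom monom_0)
  qed
  hence "poly (pderiv P) z \<noteq> 0" for z using assms(2) by (simp add: if_distrib)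
  hence "rsquarefree P" using P0 by (intro rsquarefree_if_separable)
  from card_roots_rsquarefree[OF this] show "card {z. act p h z = 0} = p ^ degree h"
    by (simp add: P deg)
  show "finite {z. act p h z = 0}" using poly_roots_finite[OF P0] by (simp add: P)
qed

text \<open>For nonzero \<open>h\<close> the linearized polynomial has ordinary degree
  \<open>p ^ degree h\<close>, which bounds its zeros.\<close>

lemma act_many_zeros:
  assumes "k \<ge> 1" "degree h < d" "finite Z" "card Z \<ge> p ^ d" "\<And>z. z \<in> Z \<Longrightarrow> act p h z = 0"
  shows "h = 0"
proof (rule ccontr)
  assume h0: "h \<noteq> 0"
  define P where "P = (\<Sum>i\<le>degree h. monom (coeff h i) (p ^ i))"
  have p2: "p > 1" using assms(1) one_less_power[of "2::nat" k] by (simp add: p)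
  have P: "poly P z = act p h z" for z by (simp add: P_def poly_sum poly_monom act_def)
  have "coeff P (p ^ degree h) = (\<Sum>i\<le>degree h. if i = degree h then coeff h i else 0)"
    unfolding P_def coeff_sum using p2 by (intro sum.cong) auto
  hence P0: "P \<noteq> 0" using h0 by auto
  have "degree P \<le> p ^ degree h" unfolding P_def
    using p2 by (intro degree_sum_le) (auto intro!: order.trans[OF degree_monom_le] power_increasing)
  moreover have "card Z \<le> card {x. poly P x = 0}"
    using assms(5) by (intro card_mono poly_roots_finite[OF P0]) (auto simp: P)
  moreover have "p ^ degree h < p ^ d" using p2 assms(2) by simp
  ultimately show False using card_poly_roots_bound[OF P0] assms(4) by linarith
qed

end

lemma rsquarefree_dvd:
  fixes P H :: "'a :: alg_closed_field poly"
  assumes "rsquarefree P" and roots: "\<And>x. poly P x = 0 \<Longrightarrow> poly H x = 0"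
  shows "P dvd H"
proof (cases "H = 0")
  case False
  have P0: "P \<noteq> 0" using assms by (auto simp: rsquarefree_def)
  have prod_dvd: "(\<Prod>a\<in>S. [:-a, 1:]) dvd H" if "finite S" "\<And>x. x \<in> S \<Longrightarrow> poly H x = 0" for S
    using that
  proof (induction S rule: finite_induct)
    case (insert a S)
    then obtain H' where H': "H = (\<Prod>a\<in>S. [:-a, 1:]) * H'" by (auto elim: dvdE)
    have "poly (\<Prod>a\<in>S. [:-a, 1:]) a \<noteq> 0" using insert by (auto simp: poly_prod)
    hence "poly H' a = 0" using insert.prems[of a] H' by simp
    hence "[:-a, 1:] dvd H'" by (simp add: poly_eq_0_iff_dvd)
    hence "[:-a, 1:] * (\<Prod>a\<in>S. [:-a, 1:]) dvd H' * (\<Prod>a\<in>S. [:-a, 1:])" by (rule mult_dvd_mono) simp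
    thus ?case by (simp only: H' prod.insert[OF insert.hyps(1,2)] mult.commute[of H'])
  qed simp
  define S where "S = {x. poly P x = 0}"
  have fin: "finite S" unfolding S_def by (rule poly_roots_finite[OF P0])
  obtain A where A: "size A = degree P" "P = smult (lead_coeff P) (\<Prod>x\<in>#A. [:- x, 1:])"
    using alg_closed_imp_factorization[OF P0] by auto
  have "poly P x = 0 \<longleftrightarrow> x \<in># A" for x
    by (subst A(2)) (use P0 in \<open>auto simp: poly_prod_mset prod_mset_zero_iff\<close>)
  hence "S = set_mset A" by (auto simp: S_def)
  moreover have "card S = size A" using card_roots_rsquarefree[OF assms(1)] A(1) by (simp add: S_def)
  ultimately have "A = mset_set S"
    by (metis fin mset_set_set_mset_msubset finite_set_mset size_mset_set mset_subset_size subset_mset.le_less less_irrefl)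
  hence "P = smult (lead_coeff P) (\<Prod>x\<in>S. [:- x, 1:])" using A(2) by (simp add: prod_unfold_prod_mset)
  moreover have "(\<Prod>x\<in>S. [:- x, 1:]) dvd H" by (rule prod_dvd[OF fin]) (auto simp: S_def roots)
  ultimately show ?thesis by (metis P0 leading_coeff_0_iff smult_dvd_iff)
qed auto

section \<open>The quadratic form of the curve\<close>

lemma inv_frobenius_power: "inv_frobenius (2 ^ n) z ^ (2 ^ n) = z"
  unfolding inv_frobenius_def
proof (rule theI')
  obtain w :: universe where "w ^ (2 ^ n) = z" using nth_root_exists[of "2^n" z] by auto
  thus "\<exists>!w. w ^ (2 ^ n) = z" by (intro ex1I[of _ w]) (auto simp: frob_inj)
qed

lemma GF_if_power_in_GF:
  assumes "(w::universe) ^ (2 ^ n) \<in> GF q" shows "w \<in> GF q"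
proof -
  have "(w ^ q) ^ (2 ^ n) = w ^ (2 ^ n)" using assms by (simp add: GF_def flip: power_mult) (metis mult.commute)
  thus ?thesis by (simp add: frob_inj GF_def)
qed

text \<open>Splitting off the zero 1 of \<open>f\<close> exposes the factor \<open>x^2 + 1\<close>
  of \<open>g\<close>; it is the origin of the field \<open>GF (p ^ 2)\<close> in the computation of
  the sign.\<close>

locale quadric =
  fixes k p e :: nat and f f1 :: "universe poly"
  assumes k: "k \<ge> 1" and p: "p = 2 ^ k" and f1: "\<And>i. coeff f1 i \<in> GF p"
    and f: "f = [:1, 1:] * f1" and deg_f: "degree f = e" and f0: "coeff f 0 \<noteq> 0" and sqf: "rsquarefree f"
begin

definition "D = degree f1"
definition "f1' = reflect_poly f1"
definition "g = f * reflect_poly f"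
definition "a i = coeff g (e + i)"
definition "Rf z = (\<Sum>i=1..e. a i * z ^ (p ^ i))"
definition "E z = Rf z + (\<Sum>i=1..e. inv_frobenius (p ^ i) (a i * z))"
definition "G = f1 * f1'"
text \<open>The exponent inverts squaring on \<open>GF p\<close>, so this is the square root of the
  coefficient of \<open>G\<close> just above the middle one.\<close>

definition "c0 = coeff G (Suc D) ^ (2 ^ (k - 1))"

lemma p_gt_1: "p > 1" using k one_less_power[of "2::nat" k] by (simp add: p)

lemma f_nz: "f \<noteq> 0" using f0 by (metis coeff_0)
lemma f1_0: "f1 \<noteq> 0" using f f0 by auto
lemma f10: "coeff f1 0 \<noteq> 0" using f f0 by simp
lemma e_eq: "e = Suc D"
  using f1_0 unfolding deg_f[symmetric] f D_def by (subst degree_mult_eq) auto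
lemma degree_f1': "degree f1' = D" using f10 by (simp add: f1'_def D_def)
lemma f1': "coeff f1' i \<in> GF p"
  using f1 p_gt_1 by (auto simp: f1'_def coeff_reflect_poly)
lemma coeff_f1': "i \<le> D \<Longrightarrow> coeff f1' i = coeff f1 (D - i)"
  by (simp add: f1'_def D_def coeff_reflect_poly)
lemma reflect_f1': "reflect_poly f1' = f1" using f10 by (simp add: f1'_def)
lemma f1'_nz: "f1' \<noteq> 0" using f1_0 by (simp add: f1'_def)
lemma degree_G: "degree G = 2 * D"
  unfolding G_def using f1_0 f1'_nz by (subst degree_mult_eq) (auto simp: degree_f1' D_def)
lemma reflect_G: "reflect_poly G = G"
  by (simp add: G_def reflect_poly_mult reflect_f1' mult.commute) (simp add: f1'_def)
lemma coeff_G: "coeff G i \<in> GF p"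
  unfolding G_def coeff_mult p by (intro GF_sum GF_mult f1[unfolded p] f1'[unfolded p])
lemma coeff_G_sym: "m \<le> D \<Longrightarrow> coeff G (D - m) = coeff G (D + m)"
  using coeff_reflect_poly[of G "D - m"] by (simp add: reflect_G degree_G)

lemma g_eq: "g = [:1, 0, 1:] * G"
proof -
  have rf: "reflect_poly f = [:1, 1:] * f1'"
    by (simp only: f reflect_poly_mult f1'_def) (simp add: reflect_poly_def)
  have "g = ([:1, 1:] * f1) * ([:1, 1:] * f1')" unfolding g_def rf by (simp only: f[symmetric])
  hence "g = ([:1, 1:] * [:1, 1:]) * G" by (simp only: G_def mult_ac)
  thus ?thesis by simp
qed

lemma degree_g: "degree g = 2 * e"
  unfolding g_def using f0 deg_f by (subst degree_mult_eq) auto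

lemma coeff_g: "coeff g i \<in> GF p"
proof -
  have "coeff f j \<in> GF p" for j
    unfolding f p using f1[unfolded p] by (cases j) (auto intro: GF_add)
  moreover have "coeff (reflect_poly f) j \<in> GF p" for j
    using calculation p_gt_1 by (auto simp: coeff_reflect_poly)
  ultimately show ?thesis unfolding g_def coeff_mult p by (intro GF_sum GF_mult)
qed

lemma reflect_g: "reflect_poly g = g"
  using f0 by (simp add: g_def reflect_poly_mult mult.commute)

lemma coeff_g_sym: "m \<le> e \<Longrightarrow> coeff g (e - m) = coeff g (e + m)"
  using coeff_reflect_poly[of g "e - m"] by (simp add: reflect_g degree_g)

lemma coeff_g0: "coeff g 0 \<noteq> 0"
  using f0 f_nz by (simp add: g_def coeff_mult)

lemma coeff_g_eq: "coeff g (Suc (Suc j)) = coeff G (Suc (Suc j)) + coeff G j"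
  by (simp add: g_eq)

lemma a_eq:
  assumes "i \<ge> 1" shows "a i = coeff G (D + i + 1) + coeff G (D + i - 1)"
proof -
  have eq: "e + i = Suc (Suc (D + i - 1))" using assms e_eq by arith
  show ?thesis unfolding a_def eq using assms coeff_g_eq[of "D + i - 1"] by simp
qed

text \<open>The two neighbours of the middle coefficient of the palindromic \<open>G\<close> are
  equal and cancel in characteristic 2.\<close>

lemma coeff_g_e: "coeff g e = 0"
proof (cases D)
  case 0
  hence "coeff G (Suc 0) = 0" using degree_G by (intro coeff_eq_0) simp
  thus ?thesis using 0 by (simp add: e_eq g_eq)
next
  case (Suc d)
  have "coeff G (D - 1) = coeff G (D + 1)" using coeff_G_sym[of 1] Suc by simp
  thus ?thesis using coeff_g_eq[of d] Suc by (simp add: e_eq)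
qed

lemma a_GF: "a i \<in> GF p" by (simp add: a_def coeff_g)

lemma a_e: "a e \<noteq> 0"
  using coeff_g0 coeff_g_sym[of e] by (simp add: a_def)

text \<open>The middle coefficient of a polynomial times its reflection is the sum of the squares of
  the coefficients, and squaring is additive.\<close>

lemma sum_coeff_f1: "poly f1 1 ^ 2 = coeff G D"
proof -
  have "poly f1 1 = (\<Sum>i\<le>D. coeff f1 i)" by (simp add: poly_altdef D_def)
  hence "poly f1 1 ^ 2 = (\<Sum>i\<le>D. coeff f1 i ^ 2)" using frob_sum[of _ _ 1] by simp
  also have "\<dots> = (\<Sum>i\<le>D. coeff f1 i * coeff f1' (D - i))"
    by (intro sum.cong) (auto simp: coeff_f1' power2_eq_square)
  finally show ?thesis by (simp add: G_def coeff_mult)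
qed

text \<open>By \<open>a_eq\<close> the sum of the \<open>a i\<close> telescopes, with step 2, to the
  two lowest terms.\<close>

lemma Rf_1: "Rf 1 = coeff G D + coeff G (Suc D)"
proof -
  have "(\<Sum>i=1..n. a i) = coeff G D + coeff G (Suc D) + coeff G (D + n) + coeff G (D + n + 1)" for n
    by (induction n) (simp_all add: a_eq algebra_simps)
  from this[of e] have "(\<Sum>i=1..e. a i) = coeff G D + coeff G (Suc D)"
    using degree_G by (simp add: coeff_eq_0 e_eq)
  thus ?thesis by (simp add: Rf_def)
qed

lemma c0_GF: "c0 \<in> GF p" unfolding c0_def by (intro GF_power coeff_G)

lemma c0_sq: "c0 ^ 2 = coeff G (Suc D)"
proof -
  have "(2::nat) ^ (k - 1) * 2 = p" using k by (cases k) (simp_all add: p)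
  thus ?thesis using coeff_G[of "Suc D"] by (simp add: c0_def GF_def flip: power_mult)
qed

text \<open>Here \<open>f'(1) = f1(1)\<close>, whose square is the middle coefficient of
  \<open>G\<close>, while \<open>c0 ^ 2\<close> is the next one; their sum is \<open>R(1)\<close>.
  This identifies the leftover of \<open>tr_quadratic\<close> with the constant of the
  theorem.\<close>

lemma c0_eq: "c0 = (THE w. w \<in> GF p \<and> w ^ 2 = Rf 1) + poly (pderiv f) 1"
proof -
  have eq: "poly (pderiv f) 1 = poly f1 1"
    unfolding f pderiv_mult by (simp add: pderiv_pCons)
  have "(c0 + poly f1 1) ^ 2 = c0 ^ 2 + poly f1 1 ^ 2"
    using frob_add[of c0 "poly f1 1" 1] by (simp only: power_one_right)
  hence "(c0 + poly f1 1) ^ 2 = Rf 1"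
    by (simp only: c0_sq sum_coeff_f1 Rf_1 add.commute)
  moreover have "c0 + poly f1 1 \<in> GF p"
    unfolding p poly_altdef using f1 c0_GF by (intro GF_add GF_sum GF_mult GF_power) (simp_all add: p)
  ultimately have "(THE w. w \<in> GF p \<and> w ^ 2 = Rf 1) = c0 + poly f1 1"
    using frob_inj[of _ 1, unfolded power_one_right] by (intro the_equality) (auto, metis)
  thus ?thesis by (simp add: eq add.assoc)
qed

text \<open>Otherwise 1 would be a double zero of \<open>f\<close>. This keeps \<open>F1\<close>
  injective on \<open>GF (p ^ 2)\<close> later on.\<close>

lemma f1_1: "poly f1 1 \<noteq> 0"
proof
  assume "poly f1 1 = 0"
  hence "[:-1, 1:] dvd f1" by (simp only: poly_eq_0_iff_dvd)
  then obtain h where h: "f1 = [:-1,1:] * h" by (rule dvdE)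
  have "f = [:-1, 1:] * f1" by (subst f) simp
  hence "f = [:-1, 1:]^2 * h" by (simp only: h power2_eq_square mult.assoc)
  hence "[:-1, 1:]^2 dvd f" by (rule dvdI)
  hence "order 1 f \<ge> 2" using order_divides[of 1 2 f] f_nz by blast
  thus False using sqf by (auto simp: rsquarefree_def dest: spec[of _ 1])
qed

lemma Rf_add: "Rf (x + y) = Rf x + Rf y"
  by (simp add: Rf_def frob_add_p[OF p] distrib_left sum.distrib)

lemma inv_frob: "inv_frobenius (p ^ i) z ^ (p ^ i) = z"
  using inv_frobenius_power[of "k*i" z] by (simp add: p power_mult)

text \<open>The power \<open>p ^ e\<close> clears the inverse Frobenius powers of \<open>E\<close>;
  the palindromic shape of \<open>g\<close> supplies its lower half, and the vanishing middle
  coefficient fills the gap.\<close>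

lemma E_power: "E z ^ (p ^ e) = act p g z"
proof -
  have gi: "(\<Sum>i=1..e. a i * z ^ (p ^ i)) ^ (p ^ e) = (\<Sum>i=1..e. coeff g (e + i) * z ^ (p ^ (e + i)))"
    by (simp add: frob_sum_p[OF p] power_mult_distrib GF_p_power[OF p a_GF] power_add mult.commute flip: power_mult a_def)
  have inv: "inv_frobenius (p ^ i) (a i * z) ^ (p ^ e) = coeff g (e - i) * z ^ (p ^ (e - i))" if "i \<in> {1..e}" for i
  proof -
    have "p ^ e = p ^ i * p ^ (e - i)" using that by (simp flip: power_add)
    hence "inv_frobenius (p ^ i) (a i * z) ^ (p ^ e) = (a i * z) ^ (p ^ (e - i))"
      by (simp only: power_mult inv_frob)
    thus ?thesis using that by (simp add: power_mult_distrib GF_p_power[OF p coeff_g] coeff_g_sym a_def)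
  qed
  have "E z ^ (p ^ e) = (\<Sum>i=1..e. coeff g (e + i) * z ^ (p ^ (e + i))) + (\<Sum>i=1..e. coeff g (e - i) * z ^ (p ^ (e - i)))"
    unfolding E_def Rf_def frob_add_p[OF p] gi by (simp only: frob_sum_p[OF p]) (simp add: inv)
  also have "(\<Sum>i=1..e. coeff g (e - i) * z ^ (p ^ (e - i))) = (\<Sum>j<e. coeff g j * z ^ (p ^ j))"
    by (rule sum.reindex_bij_witness[of _ "\<lambda>j. e - j" "\<lambda>j. e - j"]) auto
  also have "(\<Sum>i=1..e. coeff g (e + i) * z ^ (p ^ (e + i))) = (\<Sum>j=Suc e..2*e. coeff g j * z ^ (p ^ j))"
    by (rule sum.reindex_bij_witness[of _ "\<lambda>j. j - e" "\<lambda>j. e + j"]) auto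
  also have "(\<Sum>j=Suc e..2*e. coeff g j * z ^ (p ^ j)) + (\<Sum>j<e. coeff g j * z ^ (p ^ j)) = (\<Sum>j\<le>2*e. coeff g j * z ^ (p ^ j))"
  proof -
    have "{..2*e} = {Suc e..2*e} \<union> ({..<e} \<union> {e})" by auto
    thus ?thesis by (subst \<open>{..2*e} = _\<close>, subst sum.union_disjoint) (auto simp: coeff_g_e)
  qed
  finally show ?thesis by (simp add: act_def degree_g)
qed

lemma E_0_iff: "E z = 0 \<longleftrightarrow> act p g z = 0"
  using E_power[of z] p_gt_1 by (metis frob_inj_p[OF p] frob_0_p[OF p])

lemma E_add: "E (x + y) = E x + E y"
proof -
  have "E (x + y) ^ (p ^ e) = (E x + E y) ^ (p ^ e)"
    by (simp only: frob_add_p[OF p] E_power act_add[OF p])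
  thus ?thesis by (simp only: frob_inj_p[OF p])
qed

lemma E_0 [simp]: "E 0 = 0" by (simp only: E_0_iff act_zero[OF p])

text \<open>The least \<open>n\<close> of the statement exists because Frobenius permutes the finite kernel.\<close>

lemma g_dvd_iff:
  assumes "r \<ge> 1"
  shows "g dvd monom 1 r + 1 \<longleftrightarrow> {z. act p g z = 0} \<subseteq> GF (p ^ r)"
proof
  have act_eq: "act p (monom 1 r + 1) z = z ^ (p ^ r) + z" for z
    by (simp add: act_add_poly act_monom_Suc_0)
  {
    assume "g dvd monom 1 r + 1"
    then obtain h where "monom 1 r + 1 = g * h" by (rule dvdE)
    hence h: "monom 1 r + 1 = h * g" by (simp only: mult.commute)
    show "{z. act p g z = 0} \<subseteq> GF (p ^ r)"
    proof
      fix z assume "z \<in> {z. act p g z = 0}"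
      hence "z ^ (p ^ r) + z = 0"
        unfolding act_eq[symmetric] h act_mult[OF p coeff_g] by (simp add: act_zero[OF p])
      thus "z \<in> GF (p ^ r)" by (simp add: GF_def)
    qed
  }
  assume sub: "{z. act p g z = 0} \<subseteq> GF (p ^ r)"
  \<comment> \<open>The remainder kills the \<open>p ^ (2 * e)\<close> zeros of \<open>g\<close> but
    has degree below \<open>2 * e\<close>, so it is 0.\<close>
  define \<rho> where "\<rho> = (monom 1 r + 1) mod g"
  have dec: "monom 1 r + 1 = ((monom 1 r + 1) div g) * g + \<rho>" by (simp add: \<rho>_def)
  have "\<rho> = 0"
  proof (rule ccontr)
    assume "\<rho> \<noteq> 0"
    hence "degree \<rho> < 2 * e"
      using degree_mod_less[of g "monom 1 r + 1"] coeff_g0 degree_g unfolding \<rho>_def by (metis coeff_0)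
    moreover have "act p \<rho> z = 0" if "act p g z = 0" for z
    proof -
      have "act p (monom 1 r + 1) z = act p \<rho> z"
        by (subst dec) (simp add: act_add_poly act_mult[OF p coeff_g] that act_zero[OF p])
      thus ?thesis using that sub by (auto simp: act_eq GF_def)
    qed
    ultimately have "\<rho> = 0"
      using card_kernel_act[OF p k coeff_g0] degree_g
      by (intro act_many_zeros[OF p k, of \<rho> "2*e" "{z. act p g z = 0}"]) auto
    thus False using \<open>\<rho> \<noteq> 0\<close> by simp
  qed
  thus "g dvd monom 1 r + 1" by (simp add: \<rho>_def dvd_eq_mod_eq_0)
qed

lemma ex_order: "\<exists>n\<ge>1. g dvd monom 1 n + 1"
proof -
  define Z where "Z = {z. act p g z = 0}"
  have finZ: "finite Z" unfolding Z_def by (rule card_kernel_act[OF p k coeff_g0])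
  have step: "z ^ (p ^ i) \<in> Z" if "z \<in> Z" for z i
    using that frob_0_p[OF p] by (simp add: Z_def act_frob[OF p coeff_g])
  have ex1: "\<exists>i\<ge>1. z ^ (p ^ i) = z" if z: "z \<in> Z" for z
  proof -
    have "\<not> inj_on (\<lambda>i. z ^ (p ^ i)) (UNIV :: nat set)"
      using step[OF z] finite_imageD[of "\<lambda>i. z ^ (p ^ i)" UNIV] finite_subset[OF _ finZ]
      by (metis image_subsetI infinite_UNIV_nat)
    then obtain i j where ij: "i < j" "z ^ (p ^ i) = z ^ (p ^ j)"
      by (metis inj_onI linorder_neqE_nat)
    hence "p ^ j = p ^ (j - i) * p ^ i" by (simp flip: power_add)
    hence "(z ^ (p ^ (j - i))) ^ (p ^ i) = z ^ (p ^ i)" using ij(2) by (simp add: power_mult)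
    hence "z ^ (p ^ (j - i)) = z" by (simp only: frob_inj_p[OF p])
    thus ?thesis using ij(1) by (intro exI[of _ "j - i"]) auto
  qed
  then obtain N where N: "\<And>z. z \<in> Z \<Longrightarrow> N z \<ge> 1 \<and> z ^ (p ^ (N z)) = z" by metis
  define n where "n = (\<Prod>z\<in>Z. N z)"
  have "Z \<subseteq> GF (p ^ n)"
  proof
    fix z assume z: "z \<in> Z"
    have "N z dvd n" unfolding n_def using finZ z by (rule dvd_prodI)
    thus "z \<in> GF (p ^ n)" using GF_mono[of "N z" n p] N[OF z] by (auto simp: GF_def)
  qed
  moreover have "n \<ge> 1" unfolding n_def using N by (metis One_nat_def Suc_leI prod_pos zero_less_one order_less_le_trans)
  ultimately show ?thesis using g_dvd_iff by (auto simp: Z_def)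
qed

definition "n = (LEAST n. n \<ge> 1 \<and> g dvd monom 1 n + 1)"

lemma n: "n \<ge> 1" "g dvd monom 1 n + 1"
  using LeastI_ex[OF ex_order] by (simp_all add: n_def)

lemma n_le: "r \<ge> 1 \<Longrightarrow> g dvd monom 1 r + 1 \<Longrightarrow> n \<le> r"
  unfolding n_def by (rule Least_le) simp

text \<open>If the kernel of \<open>g\<close> is fixed by the powers \<open>p ^ n\<close> and
  \<open>p ^ r\<close> of Frobenius, it is fixed by \<open>p ^ (r mod n)\<close>; minimality of
  \<open>n\<close> leaves no room for a nonzero remainder.\<close>

lemma n_dvd_iff:
  assumes "r \<ge> 1" shows "g dvd monom 1 r + 1 \<longleftrightarrow> n dvd r"
proof
  let ?Z = "{z. act p g z = 0}"
  have Zn: "?Z \<subseteq> GF (p ^ n)" using n g_dvd_iff by blast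
  {
    assume "n dvd r"
    hence "?Z \<subseteq> GF (p ^ r)" using Zn GF_mono by blast
    thus "g dvd monom 1 r + 1" using g_dvd_iff[OF assms] by simp
  }
  assume "g dvd monom 1 r + 1"
  hence Zr: "?Z \<subseteq> GF (p ^ r)" using g_dvd_iff[OF assms] by simp
  show "n dvd r"
  proof (rule ccontr)
    assume "\<not> n dvd r"
    hence b: "r mod n \<ge> 1" "r mod n < n" using n(1) by (auto simp: dvd_eq_mod_eq_0 Suc_le_eq)
    have "z \<in> GF (p ^ (r mod n))" if z: "z \<in> ?Z" for z
    proof -
      have "z \<in> GF (p ^ (n * (r div n)))" using z Zn GF_mono[of n "n * (r div n)" p] by auto
      hence "z ^ (p ^ (n * (r div n))) = z" by (simp add: GF_def)
      moreover have "z ^ (p ^ (n * (r div n) + r mod n)) = (z ^ (p ^ (n * (r div n)))) ^ (p ^ (r mod n))"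
        by (simp only: power_add power_mult)
      ultimately have "z ^ (p ^ (n * (r div n) + r mod n)) = z ^ (p ^ (r mod n))" by simp
      thus ?thesis using z Zr by (auto simp: GF_def)
    qed
    hence "n \<le> r mod n" using b(1) g_dvd_iff by (intro n_le) auto
    thus False using b by simp
  qed
qed

end

section \<open>The form over the field with \<open>p ^ r\<close> elements and its character
  sum\<close>

context quadric
begin

context
  fixes r :: nat
  assumes r: "r \<ge> 1"
begin

abbreviation "K \<equiv> GF (p ^ r) :: universe set"
abbreviation "tr z \<equiv> trace_GF2 (p ^ r) (z :: universe)"
abbreviation "ch z \<equiv> chi (k * r) z"

lemma pr: "p ^ r = 2 ^ (k * r)" by (simp add: p power_mult)
lemma kr: "k * r \<ge> 1" using k r by simp

lemma finite_K: "finite K" and card_K: "card K = p ^ r"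
  using card_GF[OF kr] by (simp_all add: pr)

lemma K_add: "x \<in> K \<Longrightarrow> y \<in> K \<Longrightarrow> x + y \<in> K" unfolding pr by (rule GF_add)
lemma K_sum: "(\<And>i. i \<in> I \<Longrightarrow> h i \<in> K) \<Longrightarrow> sum h I \<in> K" unfolding pr by (rule GF_sum)
lemma K_0 [simp]: "0 \<in> K" using p_gt_1 by simp
lemma GFp_K: "c \<in> GF p \<Longrightarrow> c \<in> K" using GF_p_subset[OF p r] by blast
lemma ch_cong: "tr x = tr y \<Longrightarrow> ch x = ch y" by (rule chi_cong) (simp add: pr)
lemma ch_add: "x \<in> K \<Longrightarrow> y \<in> K \<Longrightarrow> ch (x + y) = ch x * ch y" unfolding pr by (rule chi_add)
lemma tr_0: "tr 0 = 0" unfolding pr by simp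
lemma tr_frob: "z \<in> K \<Longrightarrow> tr (z ^ (p ^ i)) = tr z" by (rule trace_frob_p[OF p])
lemma tr_add: "tr (x + y) = tr x + tr y" by (rule trace_add_p[OF p])
lemma tr_square: "z \<in> K \<Longrightarrow> tr (z ^ 2) = tr z" unfolding pr by (rule trace_square)
lemma sum_ch: "b \<in> K \<Longrightarrow> (\<Sum>x\<in>K. ch (b * x)) = (if b = 0 then int (p ^ r) else 0)"
  using sum_chi_mult[OF kr] by (simp add: pr)

lemma Rf_K: "z \<in> K \<Longrightarrow> Rf z \<in> K"
  unfolding Rf_def by (intro K_sum GF_mult GF_power) (auto intro: GFp_K a_GF)

lemma inv_frob_K: "z \<in> K \<Longrightarrow> inv_frobenius (p ^ i) z \<in> K"
  using inv_frob[of i z] GF_if_power_in_GF[of _ "k * i"] by (simp add: p power_mult)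

lemma E_K: "z \<in> K \<Longrightarrow> E z \<in> K"
  unfolding E_def by (intro K_add K_sum Rf_K inv_frob_K GF_mult) (auto intro: GFp_K a_GF)

lemma act_K: "(\<And>i. coeff h i \<in> GF p) \<Longrightarrow> z \<in> K \<Longrightarrow> act p h z \<in> K"
  by (rule act_GF[OF p]) (auto intro: GFp_K)

text \<open>This is the polarization of the form, so the rational zeros of \<open>E\<close> are its
  radical. The inverse Frobenius powers in \<open>E\<close> arise by moving \<open>R\<close> across
  the trace pairing.\<close>

lemma tr_polar:
  assumes x: "x \<in> K" and z: "z \<in> K"
  shows "tr (x * Rf z) + tr (z * Rf x) = tr (x * E z)"
proof -
  have "tr (a i * x ^ (p ^ i) * z) = tr (x * inv_frobenius (p ^ i) (a i * z))" for i
  proof -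
    have "(x * inv_frobenius (p ^ i) (a i * z)) ^ (p ^ i) = a i * x ^ (p ^ i) * z"
      by (simp add: power_mult_distrib inv_frob)
    thus ?thesis
      using tr_frob[of "x * inv_frobenius (p ^ i) (a i * z)" i] x z GFp_K[OF a_GF]
      by (simp add: GF_mult inv_frob_K)
  qed
  hence "tr (z * Rf x) = tr (x * (\<Sum>i=1..e. inv_frobenius (p ^ i) (a i * z)))"
    by (simp add: Rf_def sum_distrib_left trace_sum_p[OF p] mult_ac)
  thus ?thesis by (simp add: E_def distrib_left tr_add)
qed

lemma tr_E_sym: "x \<in> K \<Longrightarrow> z \<in> K \<Longrightarrow> tr (E x * z) = tr (x * E z)"
  using tr_polar[of x z] tr_polar[of z x] by (simp add: mult.commute add.commute)

text \<open>One factor \<open>F1\<close> is moved across the trace by adjunction, which leaves the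
  single polynomial \<open>G\<close> between \<open>x ^ (p ^ D)\<close> and \<open>x ^ p\<close>.
  Both halves of \<open>G\<close> are then brought to the form \<open>x * x ^ (p ^ i)\<close>; their
  sum has the coefficients \<open>a i\<close> by \<open>a_eq\<close>, up to one term that is a
  multiple of \<open>x ^ 2\<close>.\<close>

lemma tr_quadratic:
  assumes x: "x \<in> K"
  shows "tr (x * Rf x + c0 * x) = tr (act p f1 x * act p f1 x ^ p)"
proof -
  define b where "b m = tr (coeff G (D + m + 1) * (x * x ^ (p ^ m)))" for m
  define b' where "b' m = tr (coeff G (D + m) * (x * x ^ (p ^ Suc m)))" for m
  define u where "u = act p f1 x"
  have u: "u \<in> K" unfolding u_def by (rule act_K[OF f1 x])
  have Gx: "tr (coeff G j * (x * x ^ i)) = tr ((coeff G j * (x * x ^ i)) ^ (p ^ l))" for i j l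
    by (subst tr_frob) (simp_all add: GF_mult GF_power GFp_K[OF coeff_G] x)
  have "tr (u * u ^ p) = tr (act p f1 (x ^ (p ^ D)) * (u ^ p) ^ (p ^ D))"
    using tr_frob[of "u * u ^ p" D] u by (simp add: power_mult_distrib GF_mult GF_power act_frob[OF p f1] flip: u_def)
  also have "\<dots> = tr (x ^ (p ^ D) * act p f1' (u ^ p))"
    unfolding D_def f1'_def by (rule act_adjoint[OF p r f1]) (auto intro: GF_power x u)
  also have "act p f1' (u ^ p) = act p G (x ^ p)"
    using act_frob[OF p f1, of x 1] by (simp add: u_def G_def mult.commute[of f1] act_mult[OF p f1])
  also have "tr (x ^ (p ^ D) * act p G (x ^ p)) = (\<Sum>j\<le>2*D. tr (coeff G j * x ^ (p ^ D) * x ^ (p ^ Suc j)))"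
    by (simp add: act_def degree_G sum_distrib_left trace_sum_p[OF p] mult_ac flip: power_mult)
  also have "{..2*D} = {..<D} \<union> {D..2*D}" by auto
  also have "(\<Sum>j\<in>\<dots>. tr (coeff G j * x ^ (p ^ D) * x ^ (p ^ Suc j))) =
      (\<Sum>j<D. tr (coeff G j * x ^ (p ^ D) * x ^ (p ^ Suc j))) + (\<Sum>j=D..2*D. tr (coeff G j * x ^ (p ^ D) * x ^ (p ^ Suc j)))"
    by (rule sum.union_disjoint) auto
  \<comment> \<open>In the upper half the power \<open>p ^ D\<close> is common to both factors and
    is undone by the invariance of the trace.\<close>
  also have "(\<Sum>j=D..2*D. tr (coeff G j * x ^ (p ^ D) * x ^ (p ^ Suc j))) = (\<Sum>m\<le>D. b' m)"
  proof (rule sum.reindex_bij_witness[of _ "\<lambda>m. D + m" "\<lambda>j. j - D"])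
    fix j assume "j \<in> {D..2*D}"
    then obtain m where j: "j = D + m" by (auto simp: le_iff_add)
    have "b' m = tr ((coeff G (D + m) * (x * x ^ (p ^ Suc m))) ^ (p ^ D))" unfolding b'_def by (rule Gx)
    also have "\<dots> = tr (coeff G j * x ^ (p ^ D) * x ^ (p ^ Suc j))"
      by (simp add: j power_mult_distrib GF_p_power[OF p coeff_G] mult_ac power_add flip: power_mult)
    finally show "b' (j - D) = tr (coeff G j * x ^ (p ^ D) * x ^ (p ^ Suc j))" by (simp add: j)
  qed auto
  \<comment> \<open>In the lower half the common power is \<open>p ^ Suc j\<close>, and the symmetry
    of \<open>G\<close> exchanges the coefficient for one above the middle.\<close>
  also have "(\<Sum>j<D. tr (coeff G j * x ^ (p ^ D) * x ^ (p ^ Suc j))) = (\<Sum>m<D. b m)"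
  proof (rule sum.reindex_bij_witness[of _ "\<lambda>m. D - Suc m" "\<lambda>j. D - Suc j"])
    fix j assume j: "j \<in> {..<D}"
    define m where "m = D - Suc j"
    have D: "D = m + Suc j" and jm: "j = D - (m + 1)" and mD: "m + 1 \<le> D" using j by (auto simp: m_def)
    have G: "coeff G (D + m + 1) = coeff G j" using coeff_G_sym[OF mD] unfolding jm by simp
    have "b m = tr ((coeff G j * (x * x ^ (p ^ m))) ^ (p ^ Suc j))" unfolding b_def G by (rule Gx)
    also have "(coeff G j * (x * x ^ (p ^ m))) ^ (p ^ Suc j) = coeff G j * x ^ (p ^ Suc j) * x ^ (p ^ m * p ^ Suc j)"
      by (simp only: power_mult_distrib GF_p_power[OF p coeff_G] power_mult mult_ac)
    also have "p ^ m * p ^ Suc j = p ^ D" by (simp only: D power_add)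
    finally show "b (D - Suc j) = tr (coeff G j * x ^ (p ^ D) * x ^ (p ^ Suc j))" by (simp add: m_def mult_ac)
  qed auto
  also have "(\<Sum>m<D. b m) = (\<Sum>m\<le>Suc D. b m)"
    by (rule sum.mono_neutral_left) (auto simp: b_def coeff_eq_0 degree_G tr_0)
  also have "\<dots> = b 0 + (\<Sum>m\<le>D. b (Suc m))" by (rule sum.atMost_Suc_shift)
  finally have "tr (u * u ^ p) = b 0 + (\<Sum>m\<le>D. b (Suc m) + b' m)" by (simp add: sum.distrib add_ac)
  also have "(\<Sum>m\<le>D. b (Suc m) + b' m) = (\<Sum>m\<le>D. tr (a (Suc m) * (x * x ^ (p ^ Suc m))))"
    by (intro sum.cong refl, subst a_eq) (simp_all add: b_def b'_def distrib_right tr_add)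
  also have "\<dots> = (\<Sum>i=1..Suc D. tr (a i * (x * x ^ (p ^ i))))"
    by (rule sum.reindex_bij_witness[of _ "\<lambda>i. i - 1" Suc]) auto
  also have "\<dots> = tr (x * Rf x)"
    unfolding Rf_def sum_distrib_left trace_sum_p[OF p] e_eq[symmetric] by (simp add: mult_ac)
  \<comment> \<open>The unmatched term: the coefficient of \<open>G\<close> just above the middle
    times \<open>x ^ 2\<close>, which explains the definition of \<open>c0\<close>.\<close>
  also have "b 0 = tr ((c0 * x) ^ 2)" by (simp add: b_def c0_sq power_mult_distrib) (simp add: power2_eq_square)
  also have "\<dots> = tr (c0 * x)" by (intro tr_square GF_mult GFp_K c0_GF x)
  finally show ?thesis by (simp add: tr_add u_def add.commute)
qed

definition "S c = (\<Sum>x\<in>K. ch (x * Rf x + c * x ^ 2))"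
definition "W = {z\<in>K. E z = 0}"

lemma finite_W: "finite W" using finite_K by (simp add: W_def)

lemma Q_K: "c \<in> K \<Longrightarrow> x \<in> K \<Longrightarrow> x * Rf x + c * x ^ 2 \<in> K"
  by (intro K_add GF_mult Rf_K GF_power)

lemma ch_Q_add:
  assumes c: "c \<in> K" and x: "x \<in> K" and z: "z \<in> K"
  shows "ch ((x + z) * Rf (x + z) + c * (x + z) ^ 2)
    = ch (x * Rf x + c * x ^ 2) * ch (z * Rf z + c * z ^ 2) * ch (E z * x)"
proof -
  have sq: "(x + z)\<^sup>2 = x\<^sup>2 + z\<^sup>2" using frob_add[of x z 1] by (simp only: power_one_right)
  have eq: "(x + z) * Rf (x + z) + c * (x + z) ^ 2 =
      (x * Rf x + c * x ^ 2) + (z * Rf z + c * z ^ 2) + (x * Rf z + z * Rf x)"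
    unfolding sq Rf_add by (simp add: algebra_simps)
  have "ch (x * Rf z + z * Rf x) = ch (E z * x)"
    by (rule ch_cong) (simp add: tr_add tr_polar[OF x z] mult.commute)
  thus ?thesis unfolding eq using c x z by (simp add: ch_add K_add GF_mult Rf_K GF_power)
qed

text \<open>Replacing the second variable by \<open>x + z\<close> separates off the character of
  \<open>E z * x\<close>. Summation over \<open>x\<close> then confines \<open>z\<close> to the
  radical \<open>W\<close>, where the form is additive and its sign is a character.\<close>

lemma S_square:
  assumes c: "c \<in> K"
  shows "S c ^ 2 = (if \<forall>z\<in>W. ch (z * Rf z + c * z ^ 2) = 1 then int (p ^ r) * int (card W) else 0)"
proof -
  let ?Q = "\<lambda>x. x * Rf x + c * x ^ 2"
  have one: "ch z * ch z = 1" for z using chi_cases[of "k*r" z] by auto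
  have "S c ^ 2 = (\<Sum>x\<in>K. \<Sum>z\<in>K. ch (?Q x) * ch (?Q z))"
    by (simp add: power2_eq_square S_def sum_product)
  also have "\<dots> = (\<Sum>x\<in>K. \<Sum>z\<in>K. ch (?Q x) * ch (?Q (x + z)))"
  proof (rule sum.cong, rule refl)
    fix x assume x: "x \<in> K"
    show "(\<Sum>z\<in>K. ch (?Q x) * ch (?Q z)) = (\<Sum>z\<in>K. ch (?Q x) * ch (?Q (x + z)))"
      by (rule sum.reindex_bij_witness[of _ "\<lambda>z. x + z" "\<lambda>z. x + z"]) (auto simp: K_add x)
  qed
  also have "\<dots> = (\<Sum>x\<in>K. \<Sum>z\<in>K. ch (?Q z) * ch (E z * x))"
    by (intro sum.cong refl, subst ch_Q_add[OF c], assumption, assumption) (simp add: one mult.assoc[symmetric])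
  also have "\<dots> = (\<Sum>z\<in>K. ch (?Q z) * (\<Sum>x\<in>K. ch (E z * x)))"
    by (subst sum.swap) (simp add: sum_distrib_left)
  also have "\<dots> = (\<Sum>z\<in>K. if E z = 0 then ch (?Q z) * int (p ^ r) else 0)"
    by (intro sum.cong refl, subst sum_ch) (auto intro: E_K)
  also have "\<dots> = int (p ^ r) * (\<Sum>z\<in>W. ch (?Q z))"
    using finite_K by (simp add: sum.If_cases W_def Int_def sum_distrib_left mult.commute)
  also have "(\<Sum>z\<in>W. ch (?Q z)) = (if \<forall>z\<in>W. ch (?Q z) = 1 then int (card W) else 0)"
  proof (rule sum_sign_character[OF finite_W])
    show "x + y \<in> W" if "x \<in> W" "y \<in> W" for x y using that by (simp add: W_def K_add E_add)
    show "ch (?Q (x + y)) = ch (?Q x) * ch (?Q y)" if "x \<in> W" "y \<in> W" for x y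
      using that by (subst ch_Q_add[OF c]) (auto simp: W_def)
  qed (rule chi_cases)
  finally show ?thesis by simp
qed

lemma card_W: "card W \<le> p ^ (2 * e)" "card W = p ^ (2 * e) \<longleftrightarrow> n dvd r"
proof -
  let ?Z = "{z. act p g z = 0}"
  have Z: "card ?Z = p ^ (2 * e)" "finite ?Z"
    using card_kernel_act[OF p k coeff_g0] by (simp_all add: degree_g)
  have W: "W = ?Z \<inter> K" by (auto simp: W_def E_0_iff)
  show "card W \<le> p ^ (2 * e)" unfolding W Z(1)[symmetric] by (rule card_mono) (use Z in auto)
  have "card W = p ^ (2 * e) \<longleftrightarrow> ?Z \<subseteq> K"
    unfolding W Z(1)[symmetric] using card_subset_eq[OF Z(2), of "?Z \<inter> K"] by (auto simp: Int_absorb2)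
  thus "card W = p ^ (2 * e) \<longleftrightarrow> n dvd r" using n_dvd_iff[OF r] g_dvd_iff[OF r] by simp
qed

lemma S_square_extremal_iff:
  assumes c: "c \<in> K"
  shows "S c ^ 2 = int (p ^ r * p ^ (2 * e)) \<longleftrightarrow> n dvd r \<and> (\<forall>z\<in>W. ch (z * Rf z + c * z ^ 2) = 1)"
  unfolding S_square[OF c] card_W(2)[symmetric] using p_gt_1 by auto

text \<open>Translating \<open>x\<close> by \<open>u\<close> adds the linear term of
  \<open>E u * x\<close>; since the traces of \<open>d * x\<close> and of its square agree, that
  term is absorbed by replacing \<open>c0\<close> with \<open>c0 + E u\<close> under the
  square.\<close>

lemma S_translate:
  assumes u: "u \<in> K"
  shows "S ((c0 + E u) ^ 2) = ch (u * Rf u + c0 * u) * S (c0 ^ 2)"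
proof -
  have c0: "c0 \<in> K" by (rule GFp_K[OF c0_GF])
  have sq: "ch (x * Rf x + c ^ 2 * x ^ 2) = ch (x * Rf x + c * x)" if "x \<in> K" "c \<in> K" for x c
    using that tr_square[of "c * x"] by (intro ch_cong) (simp add: tr_add GF_mult power_mult_distrib)
  have one: "ch z * ch z = 1" for z using chi_cases[of "k*r" z] by auto
  have "S (c0 ^ 2) = (\<Sum>x\<in>K. ch ((x + u) * Rf (x + u) + c0 ^ 2 * (x + u) ^ 2))" unfolding S_def
    by (rule sum.reindex_bij_witness[of _ "\<lambda>x. x + u" "\<lambda>x. x + u"]) (auto simp: K_add u add.assoc)
  also have "\<dots> = (\<Sum>x\<in>K. ch (u * Rf u + c0 * u) * ch (x * Rf x + (c0 + E u) ^ 2 * x ^ 2))"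
  proof (rule sum.cong, rule refl)
    fix x assume x: "x \<in> K"
    have "ch (x * Rf x + (c0 + E u) ^ 2 * x ^ 2) = ch ((x * Rf x + c0 * x) + E u * x)"
      using x by (subst sq) (auto simp: K_add c0 E_K u algebra_simps)
    also have "\<dots> = ch (x * Rf x + c0 * x) * ch (E u * x)"
      using x c0 u by (intro ch_add K_add GF_mult Rf_K E_K)
    finally show "ch ((x + u) * Rf (x + u) + c0 ^ 2 * (x + u) ^ 2) = ch (u * Rf u + c0 * u) * ch (x * Rf x + (c0 + E u) ^ 2 * x ^ 2)"
      by (subst ch_Q_add) (auto simp: GF_power c0 x u sq)
  qed
  also have "\<dots> = ch (u * Rf u + c0 * u) * S ((c0 + E u) ^ 2)" by (simp add: S_def sum_distrib_left)
  finally show ?thesis by (simp add: mult.assoc[symmetric] one)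
qed

text \<open>Two forms that both vanish on \<open>W\<close> differ by the trace of
  \<open>(d + c0) * x\<close> with \<open>d + c0\<close> orthogonal to \<open>W\<close>. As
  \<open>E\<close> is self-adjoint with kernel \<open>W\<close>, such an element lies in its
  image.\<close>

lemma extremal_iff_image:
  assumes S0: "S (c0 ^ 2) \<noteq> 0" and c: "c \<in> K"
  shows "(\<forall>z\<in>W. ch (z * Rf z + c * z ^ 2) = 1) \<longleftrightarrow> (\<exists>u\<in>K. c = (c0 + E u) ^ 2)"
proof
  have c0: "c0 \<in> K" by (rule GFp_K[OF c0_GF])
  have W0: "ch (z * Rf z + c0 ^ 2 * z ^ 2) = 1" if "z \<in> W" for z
    using S0 S_square[of "c0 ^ 2"] that c0 by (auto simp: GF_power split: if_splits)
  {
    assume "\<exists>u\<in>K. c = (c0 + E u) ^ 2"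
    then obtain u where u: "u \<in> K" "c = (c0 + E u) ^ 2" by blast
    have "S c \<noteq> 0" using S_translate[OF u(1)] S0 chi_cases[of "k*r" "u * Rf u + c0 * u"] u(2) by auto
    thus "\<forall>z\<in>W. ch (z * Rf z + c * z ^ 2) = 1" using S_square[OF c] by (auto split: if_splits)
  }
  assume *: "\<forall>z\<in>W. ch (z * Rf z + c * z ^ 2) = 1"
  \<comment> \<open>The square root of \<open>c\<close> in \<open>K\<close>, which has
    \<open>2 ^ (k * r)\<close> elements.\<close>
  define d where "d = c ^ (2 ^ (k * r - 1))"
  have d: "d \<in> K" unfolding d_def by (rule GF_power[OF c])
  have "(2::nat) ^ (k * r - 1) * 2 = p ^ r" using kr by (cases "k * r") (simp_all add: pr)
  hence dsq: "d ^ 2 = c" using c by (simp add: d_def GF_def flip: power_mult)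
  have "\<exists>u\<in>GF (2^(k*r)). E u = d + c0"
  proof (rule mem_image_if_orthogonal[OF kr, where A' = E])
    fix l assume "l \<in> GF (2^(k*r))" "E l = 0"
    hence l: "l \<in> W" "l \<in> K" by (simp_all add: W_def pr)
    have "(l * (d + c0)) ^ 2 = (l * Rf l + c * l ^ 2) + (l * Rf l + c0 ^ 2 * l ^ 2)"
      unfolding power_mult_distrib frob_add[of d c0 1, unfolded power_one_right] dsq by (simp add: algebra_simps)
    hence "tr (l * (d + c0)) = tr ((l * Rf l + c * l ^ 2) + (l * Rf l + c0 ^ 2 * l ^ 2))"
      using tr_square[of "l * (d + c0)"] l d c0 by (simp add: GF_mult K_add)
    hence "ch (l * (d + c0)) = ch (l * Rf l + c * l ^ 2) * ch (l * Rf l + c0 ^ 2 * l ^ 2)"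
      using l c c0 by (subst ch_add[symmetric]) (auto intro!: ch_cong Q_K GF_power)
    thus "ch (l * (d + c0)) = 1" using * W0 l by simp
  qed (use E_K tr_E_sym d c0 in \<open>auto simp: K_add simp flip: pr\<close>)
  then obtain u where u: "u \<in> K" "E u = d + c0" by (auto simp: pr)
  hence "c = (c0 + E u) ^ 2" by (simp add: dsq add.left_commute)
  thus "\<exists>u\<in>K. c = (c0 + E u) ^ 2" using u(1) by blast
qed

text \<open>Each fibre of \<open>y ^ p + y\<close> is counted by the characters indexed by
  \<open>GF p\<close>. The trivial one contributes \<open>p ^ r\<close>, and the other
  \<open>p - 1\<close> all contribute the same sum.\<close>

lemma card_affine_points:
  assumes c: "c \<in> K"
  shows "int (card {(x, y). x \<in> K \<and> y \<in> K \<and> y ^ p + y = x * (Rf x + c * x)}) = int (p ^ r) + int (p - 1) * S c"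
proof -
  let ?Q = "\<lambda>x. x * Rf x + c * x ^ 2"
  define r' where "r' = r - 1"
  have rr: "r = Suc r'" using r by (simp add: r'_def)
  have fibre: "int (card {y\<in>K. y ^ p + y = ?Q x}) = (\<Sum>l\<in>GF p. ch (l * ?Q x))" if x: "x \<in> K" for x
  proof -
    \<comment> \<open>On \<open>K\<close> the adjoint of the \<open>p\<close>-th power is its
      inverse, the power \<open>p ^ (r - 1)\<close>; the adjoint of \<open>y ^ p + y\<close>
      therefore has kernel \<open>GF p\<close>.\<close>
    have adj: "tr ((y ^ p + y) * l) = tr (y * (l ^ (p ^ r') + l))" if y: "y \<in> K" and l: "l \<in> K" for y l
    proof -
      have "(y * l ^ (p ^ r')) ^ p = y ^ p * l"
        using l by (simp add: power_mult_distrib rr GF_def mult.commute flip: power_mult)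
      hence "tr (y ^ p * l) = tr (y * l ^ (p ^ r'))"
        using tr_frob[of "y * l ^ (p ^ r')" 1] y l by (simp add: GF_mult GF_power)
      thus ?thesis by (simp add: distrib_left distrib_right tr_add)
    qed
    have "int (card {y\<in>GF (2^(k*r)). y ^ p + y = ?Q x}) =
        (\<Sum>l | l \<in> GF (2^(k*r)) \<and> l ^ (p ^ r') + l = 0. ch (l * ?Q x))"
      by (rule card_fibre_eq_char_sum[OF kr]) (use adj Q_K[OF c x] in \<open>auto intro!: K_add GF_power simp flip: pr\<close>)
    moreover have "{l. l \<in> K \<and> l ^ (p ^ r') + l = 0} = GF p"
    proof (intro equalityI subsetI)
      fix l assume "l \<in> {l. l \<in> K \<and> l ^ (p ^ r') + l = 0}"
      hence "l ^ p = (l ^ (p ^ r')) ^ p" "l ^ (p ^ r) = l" by (auto simp: GF_def)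
      thus "l \<in> GF p" by (simp add: GF_def rr mult.commute flip: power_mult)
    next
      fix l :: universe assume "l \<in> GF p"
      thus "l \<in> {l. l \<in> K \<and> l ^ (p ^ r') + l = 0}" using GFp_K[of l] GF_p_power[OF p, of l r'] by simp
    qed
    ultimately show ?thesis by (simp add: pr)
  qed
  have finp: "finite (GF p :: universe set)" and cardp: "card (GF p :: universe set) = p"
    using card_GF[OF k] by (simp_all add: p)
  \<comment> \<open>Every \<open>l\<close> in \<open>GF p\<close> is a square
    \<open>\<mu> ^ 2\<close>, and \<open>R\<close> is linear over \<open>GF p\<close>, so
    substituting \<open>\<mu> * x\<close> for \<open>x\<close> absorbs \<open>l\<close>.\<close>
  have twist: "(\<Sum>x\<in>K. ch (l * ?Q x)) = S c" if l: "l \<in> GF p" "l \<noteq> 0" for l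
  proof -
    define \<mu> where "\<mu> = l ^ (2 ^ (k - 1))"
    have \<mu>: "\<mu> \<in> GF p" "\<mu> \<noteq> 0" unfolding \<mu>_def using l by (auto intro: GF_power)
    have "(2::nat) ^ (k - 1) * 2 = p" using k by (cases k) (simp_all add: p)
    hence sq: "l = \<mu> ^ 2" using l(1) by (simp add: \<mu>_def GF_def flip: power_mult)
    have R\<mu>: "Rf (\<mu> * x) = \<mu> * Rf x" for x
      by (simp add: Rf_def power_mult_distrib GF_p_power[OF p \<mu>(1)] sum_distrib_left mult_ac)
    have eq: "l * ?Q x = (\<mu> * x) * Rf (\<mu> * x) + c * (\<mu> * x) ^ 2" for x
      by (simp add: R\<mu> sq power2_eq_square algebra_simps)
    show ?thesis unfolding S_def eq
      by (rule sum.reindex_bij_witness[of _ "\<lambda>x. inverse \<mu> * x" "\<lambda>x. \<mu> * x"])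
         (use \<mu> GFp_K[OF \<mu>(1)] in \<open>auto intro: GF_mult GF_inverse simp: mult.assoc[symmetric]\<close>)
  qed
  have "{(x, y). x \<in> K \<and> y \<in> K \<and> y ^ p + y = x * (Rf x + c * x)} = (SIGMA x:K. {y\<in>K. y ^ p + y = ?Q x})"
    by (auto simp: algebra_simps power2_eq_square)
  hence "int (card {(x, y). x \<in> K \<and> y \<in> K \<and> y ^ p + y = x * (Rf x + c * x)}) = (\<Sum>x\<in>K. int (card {y\<in>K. y ^ p + y = ?Q x}))"
    using finite_K by simp
  also have "\<dots> = (\<Sum>x\<in>K. \<Sum>l\<in>GF p. ch (l * ?Q x))" by (simp add: fibre)
  also have "\<dots> = (\<Sum>l\<in>GF p. \<Sum>x\<in>K. ch (l * ?Q x))" by (rule sum.swap)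
  also have "\<dots> = (\<Sum>x\<in>K. ch (0 * ?Q x)) + (\<Sum>l\<in>GF p - {0}. \<Sum>x\<in>K. ch (l * ?Q x))"
    using p_gt_1 by (intro sum.remove finp) simp
  also have "(\<Sum>l\<in>GF p - {0}. \<Sum>x\<in>K. ch (l * ?Q x)) = (\<Sum>l\<in>GF p - {0::universe}. S c)"
    by (intro sum.cong refl twist) auto
  also have "\<dots> = int (p - 1) * S c" using p_gt_1 by (simp add: card_Diff_singleton finp cardp)
  finally show ?thesis by (simp add: card_K)
qed

end

end

lemma trace_double: "trace_GF2 (2 ^ (m + m)) (z::universe) = trace_GF2 (2 ^ m) (z + z ^ (2 ^ m))"
proof -
  have "(\<Sum>i<m+m. z ^ (2 ^ i)) = (\<Sum>i<m. z ^ (2 ^ i)) + (\<Sum>i=m..<m+m. z ^ (2 ^ i))"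
    by (simp add: lessThan_atLeast0 sum.atLeastLessThan_concat)
  also have "(\<Sum>i=m..<m+m. z ^ (2 ^ i)) = (\<Sum>i<m. (z ^ (2 ^ m)) ^ (2 ^ i))"
    by (rule sum.reindex_bij_witness[of _ "\<lambda>i. m + i" "\<lambda>i. i - m"]) (auto simp flip: power_mult power_add)
  finally show ?thesis unfolding trace_GF2_eq by (simp add: frob_add sum.distrib)
qed

context quadric
begin

section \<open>The sign of the character sum\<close>

text \<open>In characteristic 2 the polynomial \<open>x^(2j) + 1\<close> is the square of
  \<open>x^j + 1\<close> and has the same zeros; those of \<open>f\<close> are simple.\<close>

lemma f_dvd_half:
  assumes "f dvd monom 1 (2 * j) + 1" shows "f dvd monom 1 j + 1"
proof (rule rsquarefree_dvd[OF sqf])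
  fix x assume "poly f x = 0"
  hence "x ^ (2 * j) + 1 = 0" using assms by (auto elim!: dvdE dest!: arg_cong[of _ _ "\<lambda>q. poly q x"] simp: poly_monom)
  moreover have "(x ^ j + 1) ^ 2 = x ^ (2 * j) + 1"
    using frob_add[of "x ^ j" 1 1] by (simp flip: power_mult add: mult.commute)
  ultimately have "x ^ j + 1 = 0" by simp
  thus "poly (monom 1 j + 1) x = 0" by (simp add: poly_monom)
qed

lemma f_dvd_g: "f dvd g" by (simp add: g_def)

lemma reflect_dvd:
  assumes "h dvd monom 1 j + 1" "j \<ge> 1" shows "reflect_poly h dvd monom 1 j + (1::universe poly)"
proof -
  let ?X = "monom 1 j + (1::universe poly)"
  have deg: "degree ?X = j" using assms(2) by (subst degree_add_eq_left) (simp_all add: degree_monom_eq)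
  have "reflect_poly ?X = ?X"
    using assms(2) by (intro poly_eqI) (auto simp: coeff_reflect_poly deg)
  moreover obtain h' where "?X = h * h'" using assms(1) by (rule dvdE)
  ultimately show ?thesis by (metis dvdI reflect_poly_mult)
qed

text \<open>At the double zero 1 of \<open>g\<close> the derivative of \<open>x^n + 1\<close>
  vanishes, and its value there is \<open>n\<close>.\<close>

lemma n_even: "even n"
proof (rule ccontr)
  assume odd: "odd n"
  define L :: "universe poly" where "L = [:1, 1:]"
  have "g = L * (L * G)" unfolding L_def mult.assoc[symmetric] by (simp add: g_eq)
  moreover obtain h where "monom 1 n + 1 = g * h" using n(2) by (rule dvdE)
  ultimately have "monom 1 n + 1 = L * (L * (G * h))" by (simp only: mult.assoc)
  moreover have "poly L 1 = 0" by (simp add: L_def)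
  ultimately have "poly (pderiv (monom 1 n + 1)) (1::universe) = 0" by (simp add: pderiv_mult)
  moreover have "poly (pderiv (monom 1 n + 1)) (1::universe) = of_nat n"
    by (simp add: pderiv_add pderiv_monom poly_monom)
  moreover have "(of_nat n :: universe) = 1"
    using odd by (elim oddE) (simp add: two_eq_0_universe)
  ultimately show False by simp
qed

text \<open>If \<open>n = 4 * j\<close>, halving twice shows that \<open>f\<close>, and with it its
  reflection, divides \<open>x^j + 1\<close>. Their product \<open>g\<close> then divides
  \<open>x^(2j) + 1\<close>, against the minimality of \<open>n\<close>.\<close>

lemma n_half_odd: "odd (n div 2)"
proof
  assume "even (n div 2)"
  then obtain j where j: "n = 2 * (2 * j)" using n_even by (metis dvd_mult_div_cancel dvdE)
  hence j1: "j \<ge> 1" using n(1) by (cases j) auto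
  have "f dvd monom 1 (2 * (2 * j)) + 1" using dvd_trans[OF f_dvd_g n(2)] unfolding j .
  hence fj: "f dvd monom 1 j + 1" by (rule f_dvd_half[OF f_dvd_half])
  have "g dvd (monom 1 j + 1) * (monom 1 j + 1)"
    unfolding g_def using fj j1 by (intro mult_dvd_mono reflect_dvd)
  also have "(monom 1 j + 1) * (monom 1 j + 1) = (monom 1 (2 * j) + (1::universe poly))"
  proof -
    have "monom (1::universe) j + monom 1 j = monom (1 + 1) j" by (simp only: add_monom)
    hence eq: "monom (1::universe) j + monom 1 j = 0" by (simp only: add_self_universe monom_eq_0)
    have "(monom 1 j + 1) * (monom 1 j + 1) = monom 1 j * monom 1 j + (monom 1 j + monom 1 j) + (1::universe poly)"
      by (simp only: distrib_left distrib_right mult_1_left mult_1_right add.assoc)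
    also have "\<dots> = monom 1 (j + j) + 1" by (simp only: eq mult_monom mult_1_left add_0_right)
    finally show ?thesis by (simp only: mult_2)
  qed
  finally have "n \<le> 2 * j" using j1 by (intro n_le) auto
  thus False using j j1 by simp
qed

section \<open>The sign over a field of even degree \<open>r = 2 * t\<close>, with \<open>L\<close>
  the subfield of index 2\<close>

context
  fixes r t :: nat
  assumes rt: "r = 2 * t" and r1: "r \<ge> 1" and nr: "n dvd r"
begin

abbreviation "L \<equiv> GF (p ^ t) :: universe set"
abbreviation "F1 \<equiv> act p f1"
abbreviation "F1' \<equiv> act p f1'"
text \<open>The relative trace of \<open>F1 x\<close> to \<open>L\<close>: it vanishes exactly when
  \<open>F1 x\<close> lies in \<open>L\<close>.\<close>

definition "\<tau> x = F1 x ^ (p ^ t) + F1 x"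
definition "U0 = {x\<in>K r. F1 x \<in> L}"
definition "U2 = {x\<in>K r. \<tau> x \<in> GF (p ^ 2)}"

lemma t1: "t \<ge> 1" using rt r1 by auto

lemma L_K: "z \<in> L \<Longrightarrow> z \<in> K r"
  using GF_mono[of t r p] rt by auto

lemma L_add: "x \<in> L \<Longrightarrow> y \<in> L \<Longrightarrow> x + y \<in> L" by (rule GF_add_p[OF p])

lemma f1_dvd: "f1 dvd monom 1 t + 1"
proof -
  have "f dvd monom 1 (2 * t) + 1"
    using dvd_trans[OF f_dvd_g] n_dvd_iff[OF r1] nr unfolding rt by blast
  hence "f dvd monom 1 t + 1" by (rule f_dvd_half)
  moreover have "f1 dvd f" by (subst f) (rule dvd_triv_right)
  ultimately show ?thesis using dvd_trans by blast
qed

lemma kernel_L: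
  assumes "h dvd monom 1 t + 1" "\<And>i. coeff h i \<in> GF p" "act p h z = 0" shows "z \<in> L"
proof -
  obtain h' where "monom 1 t + 1 = h * h'" using assms(1) by (rule dvdE)
  hence "act p (monom 1 t + 1) z = act p h' (act p h z)" by (simp add: act_mult[OF p assms(2)] mult.commute[of h])
  hence "z ^ (p ^ t) + z = 0" using assms(3) act_zero[OF p] by (simp add: act_add_poly act_monom_Suc_0)
  thus ?thesis by (simp add: GF_def)
qed

lemma F1'_kernel: "F1' z = 0 \<Longrightarrow> z \<in> L"
  using kernel_L[OF reflect_dvd[OF f1_dvd t1]] f1' by (simp add: f1'_def)

lemma sigma_sigma: "z \<in> K r \<Longrightarrow> (z ^ (p ^ t)) ^ (p ^ t) = z"
  by (simp add: GF_def rt mult_2 power_add flip: power_mult)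

lemma tr_half: "tr r z = trace_GF2 (p ^ t) (z + z ^ (p ^ t))"
  using trace_double[of "k * t" z] by (simp add: rt p mult_2 distrib_left flip: power_mult)

text \<open>Elements of \<open>L\<close> have relative trace \<open>z + z = 0\<close>. This is why
  \<open>U0\<close> is totally singular.\<close>

lemma tr_L:
  assumes "z \<in> L" shows "tr r z = 0"
proof -
  have "z + z ^ (p ^ t) = 0" using assms by (simp add: GF_def)
  thus ?thesis unfolding tr_half by (simp only:) (rule tr_0[OF t1])
qed

lemma ch_L: "z \<in> L \<Longrightarrow> ch r z = 1"
  using tr_L pr[OF r1] by (simp add: chi_def)

lemma sum_sigma_L: "z \<in> K r \<Longrightarrow> z + z ^ (p ^ t) \<in> L"
  using sigma_sigma[of z] by (simp add: GF_def frob_add_p[OF p] add.commute)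

lemma F1_K: "z \<in> K r \<Longrightarrow> F1 z \<in> K r" by (rule act_K[OF r1 f1])
lemma F1'_K: "z \<in> K r \<Longrightarrow> F1' z \<in> K r" by (rule act_K[OF r1 f1'])

lemma \<tau>_add: "\<tau> (x + y) = \<tau> x + \<tau> y"
  by (simp add: \<tau>_def act_add[OF p] frob_add_p[OF p] add_ac)

lemma \<tau>_L: "x \<in> K r \<Longrightarrow> \<tau> x \<in> L"
  using sum_sigma_L[OF F1_K] by (simp add: \<tau>_def add.commute)

lemma U0_eq: "U0 = {x\<in>K r. \<tau> x = 0}"
  by (auto simp: U0_def \<tau>_def GF_def)

text \<open>The factor \<open>x^2 + 1\<close> of \<open>g\<close> applied to \<open>F1 x\<close>, so
  that \<open>g\<close> acts as \<open>F1'\<close> after \<open>w\<close>.\<close>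

definition "w x = act p f1 x ^ (p ^ 2) + act p f1 x"

lemma act_g_eq: "act p g x = F1' (w x)"
proof -
  have "g = (f1' * [:1, 0, 1:]) * f1" by (simp only: g_eq G_def mult_ac)
  hence "act p g x = act p (f1' * [:1, 0, 1:]) (F1 x)" by (simp only: act_mult[OF p f1])
  also have "\<dots> = F1' (act p [:1, 0, 1:] (F1 x))"
    by (rule act_mult[OF p]) (use p_gt_1 in \<open>simp add: coeff_pCons split: nat.split\<close>)
  also have "act p [:1, 0, 1:] (F1 x) = w x"
    by (simp add: act_pCons w_def power2_eq_square power_mult add.commute)
  finally show ?thesis .
qed

lemma w_L_iff:
  assumes x: "x \<in> K r" shows "w x \<in> L \<longleftrightarrow> x \<in> U2"
proof -
  let ?v = "F1 x"
  have "(w x) ^ (p ^ t) + w x = (\<tau> x) ^ (p ^ 2) + \<tau> x"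
    by (simp add: w_def \<tau>_def frob_add_p[OF p] add_ac flip: power_mult) (simp add: mult.commute)
  moreover have "w x \<in> L \<longleftrightarrow> (w x) ^ (p ^ t) + w x = 0" by (simp add: GF_def)
  moreover have "x \<in> U2 \<longleftrightarrow> (\<tau> x) ^ (p ^ 2) + \<tau> x = 0" using x by (simp add: U2_def GF_def)
  ultimately show ?thesis by (simp only:)
qed

text \<open>The reverse inclusion uses that the kernel of \<open>F1'\<close> lies in \<open>L\<close>.\<close>

lemma U0_orthogonal_iff:
  assumes x: "x \<in> K r"
  shows "(\<forall>u\<in>U0. ch r (E x * u) = 1) \<longleftrightarrow> x \<in> U2"
proof
  have wK: "w x \<in> K r" unfolding w_def by (intro K_add[OF r1] GF_power F1_K x)
  {
    assume "x \<in> U2"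
    hence wL: "w x \<in> L" using w_L_iff[OF x] by simp
    show "\<forall>u\<in>U0. ch r (E x * u) = 1"
    proof
      fix u assume "u \<in> U0"
      hence u: "u \<in> K r" "F1 u \<in> L" by (simp_all add: U0_def)
      have up: "u ^ p \<in> K r" by (rule GF_power[OF u(1)])
      have "tr r (E x * u) = tr r ((E x * u) ^ (p ^ e))" by (rule tr_frob[OF r1, symmetric]) (intro GF_mult E_K[OF r1] x u)
      \<comment> \<open>Since \<open>e = D + 1\<close>, exactly one power \<open>p\<close> is left
        on \<open>u\<close> after the power \<open>p ^ D\<close> required by the adjunction.\<close>
      also have "(E x * u) ^ (p ^ e) = F1' (w x) * (u ^ p) ^ (p ^ degree f1')"
        unfolding power_mult_distrib E_power act_g_eq degree_f1' power_mult[symmetric] power_Suc[symmetric] e_eq[symmetric] ..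
      also have "tr r \<dots> = tr r (w x * act p (reflect_poly f1') (u ^ p))"
        by (rule act_adjoint[OF p r1 f1' wK up])
      also have "act p (reflect_poly f1') (u ^ p) = F1 u ^ p"
        using act_frob[OF p f1, of u 1] by (simp add: reflect_f1')
      also have "tr r (w x * F1 u ^ p) = 0" by (intro tr_L GF_mult GF_power wL u)
      finally show "ch r (E x * u) = 1" using pr[OF r1] by (simp add: chi_def)
    qed
  }
  assume orth: "\<forall>u\<in>U0. ch r (E x * u) = 1"
  \<comment> \<open>The inverse on \<open>K\<close> of the power \<open>p ^ D\<close>; it
    compensates the shift in \<open>act_adjoint\<close>.\<close>
  define rt' where "rt' y = y ^ (p ^ ((r - 1) * D))" for y :: universe
  have rt'K: "rt' y \<in> K r" if "y \<in> K r" for y unfolding rt'_def using that by (rule GF_power)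
  have rt': "rt' y ^ (p ^ D) = y" if "y \<in> K r" for y
  proof -
    have "(r - 1) * D + D = r * D" using r1 by (cases r) auto
    hence "rt' y ^ (p ^ D) = y ^ (p ^ (r * D))" by (simp add: rt'_def flip: power_mult power_add)
    moreover have "y \<in> GF (p ^ (r * D))" using that GF_mono[of r "r * D" p] by auto
    ultimately show ?thesis by (simp add: GF_def)
  qed
  \<comment> \<open>\<open>B\<close> is the relative trace followed by \<open>F1\<close>, and its
    kernel in \<open>K\<close> is \<open>U0\<close>; \<open>A\<close> is its adjoint. Orthogonality
    to \<open>U0\<close> thus puts \<open>E x\<close> into the image of \<open>A\<close>.\<close>
  define A where "A y = F1' (rt' y) ^ (p ^ t) + F1' (rt' y)" for y
  define B where "B l = F1 (l ^ (p ^ t) + l)" for l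
  have "\<exists>y\<in>GF (2^(k*r)). A y = E x"
  proof (rule mem_image_if_orthogonal[OF kr[OF r1], where A' = B])
    fix y :: universe assume "y \<in> GF (2^(k*r))"
    hence y: "y \<in> K r" by (simp add: pr[OF r1])
    show "A y \<in> GF (2^(k*r))" unfolding A_def pr[OF r1, symmetric] by (intro K_add[OF r1] GF_power F1'_K rt'K y)
    show "B y \<in> GF (2^(k*r))" unfolding B_def pr[OF r1, symmetric] by (intro K_add[OF r1] GF_power F1_K y)
  next
    fix y l :: universe assume "y \<in> GF (2^(k*r))" "l \<in> GF (2^(k*r))"
    hence y: "y \<in> K r" and l: "l \<in> K r" by (simp_all add: pr[OF r1])
    let ?y = "F1' (rt' y)"
    have yK: "?y \<in> K r" by (intro F1'_K rt'K y)
    have "tr r (?y ^ (p ^ t) * l) = tr r ((?y ^ (p ^ t) * l) ^ (p ^ t))"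
      by (rule tr_frob[OF r1, symmetric]) (intro GF_mult GF_power yK l)
    also have "(?y ^ (p ^ t) * l) ^ (p ^ t) = ?y * l ^ (p ^ t)"
      by (simp add: power_mult_distrib sigma_sigma[OF yK])
    finally have "tr r (A y * l) = tr r ((l ^ (p ^ t) + l) * ?y)"
      by (simp add: A_def distrib_right distrib_left tr_add[OF r1] mult.commute)
    also have "\<dots> = tr r (F1 (l ^ (p ^ t) + l) * rt' y ^ (p ^ degree f1))"
      unfolding f1'_def by (rule act_adjoint[OF p r1 f1, symmetric]) (intro K_add[OF r1] GF_power l rt'K y)+
    also have "\<dots> = tr r (y * B l)" by (simp add: rt'[OF y, unfolded D_def] B_def mult.commute)
    finally show "trace_GF2 (2^(k*r)) (A y * l) = trace_GF2 (2^(k*r)) (y * B l)" by (simp add: pr[OF r1])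
  next
    show "E x \<in> GF (2^(k*r))" using E_K[OF r1 x] by (simp add: pr[OF r1])
    show "B 0 = 0" by (simp add: B_def act_zero[OF p] frob_0_p[OF p])
  next
    fix l :: universe assume l: "l \<in> GF (2^(k*r))" "B l = 0"
    hence "l \<in> U0" by (simp add: U0_eq \<tau>_def B_def act_add[OF p] act_frob[OF p f1] pr[OF r1])
    thus "ch r (l * E x) = 1" using orth by (simp add: mult.commute)
  qed
  then obtain y where y: "y \<in> K r" and yx: "A y = E x" by (auto simp: pr[OF r1])
  define y1 where "y1 = rt' y ^ (p ^ e)"
  have y1K: "y1 \<in> K r" unfolding y1_def by (intro GF_power rt'K y)
  \<comment> \<open>Both sides are values of \<open>F1'\<close>, so \<open>w x\<close> agrees with a
    relative trace, an element of \<open>L\<close>, up to the kernel of \<open>F1'\<close>.\<close>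
  have "F1' (w x) = E x ^ (p ^ e)" by (simp only: E_power act_g_eq)
  also have "\<dots> = F1' (y1 ^ (p ^ t) + y1)"
    unfolding yx[symmetric] A_def y1_def frob_add_p[OF p] act_add[OF p] act_frob[OF p f1']
    by (simp flip: power_mult add: mult.commute)
  finally have "F1' (w x + (y1 ^ (p ^ t) + y1)) = 0" by (simp add: act_add[OF p])
  hence "w x + (y1 ^ (p ^ t) + y1) \<in> L" by (rule F1'_kernel)
  moreover have "y1 ^ (p ^ t) + y1 \<in> L" using sum_sigma_L[OF y1K] by (simp add: add.commute)
  ultimately have "w x + (y1 ^ (p ^ t) + y1) + (y1 ^ (p ^ t) + y1) \<in> L" by (rule L_add)
  hence "w x \<in> L" by (simp add: add.assoc)
  thus "x \<in> U2" using w_L_iff[OF x] by simp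
qed

definition "\<psi> x = ch r (F1 x * F1 x ^ p)"

lemma Q_eq_\<psi>: "x \<in> K r \<Longrightarrow> ch r (x * Rf x + c0 ^ 2 * x ^ 2) = \<psi> x"
proof -
  assume x: "x \<in> K r"
  have "tr r (c0 ^ 2 * x ^ 2) = tr r (c0 * x)"
    using tr_square[OF r1, of "c0 * x"] x GFp_K[OF r1 c0_GF] by (simp add: GF_mult power_mult_distrib)
  hence "tr r (x * Rf x + c0 ^ 2 * x ^ 2) = tr r (F1 x * F1 x ^ p)"
    using tr_quadratic[OF r1 x] by (simp add: tr_add[OF r1])
  thus ?thesis unfolding \<psi>_def by (rule ch_cong[OF r1])
qed

text \<open>Averaging over translations by \<open>U0\<close>, on which the form vanishes, introduces
  the character of \<open>E x * u\<close>. Its sum over \<open>u\<close> is zero unless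
  \<open>x\<close> is orthogonal to \<open>U0\<close>, and the factor \<open>card U0\<close>
  cancels.\<close>

lemma S_eq_U2: "S r (c0 ^ 2) = (\<Sum>x\<in>U2. \<psi> x)"
proof -
  have finU: "finite U0" using finite_K[OF r1] by (simp add: U0_def)
  have U0_0: "0 \<in> U0" using K_0[OF r1] by (simp add: U0_eq \<tau>_def act_zero[OF p] frob_0_p[OF p])
  have U0_add: "x + y \<in> U0" if "x \<in> U0" "y \<in> U0" for x y
    using that by (simp add: U0_eq \<tau>_add K_add[OF r1])
  have c0K: "c0 ^ 2 \<in> K r" by (intro GF_power GFp_K[OF r1] c0_GF)
  have \<psi>_U0: "\<psi> u = 1" if "u \<in> U0" for u
    unfolding \<psi>_def using that by (intro ch_L GF_mult GF_power) (auto simp: U0_def)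
  have \<psi>_add: "\<psi> (x + u) = \<psi> x * ch r (E x * u)" if "x \<in> K r" "u \<in> U0" for x u
  proof -
    have u: "u \<in> K r" using that by (simp add: U0_def)
    have "\<psi> (u + x) = \<psi> u * \<psi> x * ch r (E x * u)"
      using ch_Q_add[OF r1 c0K u that(1)] u that(1) by (simp add: Q_eq_\<psi> K_add[OF r1])
    thus ?thesis by (simp add: \<psi>_U0 that add.commute)
  qed
  have "int (card U0) * S r (c0 ^ 2) = (\<Sum>u\<in>U0. \<Sum>x\<in>K r. \<psi> x)"
    by (simp add: S_def[OF r1] Q_eq_\<psi>)
  also have "\<dots> = (\<Sum>u\<in>U0. \<Sum>x\<in>K r. \<psi> (x + u))"
  proof (rule sum.cong, rule refl)
    fix u assume "u \<in> U0"
    hence u: "u \<in> K r" by (simp add: U0_def)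
    show "(\<Sum>x\<in>K r. \<psi> x) = (\<Sum>x\<in>K r. \<psi> (x + u))"
      by (rule sum.reindex_bij_witness[of _ "\<lambda>x. x + u" "\<lambda>x. x + u"]) (auto simp: K_add[OF r1] u add.assoc)
  qed
  also have "\<dots> = (\<Sum>x\<in>K r. \<psi> x * (\<Sum>u\<in>U0. ch r (E x * u)))"
    by (subst sum.swap) (simp add: \<psi>_add sum_distrib_left)
  also have "\<dots> = (\<Sum>x\<in>K r. if x \<in> U2 then int (card U0) * \<psi> x else 0)"
  proof (rule sum.cong, rule refl)
    fix x assume x: "x \<in> K r"
    have "(\<Sum>u\<in>U0. ch r (E x * u)) = (if \<forall>u\<in>U0. ch r (E x * u) = 1 then int (card U0) else 0)"
    proof (rule sum_sign_character[OF finU U0_add])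
      fix u u' assume "u \<in> U0" "u' \<in> U0"
      thus "ch r (E x * (u + u')) = ch r (E x * u) * ch r (E x * u')"
        unfolding distrib_left by (intro ch_add[OF r1] GF_mult E_K[OF r1] x) (auto simp: U0_def)
    qed (auto simp: chi_cases)
    thus "\<psi> x * (\<Sum>u\<in>U0. ch r (E x * u)) = (if x \<in> U2 then int (card U0) * \<psi> x else 0)"
      using U0_orthogonal_iff[OF x] by simp
  qed
  also have "\<dots> = int (card U0) * (\<Sum>x\<in>U2. \<psi> x)"
  proof -
    have "K r \<inter> U2 = U2" by (auto simp: U2_def)
    thus ?thesis using finite_K[OF r1] by (simp add: sum.If_cases sum_distrib_left)
  qed
  finally show ?thesis using finU U0_0 by (auto simp: card_eq_0_iff)
qed

text \<open>On \<open>U2\<close> the form factors through \<open>\<tau>\<close>, where it is the norm form of \<open>GF (p\<^sup>2)\<close> over \<open>GF p\<close>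
  taken \<open>t + 1\<close> times.\<close>

lemma \<psi>_U2:
  assumes x: "x \<in> U2"
  shows "\<psi> x = (if even t then chi k (\<tau> x ^ (p + 1)) else 1)"
proof -
  define v T where "v = F1 x" and "T = \<tau> x"
  define N where "N = T ^ (p + 1)"
  \<comment> \<open>Chosen because the conjugate of \<open>v\<close> is \<open>v + T\<close>, so
    that the relative trace of \<open>v * v ^ p\<close> becomes
    \<open>\<omega> + \<omega> ^ p + N\<close>; the first two terms telescope in the trace from
    \<open>L\<close> to \<open>GF p\<close>.\<close>
  define \<omega> where "\<omega> = v * T ^ p"
  have xK: "x \<in> K r" and Tp2: "T ^ (p ^ 2) = T" using x by (simp_all add: U2_def T_def GF_def)
  have TL: "T ^ (p ^ t) = T" using \<tau>_L[OF xK] by (simp add: T_def GF_def)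
  have v\<sigma>: "v ^ (p ^ t) = v + T" by (simp add: v_def T_def \<tau>_def add.commute[of "F1 x"] add.assoc)
  have frobp: "(b + c) ^ p = b ^ p + c ^ p" for b c :: universe using frob_add_p[OF p, of b c 1] by simp
  have NN: "N ^ (p ^ i) = N" for i
  proof -
    have "N ^ p = T ^ (p ^ 2) * T ^ p" by (simp add: N_def power_mult_distrib power2_eq_square mult.commute flip: power_mult)
    hence "N ^ p = N" by (simp add: Tp2) (simp add: N_def)
    thus ?thesis by (induction i) (auto simp: power_mult)
  qed
  have \<omega>\<sigma>: "\<omega> ^ (p ^ t) = \<omega> + N"
  proof -
    have "(T ^ p) ^ (p ^ t) = T ^ p" by (metis TL mult.commute power_mult)
    thus ?thesis by (simp add: \<omega>_def N_def power_mult_distrib v\<sigma> distrib_right)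
  qed
  have \<omega>p: "\<omega> ^ p = v ^ p * T" by (simp add: \<omega>_def power_mult_distrib Tp2 flip: power_mult power2_eq_square)
  have \<sigma>p: "(v * v ^ p) ^ (p ^ t) = (v + T) * (v + T) ^ p"
    by (simp add: power_mult_distrib v\<sigma> mult.commute[of p] flip: power_mult) (simp add: power_mult v\<sigma>)
  have "v * v ^ p + (v * v ^ p) ^ (p ^ t) = \<omega> + \<omega> ^ p + N"
    unfolding \<sigma>p frobp \<omega>p by (simp add: \<omega>_def N_def algebra_simps)
  hence "tr r (v * v ^ p) = trace_GF2 (p ^ t) (\<omega> + \<omega> ^ p + N)" by (simp only: tr_half)
  also have "\<dots> = trace_GF2 (2 ^ k) (\<Sum>i<t. (\<omega> + \<omega> ^ p + N) ^ (p ^ i))"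
    using trace_tower[of k t "\<omega> + \<omega> ^ p + N"] by (simp add: p power_mult)
  also have "(\<Sum>i<j. (\<omega> + \<omega> ^ p + N) ^ (p ^ i)) = \<omega> ^ (p ^ j) + \<omega> + of_nat j * N" for j
  proof (induction j)
    case (Suc j)
    have "(\<omega> + \<omega> ^ p + N) ^ (p ^ j) = \<omega> ^ (p ^ j) + \<omega> ^ (p ^ Suc j) + N"
      by (simp add: frob_add_p[OF p] NN flip: power_mult)
    thus ?case using Suc by (simp add: algebra_simps)
  qed simp
  \<comment> \<open>The ends of the telescope differ by \<open>N\<close>, giving
    \<open>t + 1\<close> copies of \<open>N\<close> altogether.\<close>
  also have "\<omega> ^ (p ^ t) + \<omega> + of_nat t * N = (if even t then N else 0)"
    using two_eq_0_universe by (auto simp: \<omega>\<sigma> add_ac elim!: evenE oddE)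
  finally have tr: "tr r (v * v ^ p) = trace_GF2 (2 ^ k) (if even t then N else 0)" .
  have "\<psi> x = (if tr r (v * v ^ p) = 0 then 1 else - 1)" by (simp add: \<psi>_def v_def chi_def pr[OF r1])
  thus ?thesis unfolding tr by (simp add: chi_def N_def T_def)
qed

lemma S_c0_odd: "odd t \<Longrightarrow> S r (c0 ^ 2) > 0"
proof -
  assume "odd t"
  hence "S r (c0 ^ 2) = int (card U2)" by (simp add: S_eq_U2 \<psi>_U2)
  moreover have "0 \<in> U2" using K_0[OF r1] p_gt_1 by (simp add: U2_def \<tau>_def act_zero[OF p] frob_0_p[OF p])
  hence "card U2 > 0" using finite_K[OF r1] by (auto simp: card_gt_0_iff U2_def)
  ultimately show ?thesis by simp
qed

text \<open>\<open>\<tau>\<close> is \<open>F1\<close> applied to the relative trace of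
  \<open>x\<close>. For even \<open>t\<close> the field \<open>GF (p ^ 2)\<close> lies in
  \<open>L\<close>, so it consists of relative traces, and \<open>F1\<close> permutes it.\<close>

lemma \<tau>_surj:
  assumes "even t" and \<theta>: "\<theta> \<in> GF (p ^ 2)"
  shows "\<exists>x\<in>U2. \<tau> x = \<theta>"
proof -
  let ?M = "GF (p ^ 2) :: universe set"
  have M_sub_L: "z \<in> L" if "z \<in> ?M" for z using that GF_mono[of 2 t p] assms(1) by auto
  have M_add: "x + y \<in> ?M" if "x \<in> ?M" "y \<in> ?M" for x y using GF_add_p[OF p that] .
  have finM: "finite ?M" using card_GF(2)[of "k*2"] k by (simp add: p power_mult)
  have f1M: "coeff f1 i \<in> ?M" for i using GF_p_subset[OF p, of 2] f1 by auto
  have F1M: "F1 z \<in> ?M" if "z \<in> ?M" for z by (rule act_GF[OF p f1M that])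
  have inj0: "\<omega> = 0" if \<omega>: "\<omega> \<in> ?M" "F1 \<omega> = 0" for \<omega>
  proof -
    have fix_p: "F1 y = poly f1 1 * y" if "y ^ p = y" for y
    proof -
      have "y \<in> GF p" using that by (simp add: GF_def)
      thus ?thesis by (simp add: act_def GF_p_power[OF p] poly_altdef sum_distrib_right)
    qed
    \<comment> \<open>The trace to \<open>GF p\<close>, where \<open>F1\<close> is multiplication by
      \<open>f1(1)\<close>. Its vanishing forces \<open>\<omega>\<close> itself into
      \<open>GF p\<close>.\<close>
    define \<eta> where "\<eta> = \<omega> + \<omega> ^ p"
    have "\<eta> ^ p = \<eta>"
      using frob_add_p[OF p, of \<omega> "\<omega> ^ p" 1] \<omega>(1)
      by (simp add: \<eta>_def GF_def power2_eq_square add.commute flip: power_mult)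
    moreover have "F1 \<eta> = 0"
      using act_frob[OF p f1, of \<omega> 1] \<omega>(2) p_gt_1 by (simp add: \<eta>_def act_add[OF p])
    ultimately have "\<eta> = 0" using fix_p f1_1 by simp
    hence "\<omega> ^ p = \<omega>" by (simp add: \<eta>_def)
    thus ?thesis using fix_p f1_1 \<omega>(2) by simp
  qed
  have "inj_on F1 ?M"
  proof (rule inj_onI)
    fix x y assume xy: "x \<in> ?M" "y \<in> ?M" "F1 x = F1 y"
    have "x + y = 0" by (rule inj0[OF M_add[OF xy(1,2)]]) (simp add: act_add[OF p] xy(3))
    thus "x = y" by simp
  qed
  hence "F1 ` ?M = ?M" using finM F1M by (intro endo_inj_surj) auto
  then obtain \<omega> where \<omega>: "\<omega> \<in> ?M" "F1 \<omega> = \<theta>" using \<theta> by (metis imageE)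
  \<comment> \<open>The relative trace is self-adjoint with kernel \<open>L\<close>, and products of
    elements of \<open>L\<close> have trace 0.\<close>
  have "\<exists>x\<in>GF (2^(k*r)). x ^ (p ^ t) + x = \<omega>"
  proof (rule mem_image_if_orthogonal[OF kr[OF r1], where A' = "\<lambda>x. x ^ (p ^ t) + x"])
    fix x l :: universe assume "x \<in> GF (2^(k*r))" "l \<in> GF (2^(k*r))"
    hence x: "x \<in> K r" and l: "l \<in> K r" by (simp_all add: pr[OF r1])
    have "tr r (x ^ (p ^ t) * l) = tr r ((x ^ (p ^ t) * l) ^ (p ^ t))"
      by (rule tr_frob[OF r1, symmetric]) (intro GF_mult GF_power x l)
    also have "(x ^ (p ^ t) * l) ^ (p ^ t) = x * l ^ (p ^ t)"
      by (simp add: power_mult_distrib sigma_sigma[OF x])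
    finally show "trace_GF2 (2^(k*r)) ((x ^ (p ^ t) + x) * l) = trace_GF2 (2^(k*r)) (x * (l ^ (p ^ t) + l))"
      unfolding pr[OF r1, symmetric] by (simp add: distrib_left distrib_right tr_add[OF r1])
  next
    fix l :: universe assume "l \<in> GF (2^(k*r))" "l ^ (p ^ t) + l = 0"
    hence "l \<in> L" by (simp add: GF_def)
    thus "ch r (l * \<omega>) = 1" by (intro ch_L GF_mult M_sub_L[OF \<omega>(1)])
  qed (use L_K[OF M_sub_L[OF \<omega>(1)]] K_add[OF r1] in \<open>auto simp: pr[OF r1] frob_0_p[OF p] intro: GF_power\<close>)
  then obtain x where x: "x \<in> K r" "x ^ (p ^ t) + x = \<omega>" by (auto simp: pr[OF r1])
  have "\<tau> x = \<theta>" unfolding \<omega>(2)[symmetric] x(2)[symmetric] by (simp add: \<tau>_def act_add[OF p] act_frob[OF p f1])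
  thus ?thesis using x(1) \<theta> by (auto simp: U2_def)
qed

text \<open>The norm onto the nonzero elements of \<open>GF p\<close> has fibres of size
  \<open>p + 1\<close>, and the character sums to -1 over these elements. With the term at 0 this
  gives \<open>1 - (p + 1)\<close>.\<close>

lemma sum_norm_GF2: "(\<Sum>\<theta>\<in>GF (p ^ 2). chi k (\<theta> ^ (p + 1))) = - int p"
proof -
  let ?M = "GF (p ^ 2) :: universe set" and ?P = "GF p - {0} :: universe set"
  define fib where "fib \<nu> = {\<theta>\<in>?M - {0}. \<theta> ^ (p + 1) = \<nu>}" for \<nu>
  have finP: "finite (GF p :: universe set)" "card (GF p :: universe set) = p"
    using card_GF[OF k] by (simp_all add: p)
  have M: "finite ?M" "card ?M = p ^ 2" using card_GF[of "k*2"] k by (simp_all add: p power_mult)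
  have M0: "0 \<in> ?M" using p_gt_1 by simp
  have norm_mem: "\<theta> ^ (p + 1) \<in> ?P" if "\<theta> \<in> ?M - {0}" for \<theta>
  proof -
    have "(\<theta> ^ (p + 1)) ^ p = \<theta> ^ (p ^ 2) * \<theta> ^ p" by (simp add: power2_eq_square power_mult_distrib mult.commute flip: power_mult)
    thus ?thesis using that by (simp add: GF_def)
  qed
  have split: "(\<Sum>\<theta>\<in>?M - {0}. h \<theta>) = (\<Sum>\<nu>\<in>?P. \<Sum>\<theta>\<in>fib \<nu>. h \<theta>)" for h :: "universe \<Rightarrow> int"
    unfolding fib_def using norm_mem M(1) finP(1)
    by (intro sum.group[symmetric]) auto
  have le: "card (fib \<nu>) \<le> p + 1" for \<nu>
  proof -
    define P :: "universe poly" where "P = monom 1 (p + 1) + [:\<nu>:]"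
    have deg: "degree P = p + 1" unfolding P_def by (subst degree_add_eq_left) (simp_all add: degree_monom_eq)
    hence P0: "P \<noteq> 0" by auto
    have "fib \<nu> \<subseteq> {x. poly P x = 0}" by (auto simp: fib_def P_def poly_monom)
    hence "card (fib \<nu>) \<le> card {x. poly P x = 0}" by (rule card_mono[OF poly_roots_finite[OF P0]])
    thus ?thesis using card_poly_roots_bound[OF P0] deg by simp
  qed
  have "int (card (?M - {0})) = (\<Sum>\<nu>\<in>?P. int (card (fib \<nu>)))" using split[of "\<lambda>_. 1"] by simp
  moreover have "int (card (?M - {0})) = int (p - 1) * int (p + 1)"
    using M M0 p_gt_1 by (simp add: card_Diff_singleton of_nat_diff power2_eq_square algebra_simps)
  moreover have cP: "card ?P = p - 1" using finP p_gt_1 by (simp add: card_Diff_singleton)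
  ultimately have sum0: "(\<Sum>\<nu>\<in>?P. int (p + 1) - int (card (fib \<nu>))) = 0"
    by (simp add: sum_subtractf del: of_nat_add)
  \<comment> \<open>Each fibre has at most \<open>p + 1\<close> elements as a set of roots, and the
    total \<open>(p - 1) * (p + 1)\<close> leaves no slack.\<close>
  have card_fib: "int (card (fib \<nu>)) = int (p + 1)" if "\<nu> \<in> ?P" for \<nu>
  proof -
    have "\<forall>\<nu>\<in>?P. int (p + 1) - int (card (fib \<nu>)) = 0"
    proof (subst sum_nonneg_eq_0_iff[symmetric])
      show "0 \<le> int (p + 1) - int (card (fib \<nu>))" for \<nu> using le[of \<nu>] by simp
    qed (use sum0 finP(1) in auto)
    thus ?thesis using that by simp
  qed
  have "(\<Sum>\<theta>\<in>?M. chi k (\<theta> ^ (p + 1))) = 1 + (\<Sum>\<theta>\<in>?M - {0}. chi k (\<theta> ^ (p + 1)))"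
    by (subst sum.remove[OF M(1) M0]) simp
  also have "(\<Sum>\<theta>\<in>?M - {0}. chi k (\<theta> ^ (p + 1))) = (\<Sum>\<nu>\<in>?P. \<Sum>\<theta>\<in>fib \<nu>. chi k \<nu>)"
    unfolding split by (intro sum.cong refl) (simp add: fib_def)
  also have "\<dots> = int (p + 1) * (\<Sum>\<nu>\<in>?P. chi k \<nu>)"
    by (simp add: card_fib sum_distrib_left del: of_nat_add)
  also have "(\<Sum>\<nu>\<in>?P. chi k \<nu>) = - 1"
  proof -
    have "(\<Sum>\<nu>\<in>GF p. chi k \<nu>) = 0" using sum_chi_mult[OF k, of 1] by (simp add: p)
    moreover have "(\<Sum>\<nu>\<in>GF p. chi k \<nu>) = chi k 0 + (\<Sum>\<nu>\<in>?P. chi k \<nu>)"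
      using p_gt_1 by (intro sum.remove finP) simp
    ultimately show ?thesis by simp
  qed
  finally show ?thesis by simp
qed

lemma S_c0_even:
  assumes "even t" shows "S r (c0 ^ 2) < 0"
proof -
  let ?M = "GF (p ^ 2) :: universe set"
  have finU2: "finite U2" using finite_K[OF r1] by (simp add: U2_def)
  have finM: "finite ?M" using card_GF(2)[of "k*2"] k by (simp add: p power_mult)
  have card_fib: "card {x\<in>U2. \<tau> x = \<theta>} = card U0" if \<theta>: "\<theta> \<in> ?M" for \<theta>
  proof -
    obtain y where y: "y \<in> U2" "\<tau> y = \<theta>" using \<tau>_surj[OF assms \<theta>] by blast
    show ?thesis
      by (rule bij_betw_same_card[of "\<lambda>x. x + y"], rule bij_betw_byWitness[where f' = "\<lambda>x. x + y"])
         (use y GF_add_p[OF p] K_add[OF r1] p_gt_1 in \<open>auto simp: U0_eq U2_def \<tau>_add add.assoc\<close>)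
  qed
  have "S r (c0 ^ 2) = (\<Sum>x\<in>U2. chi k (\<tau> x ^ (p + 1)))" using assms by (simp add: S_eq_U2 \<psi>_U2)
  also have "\<dots> = (\<Sum>\<theta>\<in>?M. \<Sum>x | x \<in> U2 \<and> \<tau> x = \<theta>. chi k (\<tau> x ^ (p + 1)))"
    using finU2 finM by (intro sum.group[symmetric]) (auto simp: U2_def)
  also have "\<dots> = (\<Sum>\<theta>\<in>?M. int (card U0) * chi k (\<theta> ^ (p + 1)))"
    by (intro sum.cong refl) (simp add: card_fib)
  also have "\<dots> = - int (card U0 * p)" by (simp only: sum_norm_GF2 sum_distrib_left[symmetric]) simp
  also have "\<dots> < 0"
  proof -
    have "0 \<in> U0" using K_0[OF r1] by (simp add: U0_eq \<tau>_def act_zero[OF p] frob_0_p[OF p])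
    hence "card U0 > 0" using finite_K[OF r1] by (auto simp: card_gt_0_iff U0_def)
    thus ?thesis using p_gt_1 by simp
  qed
  finally show ?thesis .
qed

end

end

section \<open>Valuation rings\<close>

locale valring =
  fixes F V :: "'a :: field set"
  assumes F_1: "1 \<in> F" and F_diff: "\<And>a b. a \<in> F \<Longrightarrow> b \<in> F \<Longrightarrow> a - b \<in> F"
    and F_mult: "\<And>a b. a \<in> F \<Longrightarrow> b \<in> F \<Longrightarrow> a * b \<in> F" and F_inverse: "\<And>a. a \<in> F \<Longrightarrow> inverse a \<in> F"
    and V_F: "V \<subseteq> F" and V_1: "1 \<in> V" and V_diff: "\<And>a b. a \<in> V \<Longrightarrow> b \<in> V \<Longrightarrow> a - b \<in> V"
    and V_mult: "\<And>a b. a \<in> V \<Longrightarrow> b \<in> V \<Longrightarrow> a * b \<in> V"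
    and V_total: "\<And>z. z \<in> F \<Longrightarrow> z \<in> V \<or> inverse z \<in> V"
begin

abbreviation "P \<equiv> max_ideal V"

lemma V_0: "0 \<in> V" using V_diff[OF V_1 V_1] by simp
lemma V_minus: "a \<in> V \<Longrightarrow> - a \<in> V" using V_diff[OF V_0] by simp
lemma V_add: "a \<in> V \<Longrightarrow> b \<in> V \<Longrightarrow> a + b \<in> V" using V_diff[OF _ V_minus] by fastforce
lemma V_power: "a \<in> V \<Longrightarrow> a ^ n \<in> V" by (induction n) (auto intro: V_1 V_mult)
lemma V_sum: "(\<And>i. i \<in> I \<Longrightarrow> f i \<in> V) \<Longrightarrow> sum f I \<in> V"
  by (induction I rule: infinite_finite_induct) (auto intro: V_0 V_add)
lemma F_power: "a \<in> F \<Longrightarrow> a ^ n \<in> F" by (induction n) (auto intro: F_1 F_mult)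
lemma F_divide: "a \<in> F \<Longrightarrow> b \<in> F \<Longrightarrow> a / b \<in> F" by (simp add: divide_inverse F_mult F_inverse)
lemma F_powi: "a \<in> F \<Longrightarrow> a powi n \<in> F" by (simp add: power_int_def F_power F_inverse)

lemma P_V: "z \<in> P \<Longrightarrow> z \<in> V" by (simp add: max_ideal_def)
lemma P_0: "0 \<in> P" by (simp add: max_ideal_def V_0)
lemma unit_iff: "z \<in> V - P \<longleftrightarrow> z \<noteq> 0 \<and> z \<in> V \<and> inverse z \<in> V" by (auto simp: max_ideal_def)
lemma one_notin_P: "1 \<notin> P"
proof
  assume "1 \<in> P"
  hence "inverse 1 \<notin> V" unfolding max_ideal_def by simp
  thus False using V_1 by simp
qed
lemma P_iff: "z \<noteq> 0 \<Longrightarrow> z \<in> F \<Longrightarrow> z \<in> P \<longleftrightarrow> inverse z \<notin> V"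
  using V_total by (auto simp: max_ideal_def)

lemma unit_mult: "a \<in> V - P \<Longrightarrow> b \<in> V - P \<Longrightarrow> a * b \<in> V - P"
  unfolding unit_iff by (auto intro: V_mult)
lemma unit_inverse: "a \<in> V - P \<Longrightarrow> inverse a \<in> V - P"
  unfolding unit_iff by auto
lemma unit_1: "1 \<in> V - P" by (simp add: one_notin_P V_1)
lemma unit_power: "a \<in> V - P \<Longrightarrow> a ^ n \<in> V - P"
  by (induction n) (use unit_1 unit_mult in auto)

lemma P_mult: "a \<in> V \<Longrightarrow> b \<in> P \<Longrightarrow> a * b \<in> P"
proof (cases "a * b = 0")
  case False
  assume a: "a \<in> V" and b: "b \<in> P"
  hence "inverse b \<notin> V" using False by (auto simp: max_ideal_def)
  moreover have "inverse b = a * inverse (a * b)" using False by (simp add: field_simps)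
  ultimately have "inverse (a * b) \<notin> V" using V_mult[OF a] by metis
  thus ?thesis using V_mult[OF a P_V[OF b]] by (simp add: max_ideal_def)
qed (auto simp: P_0)

lemma P_mult': "a \<in> P \<Longrightarrow> b \<in> V \<Longrightarrow> a * b \<in> P" using P_mult[of b a] by (simp add: mult.commute)
lemma P_minus: "a \<in> P \<Longrightarrow> - a \<in> P" using P_mult[OF V_minus[OF V_1]] by simp

lemma P_add:
  assumes a: "a \<in> P" and b: "b \<in> P" shows "a + b \<in> P"
proof -
  have *: "c + d \<in> P" if "c \<in> P" "d \<in> P" "d \<noteq> 0" "c / d \<in> V" for c d
  proof -
    have "c + d = (c / d + 1) * d" using that by (simp add: field_simps)
    thus ?thesis using that by (simp add: P_mult V_add V_1)
  qed
  consider "a = 0" | "b = 0" | "a \<noteq> 0" "b \<noteq> 0" "a / b \<in> V" | "a \<noteq> 0" "b \<noteq> 0" "b / a \<in> V"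
    using V_total[of "a / b"] F_divide P_V[OF a] P_V[OF b] V_F by (auto simp: subset_iff)
  thus ?thesis using *[of a b] *[of b a] a b by cases (auto simp: add.commute)
qed

lemma P_diff: "a \<in> P \<Longrightarrow> b \<in> P \<Longrightarrow> a - b \<in> P" using P_add[OF _ P_minus] by fastforce
lemma P_sum: "(\<And>i. i \<in> I \<Longrightarrow> f i \<in> P) \<Longrightarrow> sum f I \<in> P"
  by (induction I rule: infinite_finite_induct) (auto intro: P_0 P_add)

lemma unit_add: "a \<in> V - P \<Longrightarrow> b \<in> P \<Longrightarrow> a + b \<in> V - P"
  using P_diff[of "a + b" b] V_add P_V by auto

lemma not_V: "z \<in> F \<Longrightarrow> z \<notin> V \<Longrightarrow> z \<noteq> 0 \<and> inverse z \<in> P"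
  using V_total[of z] V_0 by (auto simp: max_ideal_def)

lemma P_powerD:
  assumes z: "z \<in> F" "z ^ n \<in> P" shows "z \<in> P"
proof (rule ccontr)
  assume "z \<notin> P"
  hence nz: "z \<noteq> 0" and "inverse z \<in> V" using z V_total[of z] P_0 by (auto simp: max_ideal_def)
  hence "inverse z ^ n * z ^ n \<in> P" by (intro P_mult V_power z)
  thus False using nz one_notin_P by (simp flip: power_mult_distrib)
qed

lemma P_multD: "a \<in> V \<Longrightarrow> b \<in> V \<Longrightarrow> a * b \<in> P \<Longrightarrow> a \<in> P \<or> b \<in> P"
  using unit_mult[of a b] by blast

lemma V_powerD:
  assumes z: "z \<in> F" "z ^ n \<in> V" "n > 0" shows "z \<in> V"
proof (rule ccontr)
  assume "z \<notin> V"
  hence nz: "z \<noteq> 0" and i: "inverse z \<in> P" using not_V z(1) by auto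
  obtain l where n: "n = Suc l" using z(3) by (cases n) auto
  have "z = z ^ n * inverse z ^ l" using nz by (simp add: n field_simps)
  also have "\<dots> \<in> V" by (intro V_mult V_power z(2) P_V[OF i])
  finally show False using \<open>z \<notin> V\<close> by simp
qed

lemma unit_powerD:
  assumes "z \<in> F" "z ^ n \<in> V - P" "n > 0" shows "z \<in> V - P"
proof -
  have "z \<in> V" using V_powerD assms by auto
  moreover have "z \<notin> P"
  proof
    assume "z \<in> P"
    moreover obtain l where n: "n = Suc l" using assms(3) by (cases n) auto
    ultimately have "z ^ n \<in> P" using P_mult'[OF _ V_power[of z l]] P_V by simp
    thus False using assms(2) by simp
  qed
  ultimately show ?thesis by simp
qed

text \<open>Discreteness is part of the notion: it has to be shown at each kind of place that every
  nonzero function is a power of \<open>t\<close> times a unit.\<close>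

definition uniformizer :: "'a \<Rightarrow> bool" where
  "uniformizer t \<longleftrightarrow> t \<in> P \<and> t \<noteq> 0 \<and> (\<forall>z\<in>F. z \<noteq> 0 \<longrightarrow> (\<exists>n. \<exists>u\<in>V - P. z = t powi n * u))"

context
  fixes t assumes t: "uniformizer t"
begin

lemma t_P: "t \<in> P" and t_nz: "t \<noteq> 0" using t by (auto simp: uniformizer_def)
lemma t_F: "t \<in> F" using t_P P_V V_F by auto
lemma t_dec: "z \<in> F \<Longrightarrow> z \<noteq> 0 \<Longrightarrow> \<exists>n. \<exists>u\<in>V - P. z = t powi n * u" using t by (auto simp: uniformizer_def)

lemma powi_V: "n \<ge> 0 \<Longrightarrow> t powi n \<in> V"
  using V_power[OF P_V[OF t_P]] by (auto simp: power_int_def)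
lemma powi_P: assumes "n > 0" shows "t powi n \<in> P"
proof -
  have "t powi n = t * t powi (n - 1)" using t_nz power_int_add[of t 1 "n - 1"] by simp
  thus ?thesis using P_mult'[OF t_P powi_V] assms by simp
qed

lemma powi_unit_V_iff: assumes "u \<in> V - P" shows "t powi n * u \<in> V \<longleftrightarrow> n \<ge> 0"
proof
  assume *: "t powi n * u \<in> V"
  show "n \<ge> 0"
  proof (rule ccontr)
    assume "\<not> n \<ge> 0"
    hence "t powi (- n) * (t powi n * u) \<in> P" using * by (intro P_mult' powi_P) auto
    thus False using assms t_nz by (simp add: power_int_add[symmetric] mult.assoc[symmetric])
  qed
qed (use assms powi_V V_mult in auto)

lemma powi_unit_P_iff: assumes u: "u \<in> V - P" shows "t powi n * u \<in> P \<longleftrightarrow> n > 0"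
proof -
  have nz: "t powi n * u \<noteq> 0" using t_nz u P_0 by auto
  have "t powi n * u \<in> F" using u V_F by (auto intro!: F_mult F_powi t_F)
  hence "t powi n * u \<in> P \<longleftrightarrow> inverse (t powi n * u) \<notin> V" using P_iff nz by simp
  also have "inverse (t powi n * u) = t powi (- n) * inverse u" by (simp add: power_int_minus)
  finally show ?thesis using powi_unit_V_iff[OF unit_inverse[OF u], of "- n"] by auto
qed

lemma max_ideal_eq: "P = (\<lambda>v. t * v) ` V"
proof (intro equalityI subsetI)
  fix z assume z: "z \<in> P"
  show "z \<in> (\<lambda>v. t * v) ` V"
  proof (cases "z = 0")
    case True thus ?thesis using V_0 by (intro image_eqI[of _ _ 0]) auto
  next
    case False
    then obtain n u where u: "u \<in> V - P" and zn: "z = t powi n * u" using t_dec z P_V V_F by blast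
    hence "n > 0" using powi_unit_P_iff z by simp
    hence "t powi (n - 1) * u \<in> V" using u powi_unit_V_iff by simp
    moreover have "z = t * (t powi (n - 1) * u)"
      using t_nz power_int_add[of t 1 "n - 1"] by (simp add: zn mult.assoc[symmetric])
    ultimately show ?thesis by blast
  qed
qed (use P_mult'[OF t_P] in auto)

text \<open>Two generators of the maximal ideal differ by a unit, so the exponent found with one of
  them is valid for all, as \<open>valuation\<close> demands.\<close>

lemma valuation_eq:
  assumes u: "u \<in> V - P" and z: "z = t powi n * u"
  shows "valuation V z = n"
proof -
  have unit_ratio: "\<exists>c\<in>V - P. t' = t * c" if P': "P = (\<lambda>v. t' * v) ` V" for t'
  proof -
    have "t' \<in> P" using P' V_1 by (auto intro: image_eqI[of _ _ 1])
    then obtain c where c: "c \<in> V" "t' = t * c" using max_ideal_eq by auto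
    obtain d where d: "d \<in> V" "t = t' * d" using t_P unfolding P' by auto
    have "c * d = 1" using c d t_nz by (metis mult.assoc mult_cancel_left1 mult.commute)
    hence "c \<noteq> 0" "inverse c = d" by (auto simp: inverse_unique)
    hence "c \<in> V - P" using c d(1) unfolding unit_iff by simp
    thus ?thesis using c(2) by blast
  qed
  have powi_unit: "c powi i \<in> V - P" if "c \<in> V - P" for c i
    using unit_power[OF that] unit_inverse[OF unit_power[OF that]] unit_power[OF unit_inverse[OF that]]
    by (auto simp: power_int_def)
  show ?thesis unfolding valuation_def
  proof (rule the_equality)
    show "\<forall>t'. P = (\<lambda>v. t' * v) ` V \<longrightarrow> z * t' powi (- n) \<in> V - P"
    proof (intro allI impI)
      fix t' assume "P = (\<lambda>v. t' * v) ` V"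
      then obtain c where c: "c \<in> V - P" "t' = t * c" using unit_ratio by blast
      have "z * t' powi (- n) = u * c powi (- n)"
        using t_nz by (simp add: z c(2) power_int_mult_distrib power_int_minus mult_ac)
      thus "z * t' powi (- n) \<in> V - P" using unit_mult[OF u powi_unit[OF c(1)]] by simp
    qed
  next
    fix n' assume "\<forall>t'. P = (\<lambda>v. t' * v) ` V \<longrightarrow> z * t' powi (- n') \<in> V - P"
    hence "z * t powi (- n') \<in> V - P" using max_ideal_eq by blast
    moreover have "z * t powi (- n') = t powi (n - n') * u"
      using t_nz power_int_add[of t n "- n'"] by (simp add: z mult_ac)
    ultimately show "n' = n" using powi_unit_P_iff[OF u] powi_unit_V_iff[OF u] by auto
  qed
qed

lemma valuation_ge_iff:
  assumes "z \<in> F" "z \<noteq> 0"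
  shows "valuation V z \<ge> - d \<longleftrightarrow> z * t powi d \<in> V"
    and "valuation V z \<ge> - d \<longleftrightarrow> z * t powi (d + 1) \<in> P"
proof -
  obtain n u where u: "u \<in> V - P" and z: "z = t powi n * u" using t_dec assms by blast
  have *: "z * t powi i = t powi (n + i) * u" for i using t_nz by (simp add: z power_int_add mult_ac)
  show "valuation V z \<ge> - d \<longleftrightarrow> z * t powi d \<in> V"
    unfolding * powi_unit_V_iff[OF u] valuation_eq[OF u z] by auto
  show "valuation V z \<ge> - d \<longleftrightarrow> z * t powi (d + 1) \<in> P"
    unfolding * powi_unit_P_iff[OF u] valuation_eq[OF u z] by auto
qed

end

end

subsection \<open>Existence\<close>

text \<open>The degree descent in Chevalley's theorem. The relation for \<open>inverse z\<close>,
  multiplied by \<open>z ^ degree Pz\<close>, rewrites the leading power of \<open>z\<close> through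
  lower ones.\<close>

lemma valuation_ring_degree_reduction:
  fixes t z :: "'a :: field" and Pz Q :: "'a poly"
  assumes V: "1 \<in> V" "\<And>a b. a \<in> V \<Longrightarrow> b \<in> V \<Longrightarrow> a - b \<in> V" "\<And>a b. a \<in> V \<Longrightarrow> b \<in> V \<Longrightarrow> a * b \<in> V"
    and t: "t \<in> V" "\<And>b. b \<in> V \<Longrightarrow> t * b \<noteq> 1" and z: "z \<noteq> 0"
    and P: "\<And>i. coeff Pz i \<in> V" "t * poly Pz z = 1"
    and Q: "\<And>i. coeff Q i \<in> V" "t * poly Q (inverse z) = 1" and deg: "degree Q \<le> degree Pz"
  shows "\<exists>P'. (\<forall>i. coeff P' i \<in> V) \<and> t * poly P' z = 1 \<and> degree P' < degree Pz"
proof -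
  define n m where "n = degree Pz" and "m = degree Q"
  have V0: "0 \<in> V" using V(2)[OF V(1) V(1)] by simp
  have Vadd: "a + b \<in> V" if "a \<in> V" "b \<in> V" for a b using V(2)[OF that(1) V(2)[OF V0 that(2)]] by simp
  have Vsum: "sum h I \<in> V" if "\<And>i. i \<in> I \<Longrightarrow> h i \<in> V" for h :: "nat \<Rightarrow> 'a" and I
    using that by (induction I rule: infinite_finite_induct) (auto intro: V0 Vadd)
  have n0: "n > 0"
  proof (rule ccontr)
    assume "\<not> n > 0"
    then obtain b where "Pz = [:b:]" by (auto simp: n_def elim: degree_eq_zeroE)
    thus False using P t(2)[of b] P(1)[of 0] by simp
  qed
  \<comment> \<open>The second relation reads \<open>c * z ^ n = t * poly T z\<close>. The first one
    is multiplied by \<open>c\<close> and not divided by it; adding \<open>coeff Q 0\<close>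
    restores the value 1, as \<open>t * coeff Q 0 + c = 1\<close>.\<close>
  define c where "c = 1 - t * coeff Q 0"
  define T where "T = (\<Sum>j=1..m. monom (coeff Q j) (n - j))"
  define P' where "P' = [:coeff Q 0:] + smult c (\<Sum>i<n. monom (coeff Pz i) i) + smult (coeff Pz n * t) T"
  have "z ^ n * (t * poly Q (inverse z)) = z ^ n * (t * coeff Q 0) + t * poly T z"
  proof -
    have "poly Q (inverse z) = (\<Sum>j\<le>m. coeff Q j * inverse z ^ j)" by (simp add: poly_altdef m_def)
    also have "{..m} = insert 0 {1..m}" by auto
    finally have "poly Q (inverse z) = coeff Q 0 + (\<Sum>j=1..m. coeff Q j * inverse z ^ j)" by simp
    moreover have "z ^ n * (\<Sum>j=1..m. coeff Q j * inverse z ^ j) = poly T z"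
      unfolding T_def poly_sum poly_monom sum_distrib_left
    proof (rule sum.cong, rule refl)
      fix j assume "j \<in> {1..m}"
      hence "n = (n - j) + j" using deg by (auto simp: n_def m_def)
      hence "z ^ n = z ^ (n - j) * z ^ j" by (metis power_add)
      thus "z ^ n * (coeff Q j * inverse z ^ j) = coeff Q j * z ^ (n - j)" using z by (simp add: field_simps)
    qed
    ultimately show ?thesis by (simp add: algebra_simps)
  qed
  hence cz: "c * z ^ n = t * poly T z" using Q(2) by (simp add: c_def algebra_simps)
  have "poly Pz z = (\<Sum>i<n. coeff Pz i * z ^ i) + coeff Pz n * z ^ n"
    by (simp add: poly_altdef n_def lessThan_Suc_atMost[symmetric])
  hence "poly P' z = coeff Q 0 + c * (poly Pz z - coeff Pz n * z ^ n) + coeff Pz n * (t * poly T z)"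
    by (simp add: P'_def poly_sum poly_monom mult_ac)
  also have "\<dots> = coeff Q 0 + c * poly Pz z" by (simp add: cz[symmetric] algebra_simps)
  finally have "t * poly P' z = t * coeff Q 0 + c * (t * poly Pz z)" by (simp add: algebra_simps)
  hence eval: "t * poly P' z = 1" using P(2) by (simp add: c_def)
  have deg_T: "degree T \<le> n - 1" unfolding T_def by (rule degree_sum_le) (auto intro!: order.trans[OF degree_monom_le])
  have deg_S: "degree (\<Sum>i<n. monom (coeff Pz i) i) \<le> n - 1"
    by (rule degree_sum_le) (auto intro!: order.trans[OF degree_monom_le])
  have "degree P' \<le> n - 1" unfolding P'_def
    by (intro degree_add_le order.trans[OF degree_smult_le] deg_T deg_S) simp
  moreover have "coeff P' i \<in> V" for i
    unfolding P'_def T_def c_def coeff_add coeff_smult coeff_sum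
    by (intro Vadd V t P Q Vsum) (auto simp: coeff_pCons V0 P Q split: nat.split)
  ultimately show ?thesis using eval n0 by (intro exI[of _ P']) (auto simp: n_def)
qed

text \<open>A subring maximal among those containing \<open>R\<close> in which \<open>t\<close>
  stays a non-unit is a valuation ring: if neither \<open>z\<close> nor \<open>inverse z\<close>
  belonged to it, adjoining either would invert \<open>t\<close>.\<close>

lemma ex_valuation_ring:
  fixes t :: "'a :: field"
  assumes R: "1 \<in> R" "\<And>a b. a \<in> R \<Longrightarrow> b \<in> R \<Longrightarrow> a - b \<in> R" "\<And>a b. a \<in> R \<Longrightarrow> b \<in> R \<Longrightarrow> a * b \<in> R"
    and t: "t \<in> R" "\<And>b. b \<in> R \<Longrightarrow> t * b \<noteq> 1"
  shows "\<exists>V. R \<subseteq> V \<and> valring UNIV V \<and> (\<forall>b\<in>V. t * b \<noteq> 1)"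
proof -
  define Fam where "Fam = {V. R \<subseteq> V \<and> (\<forall>a\<in>V. \<forall>b\<in>V. a - b \<in> V \<and> a * b \<in> V) \<and> (\<forall>b\<in>V. t * b \<noteq> 1)}"
  have "\<exists>M\<in>Fam. \<forall>Xs\<in>Fam. M \<subseteq> Xs \<longrightarrow> Xs = M"
  proof (rule subset_Zorn_nonempty)
    have "R \<in> Fam" unfolding Fam_def using R t by blast
    thus "Fam \<noteq> {}" by blast
    fix Ch assume C: "Ch \<noteq> {}" "subset.chain Fam Ch"
    have Ch_Fam: "Xs \<in> Fam" if "Xs \<in> Ch" for Xs using that C(2) by (auto simp: subset_chain_def)
    have closed: "a - b \<in> \<Union>Ch \<and> a * b \<in> \<Union>Ch" if ab: "a \<in> \<Union>Ch" "b \<in> \<Union>Ch" for a b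
    proof -
      obtain Xs Y where XY: "Xs \<in> Ch" "Y \<in> Ch" "a \<in> Xs" "b \<in> Y" using ab by blast
      hence "Xs \<subseteq> Y \<or> Y \<subseteq> Xs" using C(2) by (auto simp: subset_chain_def)
      then obtain Z where "Z \<in> Ch" "a \<in> Z" "b \<in> Z" using XY by blast
      moreover have "Z \<in> Fam" using \<open>Z \<in> Ch\<close> by (rule Ch_Fam)
      ultimately show ?thesis unfolding Fam_def by blast
    qed
    have "R \<subseteq> \<Union>Ch" using C(1) Ch_Fam unfolding Fam_def by blast
    moreover have "\<forall>b\<in>\<Union>Ch. t * b \<noteq> 1" using Ch_Fam unfolding Fam_def by blast
    ultimately show "\<Union>Ch \<in> Fam" unfolding Fam_def using closed by blast
  qed
  then obtain V where VA: "V \<in> Fam" and max: "\<And>Xs. Xs \<in> Fam \<Longrightarrow> V \<subseteq> Xs \<Longrightarrow> Xs = V" by auto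
  have V: "1 \<in> V" "\<And>a b. a \<in> V \<Longrightarrow> b \<in> V \<Longrightarrow> a - b \<in> V" "\<And>a b. a \<in> V \<Longrightarrow> b \<in> V \<Longrightarrow> a * b \<in> V"
    "t \<in> V" "\<And>b. b \<in> V \<Longrightarrow> t * b \<noteq> 1" "R \<subseteq> V"
    using VA R t unfolding Fam_def by blast+
  have V0: "0 \<in> V" using V(2)[OF V(1) V(1)] by simp
  have Vadd: "a + b \<in> V" if "a \<in> V" "b \<in> V" for a b using V(2)[OF that(1) V(2)[OF V0 that(2)]] by simp
  have Vsum: "sum h I \<in> V" if "\<And>i. i \<in> I \<Longrightarrow> h i \<in> V" for h :: "nat \<Rightarrow> 'a" and I
    using that by (induction I rule: infinite_finite_induct) (auto intro: V0 Vadd)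
  have adjoin: "\<exists>P. (\<forall>i. coeff P i \<in> V) \<and> t * poly P z = 1" if z: "z \<notin> V" for z
  proof (rule ccontr)
    assume no: "\<not> ?thesis"
    define Xs where "Xs = {poly P z | P. \<forall>i. coeff P i \<in> V}"
    have VX: "V \<subseteq> Xs"
    proof
      fix a assume "a \<in> V"
      hence "\<forall>i. coeff [:a:] i \<in> V" using V0 by (auto simp: coeff_pCons split: nat.split)
      moreover have "a = poly [:a:] z" by simp
      ultimately show "a \<in> Xs" unfolding Xs_def by blast
    qed
    have "z \<in> Xs"
    proof -
      have "\<forall>i. coeff [:0, 1:] i \<in> V" using V0 V(1) by (auto simp: coeff_pCons split: nat.split)
      moreover have "z = poly [:0, 1:] z" by simp
      ultimately show ?thesis unfolding Xs_def by blast
    qed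
    have "a - b \<in> Xs \<and> a * b \<in> Xs" if ab: "a \<in> Xs" "b \<in> Xs" for a b
    proof -
      obtain P Q where PQ: "\<forall>i. coeff P i \<in> V" "\<forall>i. coeff Q i \<in> V" "a = poly P z" "b = poly Q z"
        using ab unfolding Xs_def by blast
      have "\<forall>i. coeff (P - Q) i \<in> V" "\<forall>i. coeff (P * Q) i \<in> V"
        using PQ by (auto simp: coeff_mult intro!: V Vsum)
      moreover have "a - b = poly (P - Q) z" "a * b = poly (P * Q) z" by (simp_all add: PQ)
      ultimately show ?thesis unfolding Xs_def by blast
    qed
    moreover have "\<forall>b\<in>Xs. t * b \<noteq> 1" using no by (auto simp: Xs_def)
    ultimately have "Xs \<in> Fam" using VX V(6) unfolding Fam_def by blast
    thus False using max VX \<open>z \<in> Xs\<close> z by blast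
  qed
  have "z \<in> V \<or> inverse z \<in> V" for z
  proof (rule ccontr)
    assume "\<not> ?thesis"
    hence z: "z \<notin> V" "inverse z \<notin> V" "z \<noteq> 0" using V0 by auto
    \<comment> \<open>Of all pairs of relations inverting \<open>t\<close>, one of least total
      degree is taken; the descent shortens the longer of the two.\<close>
    define good where "good z P \<longleftrightarrow> (\<forall>i. coeff P i \<in> V) \<and> t * poly P z = 1" for z P
    have "\<exists>PQ. good z (fst PQ) \<and> good (inverse z) (snd PQ)"
      using adjoin[OF z(1)] adjoin[OF z(2)] by (auto simp: good_def)
    then obtain PQ where PQ: "good z (fst PQ)" "good (inverse z) (snd PQ)"
      and least: "\<And>PQ'. good z (fst PQ') \<and> good (inverse z) (snd PQ') \<Longrightarrow>
        degree (fst PQ) + degree (snd PQ) \<le> degree (fst PQ') + degree (snd PQ')"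
      using exists_least_lemma[of "\<lambda>n. \<exists>PQ. good z (fst PQ) \<and> good (inverse z) (snd PQ) \<and> degree (fst PQ) + degree (snd PQ) = n"]
      using ex_has_least_nat[of "\<lambda>PQ. good z (fst PQ) \<and> good (inverse z) (snd PQ)" _ "\<lambda>PQ. degree (fst PQ) + degree (snd PQ)"]
      by blast
    obtain A B where AB: "PQ = (A, B)" by (cases PQ)
    show False
    proof (cases "degree B \<le> degree A")
      case True
      obtain A' where "good z A'" "degree A' < degree A"
        using valuation_ring_degree_reduction[OF V(1-5) z(3), of A B] True PQ by (auto simp: good_def AB)
      thus False using least[of "(A', B)"] PQ by (auto simp: AB)
    next
      case False
      obtain B' where "good (inverse z) B'" "degree B' < degree B"
        using valuation_ring_degree_reduction[OF V(1-5), of "inverse z" B A] z(3) False PQ by (auto simp: good_def AB)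
      thus False using least[of "(A, B')"] PQ by (auto simp: AB)
    qed
  qed
  hence "valring UNIV V" using V by unfold_locales auto
  thus ?thesis using V by blast
qed

section \<open>Dimensions over a finite field\<close>

text \<open>\<open>\<phi>\<close> is a linear model of the quotient of \<open>V\<close> by
  \<open>W\<close>. Over a finite field the greatest size of an independent set can then be read off
  from a cardinality, and every dimension below is obtained in this way.\<close>

lemma card_image_eq_power_dim_quot:
  fixes \<phi> :: "'a :: field \<Rightarrow> 'a"
  assumes k: "finite k" "0 \<in> k" "1 \<in> k" "\<And>a b. a \<in> k \<Longrightarrow> b \<in> k \<Longrightarrow> a - b \<in> k"
      "\<And>a b. a \<in> k \<Longrightarrow> b \<in> k \<Longrightarrow> a * b \<in> k" "\<And>a. a \<in> k \<Longrightarrow> inverse a \<in> k"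
    and V: "0 \<in> V" "\<And>a b. a \<in> V \<Longrightarrow> b \<in> V \<Longrightarrow> a + b \<in> V" "\<And>c a. c \<in> k \<Longrightarrow> a \<in> V \<Longrightarrow> c * a \<in> V"
    and add: "\<And>a b. a \<in> V \<Longrightarrow> b \<in> V \<Longrightarrow> \<phi> (a + b) = \<phi> a + \<phi> b"
    and scale: "\<And>c a. c \<in> k \<Longrightarrow> a \<in> V \<Longrightarrow> \<phi> (c * a) = c * \<phi> a"
    and ker: "\<And>a. a \<in> V \<Longrightarrow> \<phi> a = 0 \<longleftrightarrow> a \<in> W" and fin: "finite (\<phi> ` V)"
  shows "card (\<phi> ` V) = card k ^ dim_quot k V W"
proof -
  let ?S = "\<lambda>B c. \<Sum>b\<in>B. c b * b"
  have kneg: "- a \<in> k" if "a \<in> k" for a using k(4)[OF k(2) that] by simp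
  have kadd: "a + b \<in> k" if "a \<in> k" "b \<in> k" for a b using k(4)[OF that(1) kneg[OF that(2)]] by simp
  have Vsum: "(\<Sum>b\<in>B. c b * b) \<in> V" if "B \<subseteq> V" "\<And>b. b \<in> B \<Longrightarrow> c b \<in> k" for B c
    using that by (induction B rule: infinite_finite_induct) (auto intro: V)
  have \<phi>sum: "\<phi> (\<Sum>b\<in>B. c b * b) = (\<Sum>b\<in>B. c b * \<phi> b)" if "finite B" "B \<subseteq> V" "\<And>b. b \<in> B \<Longrightarrow> c b \<in> k" for B c
    using that
  proof (induction B rule: finite_induct)
    case empty
    have "\<phi> 0 = 0 * \<phi> 0" using scale[OF k(2) V(1)] by simp
    thus ?case by simp
  next
    case (insert b B)
    have "\<phi> (c b * b + (\<Sum>b\<in>B. c b * b)) = c b * \<phi> b + \<phi> (\<Sum>b\<in>B. c b * b)"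
      using insert.prems by (subst add) (auto intro!: Vsum V scale)
    thus ?case using insert by simp
  qed
  define indep where "indep B \<longleftrightarrow> B \<subseteq> V \<and> finite B \<and> indep_mod k W B" for B
  define comb where "comb B = (\<lambda>c. \<phi> (?S B c)) ` (PiE B (\<lambda>_. k))" for B
  have sub: "comb B \<subseteq> \<phi> ` V" if "B \<subseteq> V" for B
    unfolding comb_def using that by (auto intro!: imageI Vsum)
  have indepD: "\<forall>b\<in>B. c b = 0" if "indep B" "\<forall>b\<in>B. c b \<in> k" "(\<Sum>b\<in>B. c b * \<phi> b) = 0" for B c
  proof -
    have "?S B c \<in> W" using \<phi>sum[of B c] ker[OF Vsum[of B c]] that by (auto simp: indep_def)
    thus ?thesis using that by (auto simp: indep_def indep_mod_def)
  qed
  have card_comb: "card (comb B) = card k ^ card B" if B: "indep B" for B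
  proof -
    have "inj_on (\<lambda>c. \<phi> (?S B c)) (PiE B (\<lambda>_. k))"
    proof (rule inj_onI)
      fix c d assume cd: "c \<in> PiE B (\<lambda>_. k)" "d \<in> PiE B (\<lambda>_. k)" "\<phi> (?S B c) = \<phi> (?S B d)"
      have "(\<Sum>b\<in>B. (c b - d b) * \<phi> b) = 0"
        using cd \<phi>sum[of B c] \<phi>sum[of B d] B by (auto simp: indep_def left_diff_distrib sum_subtractf PiE_def Pi_def)
      moreover have "\<forall>b\<in>B. c b - d b \<in> k" using cd k(4) by (auto simp: PiE_def Pi_def)
      ultimately have "\<forall>b\<in>B. c b - d b = 0" using indepD[OF B, of "\<lambda>b. c b - d b"] by simp
      thus "c = d" using cd by (intro PiE_ext[of c B "\<lambda>_. k" d]) auto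
    qed
    thus ?thesis using B by (simp add: comb_def card_image card_PiE indep_def)
  qed
  have k2: "card k \<ge> 2"
  proof -
    have "card {0, 1::'a} \<le> card k" using k by (intro card_mono) auto
    thus ?thesis by simp
  qed
  \<comment> \<open>Without a bound on independent sets the \<open>GREATEST\<close> in
    \<open>dim_quot\<close> would carry no information.\<close>
  have bound: "card B \<le> card (\<phi> ` V)" if "indep B" for B
  proof -
    have "card B < 2 ^ card B" by (rule less_exp)
    also have "\<dots> \<le> card k ^ card B" using k2 by (rule power_mono) simp
    also have "\<dots> \<le> card (\<phi> ` V)"
      unfolding card_comb[OF that, symmetric] using that sub fin by (intro card_mono) (auto simp: indep_def)
    finally show ?thesis by simp
  qed
  let ?Q = "\<lambda>n. \<exists>B\<subseteq>V. finite B \<and> card B = n \<and> indep_mod k W B"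
  have Q0: "?Q 0" by (rule exI[of _ "{}"]) (simp add: indep_mod_def)
  have Qb: "n \<le> card (\<phi> ` V)" if "?Q n" for n using that bound by (auto simp: indep_def)
  have "?Q (GREATEST n. ?Q n)" by (rule GreatestI_nat[of ?Q, OF Q0]) (use Qb in blast)
  then obtain B where B: "indep B" "card B = dim_quot k V W" by (auto simp: indep_def dim_quot_def)
  have "comb B = \<phi> ` V"
  proof (rule ccontr)
    assume "comb B \<noteq> \<phi> ` V"
    then obtain v where v: "v \<in> V" "\<phi> v \<notin> comb B" using sub[of B] B by (auto simp: indep_def)
    have vB: "v \<notin> B"
    proof
      assume vB: "v \<in> B"
      have "?S B (\<lambda>b\<in>B. if b = v then 1 else 0) = (\<Sum>b\<in>B. if b = v then v else 0)" by (rule sum.cong) auto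
      also have "\<dots> = v" using vB B by (simp add: indep_def)
      finally have "\<phi> v = \<phi> (?S B (\<lambda>b\<in>B. if b = v then 1 else 0))" by simp
      moreover have "(\<lambda>b\<in>B. if b = v then 1 else 0) \<in> PiE B (\<lambda>_. k)" using k by auto
      ultimately show False using v(2) unfolding comb_def by blast
    qed
    have "indep_mod k W (insert v B)" unfolding indep_mod_def
    proof (intro allI impI)
      fix c assume c: "(\<forall>b\<in>insert v B. c b \<in> k) \<and> ?S (insert v B) c \<in> W"
      have finB: "finite B" and BV: "B \<subseteq> V" using B by (auto simp: indep_def)
      have "?S (insert v B) c \<in> V" by (rule Vsum) (use BV v c in auto)
      hence "\<phi> (?S (insert v B) c) = 0" using ker c by blast
      hence eq: "c v * \<phi> v + (\<Sum>b\<in>B. c b * \<phi> b) = 0"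
        using \<phi>sum[of "insert v B" c] c finB BV v vB by simp
      have cv: "c v = 0"
      proof (rule ccontr)
        assume cv: "c v \<noteq> 0"
        have "\<phi> v = (\<Sum>b\<in>B. (- inverse (c v) * c b) * \<phi> b)"
        proof -
          have "c v * \<phi> v = - (\<Sum>b\<in>B. c b * \<phi> b)" using eq by (simp add: add_eq_0_iff)
          hence "\<phi> v = - inverse (c v) * (\<Sum>b\<in>B. c b * \<phi> b)" using cv by (simp add: field_simps)
          thus ?thesis by (simp add: sum_distrib_left mult.assoc)
        qed
        moreover define d where "d = (\<lambda>b\<in>B. - inverse (c v) * c b)"
        ultimately have "\<phi> v = (\<Sum>b\<in>B. d b * \<phi> b)" by simp
        moreover have dk: "d \<in> PiE B (\<lambda>_. k)" unfolding d_def using c k kneg by auto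
        ultimately have "\<phi> v = \<phi> (?S B d)" using \<phi>sum[OF finB BV, of d] by (auto simp: PiE_def Pi_def)
        thus False using v(2) dk by (auto simp: comb_def)
      qed
      hence "\<forall>b\<in>B. c b = 0" using indepD[OF B(1), of c] c eq by simp
      thus "\<forall>b\<in>insert v B. c b = 0" using cv by simp
    qed
    hence "?Q (Suc (card B))" using B v vB by (intro exI[of _ "insert v B"]) (auto simp: indep_def)
    hence "Suc (card B) \<le> (GREATEST n. ?Q n)" by (rule Greatest_le_nat) (use Qb in blast)
    thus False using B(2) by (simp add: dim_quot_def)
  qed
  thus ?thesis using card_comb[OF B(1)] B(2) by simp
qed

section \<open>Bivariate polynomials and points of an Artin--Schreier curve\<close>

text \<open>Coefficients stay in the subring \<open>S\<close>, so the same division serves for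
  \<open>H\<close> in the variable \<open>y\<close> and for \<open>T c\<close> in the variable
  \<open>x\<close>, without leaving the constant field.\<close>

lemma monic_division:
  fixes d G :: "'b :: comm_ring_1 poly"
  assumes S: "0 \<in> S" "1 \<in> S" "\<And>a b. a \<in> S \<Longrightarrow> b \<in> S \<Longrightarrow> a - b \<in> S" "\<And>a b. a \<in> S \<Longrightarrow> b \<in> S \<Longrightarrow> a * b \<in> S"
    and d: "\<And>i. coeff d i \<in> S" "lead_coeff d = 1" and G: "\<And>i. coeff G i \<in> S"
  shows "\<exists>Q R. (\<forall>i. coeff Q i \<in> S) \<and> (\<forall>i. coeff R i \<in> S) \<and> G = d * Q + R \<and> (\<forall>i\<ge>degree d. coeff R i = 0)"
proof -
  have add: "a + b \<in> S" if "a \<in> S" "b \<in> S" for a b using S(3)[OF that(1) S(3)[OF S(1) that(2)]] by simp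
  have "\<exists>Q R. (\<forall>i. coeff Q i \<in> S) \<and> (\<forall>i. coeff R i \<in> S) \<and> G = d * Q + R \<and> (\<forall>i\<ge>degree d. coeff R i = 0)"
    if "\<And>i. coeff G i \<in> S" "\<And>i. i \<ge> n \<Longrightarrow> coeff G i = 0" for n G
    using that
  proof (induction n arbitrary: G)
    case 0
    hence "G = 0" by (intro poly_eqI) simp
    thus ?case using S by (intro exI[of _ 0]) auto
  next
    case (Suc n)
    show ?case
    proof (cases "n < degree d")
      case True
      thus ?thesis using S Suc.prems by (intro exI[of _ 0] exI[of _ G]) auto
    next
      case False
      define l where "l = n - degree d"
      define c where "c = coeff G n"
      define G' where "G' = G - monom c l * d"
      have cS: "c \<in> S" using Suc.prems by (simp add: c_def)
      have G': "coeff G' i = coeff G i - (if i < l then 0 else c * coeff d (i - l))" for i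
        unfolding G'_def by (simp add: coeff_monom_mult)
      have "coeff G' i \<in> S" for i unfolding G' using S Suc.prems(1) cS d(1) by auto
      moreover have "coeff G' i = 0" if "i \<ge> n" for i
      proof (cases "i = n")
        case True
        thus ?thesis using False d(2) by (simp add: G' l_def c_def)
      next
        case ne: False
        hence "i - l > degree d" using that False by (simp add: l_def)
        thus ?thesis using ne that Suc.prems(2)[of i] by (simp add: G' coeff_eq_0)
      qed
      ultimately obtain Q R where QR: "\<forall>i. coeff Q i \<in> S" "\<forall>i. coeff R i \<in> S" "G' = d * Q + R" "\<forall>i\<ge>degree d. coeff R i = 0"
        using Suc.IH[of G'] by blast
      have "G = d * (Q + monom c l) + R" using QR(3) by (simp add: G'_def algebra_simps)
      moreover have "\<forall>i. coeff (Q + monom c l) i \<in> S" using QR(1) cS add S(1) by auto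
      ultimately show ?thesis using QR(2,4) by blast
    qed
  qed
  from this[of G "Suc (degree G)"] show ?thesis using G by (auto simp: coeff_eq_0)
qed

lemma poly_eq_0_if_many_roots:
  fixes P :: "'b :: idom poly"
  assumes "\<And>i. i \<ge> n \<Longrightarrow> coeff P i = 0" "finite Z" "card Z \<ge> n" "\<And>z. z \<in> Z \<Longrightarrow> poly P z = 0"
  shows "P = 0"
proof (rule ccontr)
  assume P: "P \<noteq> 0"
  have "card Z \<le> card {z. poly P z = 0}" using assms(4) by (intro card_mono poly_roots_finite[OF P]) auto
  also have "\<dots> \<le> degree P" by (rule card_poly_roots_bound[OF P])
  also have "\<dots> < n" using assms(1)[of "degree P"] P by (metis leading_coeff_0_iff not_le)
  finally show False using assms(3) by simp
qed

definition ev :: "'a :: comm_ring_1 poly poly \<Rightarrow> 'a \<Rightarrow> 'a \<Rightarrow> 'a" where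
  "ev G a b = poly (poly G [:b:]) a"

lemma ev_add [simp]: "ev (G + G') a b = ev G a b + ev G' a b" by (simp add: ev_def)
lemma ev_diff [simp]: "ev (G - G') a b = ev G a b - ev G' a b" by (simp add: ev_def)
lemma ev_mult [simp]: "ev (G * G') a b = ev G a b * ev G' a b" by (simp add: ev_def)
lemma ev_power [simp]: "ev (G ^ n) a b = ev G a b ^ n" by (simp add: ev_def)
lemma ev_0 [simp]: "ev 0 a b = 0" by (simp add: ev_def)
lemma ev_1 [simp]: "ev 1 a b = 1" by (simp add: ev_def)
lemma ev_const [simp]: "ev [:c:] a b = poly c a" by (simp add: ev_def)
lemma ev_monom [simp]: "ev (monom c j) a b = poly c a * b ^ j" by (simp add: ev_def poly_monom poly_power)
lemma ev_prod: "ev (prod f A) a b = (\<Prod>i\<in>A. ev (f i) a b)"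
  by (induction A rule: infinite_finite_induct) auto
lemma ev_altdef: "ev G a b = (\<Sum>j\<le>degree G. poly (coeff G j) a * b ^ j)"
  unfolding ev_def poly_altdef[of G] by (simp add: poly_sum poly_power)

lemma ev_map_poly: "ev G a b = poly (map_poly (\<lambda>c. poly c a) G) b"
proof -
  have "degree (map_poly (\<lambda>c. poly c a) G) \<le> degree G" by (intro degree_le) (auto simp: coeff_map_poly coeff_eq_0)
  hence "poly (map_poly (\<lambda>c. poly c a) G) b = (\<Sum>j\<le>degree G. coeff (map_poly (\<lambda>c. poly c a) G) j * b ^ j)"
    unfolding poly_altdef by (intro sum.mono_neutral_left) (auto simp: coeff_eq_0)
  thus ?thesis by (simp add: ev_altdef coeff_map_poly)
qed

text \<open>The curve \<open>y^p + y = h(x)\<close>. At infinity \<open>x\<close> and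
  \<open>y\<close> have pole orders \<open>p\<close> and \<open>m\<close>; the shape
  \<open>m = p * M + 1\<close> makes \<open>x ^ M / y\<close> a function with a simple zero
  there.\<close>

locale as_curve =
  fixes \<kappa> N p q m M :: nat and h :: "universe poly"
  assumes \<kappa>: "\<kappa> \<ge> 1" and p: "p = 2 ^ \<kappa>" and N: "N \<ge> 1" and q: "q = 2 ^ N" and \<kappa>N: "\<kappa> dvd N"
    and h: "\<And>i. coeff h i \<in> GF q" and deg_h: "degree h = m" and m: "m = p * M + 1" and M: "M \<ge> 1"
begin

abbreviation "k \<equiv> GF q :: universe set"
definition "P1 = {c. \<forall>i. coeff c i \<in> k}"
abbreviation "P2 \<equiv> poly2_over k"
definition "H = monom 1 p + monom 1 1 - [:h:]"

lemma p_gt_1: "p > 1" using \<kappa> one_less_power[of "2::nat" \<kappa>] by (simp add: p)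
lemma q_gt_1: "q > 1" using N one_less_power[of "2::nat" N] by (simp add: q)
lemma finite_k: "finite k" and card_k: "card k = q" using card_GF[OF N] by (simp_all add: q)
lemma k_0: "0 \<in> k" using q_gt_1 by simp
lemma k_add: "a \<in> k \<Longrightarrow> b \<in> k \<Longrightarrow> a + b \<in> k" unfolding q by (rule GF_add)
lemma k_sum: "(\<And>i. i \<in> I \<Longrightarrow> f i \<in> k) \<Longrightarrow> sum f I \<in> k" unfolding q by (rule GF_sum)
lemma p_k: "GF p \<subseteq> k" unfolding p q using \<kappa>N by (rule GF_mono)

lemma P1_0: "0 \<in> P1" by (simp add: P1_def k_0)
lemma P1_1: "1 \<in> P1" by (simp add: P1_def k_0)
lemma P1_add: "a \<in> P1 \<Longrightarrow> b \<in> P1 \<Longrightarrow> a + b \<in> P1" by (simp add: P1_def k_add)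
lemma P1_diff: "a \<in> P1 \<Longrightarrow> b \<in> P1 \<Longrightarrow> a - b \<in> P1" by (simp add: P1_def k_add)
lemma P1_mult: "a \<in> P1 \<Longrightarrow> b \<in> P1 \<Longrightarrow> a * b \<in> P1" by (simp add: P1_def coeff_mult k_sum GF_mult)
lemma P1_monom: "c \<in> k \<Longrightarrow> monom c i \<in> P1" by (simp add: P1_def k_0)
lemma P1_const: "c \<in> k \<Longrightarrow> [:c:] \<in> P1" using P1_monom[of c 0] by (simp add: monom_0)
lemma P1_h: "h \<in> P1" by (simp add: P1_def h)
lemma P2_iff: "G \<in> P2 \<longleftrightarrow> (\<forall>i. coeff G i \<in> P1)" by (simp add: poly2_over_def P1_def)
lemma P2_0: "0 \<in> P2" by (simp add: P2_iff P1_0)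
lemma P2_add: "a \<in> P2 \<Longrightarrow> b \<in> P2 \<Longrightarrow> a + b \<in> P2" by (simp add: P2_iff P1_add)
lemma P2_diff: "a \<in> P2 \<Longrightarrow> b \<in> P2 \<Longrightarrow> a - b \<in> P2" by (simp add: P2_iff P1_diff)
lemma P1_sum: "(\<And>i. i \<in> I \<Longrightarrow> f i \<in> P1) \<Longrightarrow> sum f I \<in> P1"
  by (induction I rule: infinite_finite_induct) (auto intro: P1_0 P1_add)
lemma P2_mult: "a \<in> P2 \<Longrightarrow> b \<in> P2 \<Longrightarrow> a * b \<in> P2" by (simp add: P2_iff coeff_mult P1_sum P1_mult)
lemma P2_sum: "(\<And>i. i \<in> I \<Longrightarrow> f i \<in> P2) \<Longrightarrow> sum f I \<in> P2"
  by (induction I rule: infinite_finite_induct) (auto intro: P2_0 P2_add)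
lemma P2_monom: "c \<in> P1 \<Longrightarrow> monom c i \<in> P2" by (simp add: P2_iff P1_0)
lemma P2_const: "c \<in> P1 \<Longrightarrow> [:c:] \<in> P2" using P2_monom[of c 0] by (simp add: monom_0)
lemma P2_1: "1 \<in> P2" using P2_const[OF P1_1] by (simp add: one_pCons)
lemma P2_power: "a \<in> P2 \<Longrightarrow> a ^ n \<in> P2" by (induction n) (auto intro: P2_1 P2_mult)
lemma P2_prod: "(\<And>i. i \<in> I \<Longrightarrow> f i \<in> P2) \<Longrightarrow> prod f I \<in> P2"
  by (induction I rule: infinite_finite_induct) (auto intro: P2_1 P2_mult)
lemma P2_H: "H \<in> P2" unfolding H_def by (intro P2_add P2_diff P2_monom P2_const P1_1 P1_h)

lemma ev_H: "ev H a b = b ^ p + b + poly h a" by (simp add: H_def)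

lemma degree_H: "degree H = p" and lead_H: "lead_coeff H = 1"
proof -
  have d: "degree (monom 1 1 - [:h:]) < p"
    using p_gt_1 by (intro le_less_trans[OF degree_diff_le_max]) (simp add: degree_monom_eq)
  have H: "H = monom 1 p + (monom 1 1 - [:h:])" by (simp add: H_def)
  show deg: "degree H = p" unfolding H using d by (subst degree_add_eq_left) (simp_all add: degree_monom_eq)
  show "lead_coeff H = 1" unfolding deg unfolding H using d p_gt_1 by (simp add: coeff_eq_0)
qed

lemma reduce_mod_H:
  assumes "G \<in> P2"
  shows "\<exists>Q R. Q \<in> P2 \<and> R \<in> P2 \<and> G = H * Q + R \<and> (\<forall>i\<ge>p. coeff R i = 0)"
  using monic_division[of P1 H G] assms P2_H lead_H P1_0 P1_1 P1_diff P1_mult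
  unfolding degree_H P2_iff by blast

text \<open>It vanishes exactly on \<open>GF (q ^ c)\<close> and has derivative 1, so it will be a
  uniformizer at all points with abscissa in this field at once.\<close>

definition "T c = monom 1 (q ^ c) + monom (1::universe) 1"

lemma P1_T: "T c \<in> P1" unfolding T_def by (intro P1_add P1_monom GF_1)
lemma poly_T: "poly (T c) z = z ^ (q ^ c) + z" by (simp add: T_def poly_monom)
lemma poly_T_0_iff: "poly (T c) z = 0 \<longleftrightarrow> z \<in> GF (q ^ c)" by (simp add: poly_T GF_def)
lemma qc: "q ^ c = 2 ^ (N * c)" by (simp add: q power_mult)
lemma qc_gt_1: "c \<ge> 1 \<Longrightarrow> q ^ c > 1" using one_less_power[OF q_gt_1, of c] by simp
lemma degree_T: "c \<ge> 1 \<Longrightarrow> degree (T c) = q ^ c" and lead_T: "c \<ge> 1 \<Longrightarrow> lead_coeff (T c) = 1"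
proof -
  assume "c \<ge> 1"
  hence "1 < q ^ c" by (rule qc_gt_1)
  thus "degree (T c) = q ^ c" "lead_coeff (T c) = 1"
    unfolding T_def by (simp_all add: degree_add_eq_left degree_monom_eq)
qed

lemma finite_GFc: "c \<ge> 1 \<Longrightarrow> finite (GF (q ^ c) :: universe set)"
  and card_GFc: "c \<ge> 1 \<Longrightarrow> card (GF (q ^ c) :: universe set) = q ^ c"
  using card_GF[of "N * c"] N by (simp_all add: qc)

definition "on_curve P \<longleftrightarrow> snd P ^ p + snd P = poly h (fst P)"
definition "Xc c = {P. on_curve P \<and> fst P \<in> GF (q ^ c)}"

lemma ev_H_on_curve: "on_curve P \<Longrightarrow> ev H (fst P) (snd P) = 0"
  by (simp add: ev_H on_curve_def)

lemma frob_p: "((a::universe) + b) ^ p = a ^ p + b ^ p" unfolding p by (rule frob_add)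

lemma card_fibre: "card {b. b ^ p + b = poly h a} = p" and finite_fibre: "finite {b. b ^ p + b = poly h a}"
proof -
  define F where "F = monom 1 p + (monom 1 1 + [:poly h a:])"
  have "degree (monom 1 1 + [:poly h a:]) < p"
    using p_gt_1 by (intro le_less_trans[OF degree_add_le_max]) (simp add: degree_monom_eq)
  hence "degree F = p" unfolding F_def by (subst degree_add_eq_left) (simp_all add: degree_monom_eq)
  then obtain b where "poly F b = 0" using alg_closed_imp_poly_has_root[of F] p_gt_1 by auto
  moreover have "poly F b = (b ^ p + b) + poly h a" by (simp add: F_def poly_monom add.assoc)
  ultimately have b: "b ^ p + b = poly h a" by (simp only: add_eq_0_universe)
  have "{b. b ^ p + b = poly h a} = (\<lambda>z. b + z) ` GF p"
  proof (intro equalityI subsetI)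
    fix z assume "z \<in> {b. b ^ p + b = poly h a}"
    hence eq: "z ^ p + z = b ^ p + b" by (simp add: b)
    have "(b + z) ^ p + (b + z) = (b ^ p + b) + (z ^ p + z)" by (simp add: frob_p add_ac)
    hence "(b + z) ^ p + (b + z) = 0" by (simp only: eq add_self_universe)
    hence "b + z \<in> GF p" by (simp add: GF_def)
    moreover have "z = b + (b + z)" by simp
    ultimately show "z \<in> (\<lambda>z. b + z) ` GF p" by blast
  qed (auto simp: frob_p GF_def add_ac b[symmetric])
  moreover have "inj (\<lambda>z. b + z)" by (rule injI) simp
  ultimately show "card {b. b ^ p + b = poly h a} = p" "finite {b. b ^ p + b = poly h a}"
    using card_GF[OF \<kappa>] by (simp_all add: p card_image inj_on_subset)
qed

lemma Xc_eq: "Xc c = (SIGMA a:GF (q ^ c). {b. b ^ p + b = poly h a})"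
  by (auto simp: Xc_def on_curve_def)

lemma finite_Xc: "c \<ge> 1 \<Longrightarrow> finite (Xc c)" and card_Xc: "c \<ge> 1 \<Longrightarrow> card (Xc c) = p * q ^ c"
  unfolding Xc_eq using finite_GFc card_GFc by (simp_all add: finite_fibre card_fibre)

text \<open>The difference of \<open>b\<close> and its conjugate \<open>b ^ (q ^ c)\<close> lies in
  \<open>GF p\<close> and is fixed by Frobenius; applying Frobenius twice adds it twice, which is
  0.\<close>

lemma Xc_coords:
  assumes "P \<in> Xc c" shows "fst P \<in> GF (q ^ (2 * c))" "snd P \<in> GF (q ^ (2 * c))"
proof -
  obtain a b where P: "P = (a, b)" by (cases P)
  have a: "a \<in> GF (q ^ c)" and b: "b ^ p + b = poly h a" using assms by (auto simp: P Xc_def on_curve_def)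
  show "fst P \<in> GF (q ^ (2 * c))" using a GF_mono[of c "2*c" q] by (auto simp: P)
  have frob: "(z + w) ^ (q ^ c) = z ^ (q ^ c) + w ^ (q ^ c)" for z w :: universe unfolding qc by (rule frob_add)
  have hk: "coeff h i ^ (q ^ c) = coeff h i" for i
    using GF_mono[of 1 c q] h[of i] by (auto simp: GF_def)
  have "poly h a ^ (q ^ c) = poly h (a ^ (q ^ c))"
    unfolding poly_altdef qc frob_sum by (simp add: power_mult_distrib hk[unfolded qc] mult.commute flip: power_mult)
  hence "(b ^ p + b) ^ (q ^ c) = b ^ p + b" using a b by (simp add: GF_def)
  hence eq: "(b ^ p) ^ (q ^ c) + b ^ (q ^ c) = b ^ p + b" by (simp only: frob)
  have "(b ^ (q ^ c) + b) ^ p + (b ^ (q ^ c) + b) = ((b ^ p) ^ (q ^ c) + b ^ (q ^ c)) + (b ^ p + b)"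
    by (simp add: frob_p mult.commute add_ac flip: power_mult)
  hence "(b ^ (q ^ c) + b) ^ p + (b ^ (q ^ c) + b) = 0" by (simp only: eq add_self_universe)
  hence "(b ^ (q ^ c) + b) ^ p = b ^ (q ^ c) + b" by simp
  hence "b ^ (q ^ c) + b \<in> GF p" by (simp add: GF_def)
  hence "b ^ (q ^ c) + b \<in> GF (q ^ c)" using p_k GF_mono[of 1 c q] by auto
  hence "(b ^ (q ^ c)) ^ (q ^ c) + b ^ (q ^ c) = b ^ (q ^ c) + b" unfolding GF_def by (simp add: frob)
  hence "(b ^ (q ^ c)) ^ (q ^ c) = b" by (metis add.commute add_left_cancel)
  thus "snd P \<in> GF (q ^ (2 * c))" by (simp add: P GF_def power_add mult_2 flip: power_mult)
qed

text \<open>The ideal of the finite set \<open>Xc c\<close> is generated by \<open>T c\<close> and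
  \<open>H\<close>. Modulo \<open>H\<close> the degree in \<open>y\<close> is below the number
  \<open>p\<close> of points in a fibre, so each coefficient vanishes on \<open>GF (q ^ c)\<close>
  and is divisible by \<open>T c\<close>.\<close>

lemma vanish_on_Xc:
  assumes c: "c \<ge> 1" and G: "G \<in> P2" and van: "\<And>P. P \<in> Xc c \<Longrightarrow> ev G (fst P) (snd P) = 0"
  shows "\<exists>A\<in>P2. \<exists>B\<in>P2. G = [:T c:] * A + H * B"
proof -
  obtain Q R where QR: "Q \<in> P2" "R \<in> P2" "G = H * Q + R" "\<And>i. i \<ge> p \<Longrightarrow> coeff R i = 0"
    using reduce_mod_H[OF G] by blast
  have root: "poly (coeff R j) a = 0" if a: "a \<in> GF (q ^ c)" for a j
  proof -
    have "map_poly (\<lambda>c. poly c a) R = 0"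
    proof (rule poly_eq_0_if_many_roots)
      show "coeff (map_poly (\<lambda>c. poly c a) R) i = 0" if "i \<ge> p" for i using QR(4)[OF that] by (simp add: coeff_map_poly)
      fix b assume "b \<in> {b. b ^ p + b = poly h a}"
      hence P: "(a, b) \<in> Xc c" using a by (simp add: Xc_eq)
      hence "ev R a b = 0" using van[OF P] ev_H_on_curve[of "(a, b)"] by (simp add: QR(3) Xc_def)
      thus "poly (map_poly (\<lambda>c. poly c a) R) b = 0" by (simp add: ev_map_poly)
    qed (auto simp: finite_fibre card_fibre)
    hence "coeff (map_poly (\<lambda>c. poly c a) R) j = 0" by simp
    thus ?thesis by (simp add: coeff_map_poly)
  qed
  have "\<exists>A. A \<in> P1 \<and> coeff R j = T c * A" for j
  proof -
    have "coeff R j \<in> P1" using QR(2) by (simp add: P2_iff)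
    hence "\<exists>A S. (\<forall>i. coeff A i \<in> k) \<and> (\<forall>i. coeff S i \<in> k) \<and> coeff R j = T c * A + S \<and> (\<forall>i\<ge>degree (T c). coeff S i = 0)"
      using P1_T[of c] lead_T[OF c] by (intro monic_division) (auto simp: P1_def k_0 k_add GF_mult)
    then obtain A S where AS: "A \<in> P1" "S \<in> P1" "coeff R j = T c * A + S" "\<forall>i\<ge>q ^ c. coeff S i = 0"
      unfolding degree_T[OF c] P1_def by blast
    have "S = 0"
    proof (rule poly_eq_0_if_many_roots[of "q ^ c" _ "GF (q ^ c)"])
      fix z :: universe assume z: "z \<in> GF (q ^ c)"
      thus "poly S z = 0" using root[OF z, of j] by (simp add: AS(3)) (simp add: poly_T GF_def)
    qed (use AS c in \<open>auto simp: finite_GFc card_GFc\<close>)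
    thus ?thesis using AS by auto
  qed
  then obtain A where A: "\<And>j. A j \<in> P1" "\<And>j. coeff R j = T c * A j" by metis
  define A' where "A' = (\<Sum>j<p. monom (A j) j)"
  have "A' \<in> P2" unfolding A'_def by (intro P2_sum P2_monom A)
  moreover have "R = [:T c:] * A'"
  proof (rule poly_eqI)
    fix i
    have "coeff A' i = (\<Sum>j<p. if j = i then A j else 0)" unfolding A'_def coeff_sum by (rule sum.cong) auto
    thus "coeff R i = coeff ([:T c:] * A') i" using A(2)[of i] QR(4)[of i] by auto
  qed
  ultimately show ?thesis using QR by (metis add.commute)
qed

end

section \<open>The function field and its place at infinity\<close>

locale as_point = as_curve +
  fixes x y :: universe
  assumes xy: "y ^ p + y = poly h x" and transc: "\<And>c. c \<in> P1 \<Longrightarrow> poly c x = 0 \<Longrightarrow> c = 0"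
begin

definition "A = (\<lambda>G. ev G x y) ` P2"
definition "F = {a / b | a b. a \<in> A \<and> b \<in> A \<and> b \<noteq> 0}"

lemma AI: "G \<in> P2 \<Longrightarrow> ev G x y \<in> A" unfolding A_def by (rule imageI)
lemma AE: assumes "z \<in> A" obtains G where "G \<in> P2" "z = ev G x y" using assms unfolding A_def by blast
lemma A_diff: assumes "a \<in> A" "b \<in> A" shows "a - b \<in> A"
  using assms by (elim AE) (simp only: ev_diff[symmetric], intro AI P2_diff)
lemma A_add: "a \<in> A \<Longrightarrow> b \<in> A \<Longrightarrow> a + b \<in> A" using A_diff by simp
lemma A_mult: assumes "a \<in> A" "b \<in> A" shows "a * b \<in> A"
  using assms by (elim AE) (simp only: ev_mult[symmetric], intro AI P2_mult)
lemma A_poly: "c \<in> P1 \<Longrightarrow> poly c x \<in> A" using AI[OF P2_const, of c] by simp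
lemma A_1: "1 \<in> A" using A_poly[OF P1_1] by simp
lemma A_k: "c \<in> k \<Longrightarrow> c \<in> A" using A_poly[OF P1_const] by simp
lemma A_0: "0 \<in> A" using A_k[OF k_0] .
lemma A_x: "x \<in> A" using A_poly[OF P1_monom[OF GF_1, of 1]] by (simp add: poly_monom)
lemma A_y: "y \<in> A" using AI[OF P2_monom[OF P1_1, of 1]] by simp
lemma A_power: "a \<in> A \<Longrightarrow> a ^ n \<in> A" by (induction n) (auto intro: A_1 A_mult)
lemma A_sum: "(\<And>i. i \<in> I \<Longrightarrow> f i \<in> A) \<Longrightarrow> sum f I \<in> A"
  by (induction I rule: infinite_finite_induct) (auto intro: A_0 A_add)

lemma A_F: "a \<in> A \<Longrightarrow> a \<in> F" unfolding F_def using A_1 by (intro CollectI exI[of _ a] exI[of _ 1]) simp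
lemma F_1: "1 \<in> F" by (rule A_F[OF A_1])
lemma F_diff: assumes "a \<in> F" "b \<in> F" shows "a - b \<in> F"
proof -
  obtain c d c' d' where ab: "a = c / d" "b = c' / d'" and *: "c \<in> A" "d \<in> A" "d \<noteq> 0" "c' \<in> A" "d' \<in> A" "d' \<noteq> 0"
    using assms unfolding F_def by blast
  have "a - b = (c * d' - c' * d) / (d * d')" unfolding ab by (rule diff_frac_eq[OF *(3,6)])
  moreover have "c * d' - c' * d \<in> A" "d * d' \<in> A" "d * d' \<noteq> 0" using * by (auto intro!: A_diff A_mult simp del: diff_universe)
  ultimately show ?thesis unfolding F_def by blast
qed
lemma F_mult: assumes "a \<in> F" "b \<in> F" shows "a * b \<in> F"
proof -
  obtain c d c' d' where "a = c / d" "b = c' / d'" and *: "c \<in> A" "d \<in> A" "d \<noteq> 0" "c' \<in> A" "d' \<in> A" "d' \<noteq> 0"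
    using assms unfolding F_def by blast
  hence "a * b = (c * c') / (d * d')" by simp
  moreover have "c * c' \<in> A" "d * d' \<in> A" "d * d' \<noteq> 0" using * by (auto intro!: A_mult)
  ultimately show ?thesis unfolding F_def by blast
qed
lemma F_inverse: assumes "a \<in> F" shows "inverse a \<in> F"
proof -
  obtain c d where a: "a = c / d" and *: "c \<in> A" "d \<in> A" "d \<noteq> 0"
    using assms unfolding F_def by blast
  show ?thesis
  proof (cases "c = 0")
    case False
    thus ?thesis unfolding F_def a using * by (intro CollectI exI[of _ d] exI[of _ c]) auto
  qed (simp add: a A_F[OF A_0])
qed

lemma x_nz: "x \<noteq> 0" using transc[OF P1_monom[OF GF_1, of 1]] by (auto simp: poly_monom)

text \<open>The functions with poles only at infinity have there the pole orders \<open>p i + m j\<close> of the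
  monomials \<open>x\<^sup>i y\<^sup>j\<close>; each order comes from exactly one monomial with \<open>j < p\<close>.\<close>

definition "nongap v \<longleftrightarrow> M * (v mod p) \<le> v div p"
definition "xymon v = x ^ (v div p - M * (v mod p)) * y ^ (v mod p)"
definition "Sp n = {\<Sum>v | v < n \<and> nongap v. c v * xymon v | c. \<forall>v. c v \<in> k}"

text \<open>As \<open>m\<close> is 1 modulo \<open>p\<close>, the residue of a weight is the
  exponent of \<open>y\<close>, so weights with \<open>j < p\<close> determine their
  monomials.\<close>

lemma weight_div_mod: "j < p \<Longrightarrow> (p * i + m * j) div p = i + M * j \<and> (p * i + m * j) mod p = j"
proof -
  assume j: "j < p"
  have "p * i + m * j = p * (i + M * j) + j" by (simp add: m algebra_simps)
  thus ?thesis using j by simp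
qed

lemma nongap_weight: "j < p \<Longrightarrow> nongap (p * i + m * j)" and mon_weight: "j < p \<Longrightarrow> xymon (p * i + m * j) = x ^ i * y ^ j"
  using weight_div_mod[of j i] by (simp_all add: nongap_def xymon_def)

lemma weight_nongap: "nongap v \<Longrightarrow> p * (v div p - M * (v mod p)) + m * (v mod p) = v"
proof -
  assume v: "nongap v"
  hence "p * (v div p - M * (v mod p)) + m * (v mod p) = p * (v div p) + v mod p"
    by (simp add: nongap_def m algebra_simps diff_mult_distrib2)
  thus ?thesis by simp
qed

lemma SpI: "(\<And>v. c v \<in> k) \<Longrightarrow> (\<Sum>v | v < n \<and> nongap v. c v * xymon v) \<in> Sp n" unfolding Sp_def by blast
lemma SpE: assumes "z \<in> Sp n" obtains c where "\<And>v. c v \<in> k" "z = (\<Sum>v | v < n \<and> nongap v. c v * xymon v)"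
  using assms unfolding Sp_def by blast
lemma Sp_0: "0 \<in> Sp n" using SpI[of "\<lambda>_. 0" n] k_0 by simp
lemma Sp_add: assumes "z \<in> Sp n" "w \<in> Sp n" shows "z + w \<in> Sp n"
  using assms by (elim SpE) (simp add: sum.distrib[symmetric] distrib_right[symmetric] SpI k_add)
lemma Sp_scale: assumes "a \<in> k" "z \<in> Sp n" shows "a * z \<in> Sp n"
  using assms(2) by (elim SpE) (simp add: sum_distrib_left mult.assoc[symmetric] SpI GF_mult assms(1))
lemma Sp_sum: "(\<And>i. i \<in> I \<Longrightarrow> f i \<in> Sp n) \<Longrightarrow> sum f I \<in> Sp n"
  by (induction I rule: infinite_finite_induct) (auto intro: Sp_0 Sp_add)
lemma Sp_mon: assumes "v < n" "nongap v" shows "xymon v \<in> Sp n"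
proof -
  have "(\<Sum>u | u < n \<and> nongap u. (if u = v then 1 else 0) * xymon u) = (\<Sum>u | u < n \<and> nongap u. if u = v then xymon v else 0)"
    by (rule sum.cong) auto
  also have "\<dots> = xymon v" using assms by simp
  finally show ?thesis using SpI[of "\<lambda>u. if u = v then 1 else 0" n] k_0 by simp
qed
lemma Sp_mono: assumes "z \<in> Sp n" "n \<le> n'" shows "z \<in> Sp n'"
  using assms(1)
proof (rule SpE)
  fix c assume c: "\<And>v. c v \<in> k" "z = (\<Sum>v | v < n \<and> nongap v. c v * xymon v)"
  show "z \<in> Sp n'" unfolding c(2) using assms(2) c(1) by (intro Sp_sum Sp_scale Sp_mon) auto
qed

lemma y_p: "y ^ p = poly h x + y" by (simp only: xy[symmetric] add.assoc add_self_universe add_0_right)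

text \<open>Replacing \<open>y ^ p\<close> by \<open>h(x) + y\<close> does not raise the weight,
  because \<open>p\<close> times the degree of \<open>h\<close> is the weight of
  \<open>y ^ p\<close>.\<close>

lemma monomial_Sp: "x ^ i * y ^ j \<in> Sp (p * i + m * j + 1)"
proof (induction j arbitrary: i rule: less_induct)
  case (less j)
  show ?case
  proof (cases "j < p")
    case True
    thus ?thesis using Sp_mon[of "p * i + m * j"] nongap_weight mon_weight by simp
  next
    case False
    define j' where "j' = j - p"
    have j: "j = j' + p" using False by (simp add: j'_def)
    have "x ^ i * y ^ j = x ^ i * y ^ j' * (poly h x + y)" by (simp add: j power_add y_p)
    also have "\<dots> = (\<Sum>l\<le>m. coeff h l * (x ^ (i + l) * y ^ j')) + x ^ i * y ^ Suc j'"
      by (simp add: poly_altdef deg_h distrib_left sum_distrib_left power_add mult_ac)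
    also have "\<dots> \<in> Sp (p * i + m * j + 1)"
    proof (rule Sp_add, rule Sp_sum, rule Sp_scale[OF h])
      fix l assume "l \<in> {..m}"
      hence "p * l \<le> p * m" by simp
      hence "p * (i + l) + m * j' + 1 \<le> p * i + m * j + 1" by (simp add: j algebra_simps)
      thus "x ^ (i + l) * y ^ j' \<in> Sp (p * i + m * j + 1)" using less[of j' "i + l"] p_gt_1 j by (auto intro: Sp_mono)
    next
      have "m * Suc j' \<le> m * j" using p_gt_1 j by (intro mult_le_mono2) simp
      hence "p * i + m * Suc j' + 1 \<le> p * i + m * j + 1" by (simp only: add_le_cancel_left add_le_cancel_right)
      thus "x ^ i * y ^ Suc j' \<in> Sp (p * i + m * j + 1)" using less[of "Suc j'" i] p_gt_1 j by (auto intro: Sp_mono)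
    qed
    finally show ?thesis .
  qed
qed

lemma Sp_mult: assumes "z \<in> Sp a" "w \<in> Sp b" shows "z * w \<in> Sp (a + b)"
proof -
  obtain c where c: "\<And>v. c v \<in> k" "z = (\<Sum>v | v < a \<and> nongap v. c v * xymon v)" using SpE[OF assms(1)] by blast
  obtain d where d: "\<And>v. d v \<in> k" "w = (\<Sum>v | v < b \<and> nongap v. d v * xymon v)" using SpE[OF assms(2)] by blast
  have "z * w = (\<Sum>v | v < a \<and> nongap v. \<Sum>u | u < b \<and> nongap u. (c v * d u) * (xymon v * xymon u))"
    by (simp add: c(2) d(2) sum_product mult_ac)
  also have "\<dots> \<in> Sp (a + b)"
  proof (rule Sp_sum, rule Sp_sum, rule Sp_scale[OF GF_mult[OF c(1) d(1)]])
    fix v u assume "v \<in> {v. v < a \<and> nongap v}" "u \<in> {u. u < b \<and> nongap u}"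
    hence v: "v < a" "nongap v" and u: "u < b" "nongap u" by auto
    let ?i = "\<lambda>v. v div p - M * (v mod p)"
    have "xymon v * xymon u = x ^ (?i v + ?i u) * y ^ (v mod p + u mod p)" by (simp add: xymon_def power_add mult_ac)
    also have "\<dots> \<in> Sp (p * (?i v + ?i u) + m * (v mod p + u mod p) + 1)" by (rule monomial_Sp)
    also have "p * (?i v + ?i u) + m * (v mod p + u mod p) = v + u"
      using weight_nongap[OF v(2)] weight_nongap[OF u(2)] by (simp add: distrib_left)
    finally show "xymon v * xymon u \<in> Sp (a + b)" by (rule Sp_mono) (use v u in auto)
  qed
  finally show ?thesis .
qed

lemma Sp_A: assumes "z \<in> Sp n" shows "z \<in> A"
proof -
  obtain c where c: "\<And>v. c v \<in> k" "z = (\<Sum>v | v < n \<and> nongap v. c v * xymon v)" using SpE[OF assms] by blast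
  show ?thesis unfolding c(2) xymon_def using c(1) by (intro A_sum A_mult A_power A_x A_y A_k)
qed

lemma A_Sp: assumes "z \<in> A" shows "\<exists>n. z \<in> Sp n"
proof -
  have up: "z \<in> Sp n \<Longrightarrow> w \<in> Sp n' \<Longrightarrow> z \<in> Sp (max n n') \<and> w \<in> Sp (max n n')" for z w n n'
    using Sp_mono by (meson max.cobounded1 max.cobounded2)
  have sum: "\<exists>n. sum f I \<in> Sp n" if "\<And>i. i \<in> I \<Longrightarrow> \<exists>n. f i \<in> Sp n" for f :: "nat \<Rightarrow> universe" and I
    using that
  proof (induction I rule: infinite_finite_induct)
    case (insert i I)
    then obtain n n' where "f i \<in> Sp n" "sum f I \<in> Sp n'" by blast
    hence "f i + sum f I \<in> Sp (max n n')" using up Sp_add by blast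
    thus ?case using insert by auto
  qed (use Sp_0 in auto)
  obtain G where G: "G \<in> P2" "z = ev G x y" using assms by (auto simp: A_def)
  have z: "z = (\<Sum>j\<le>degree G. \<Sum>i\<le>degree (coeff G j). coeff (coeff G j) i * (x ^ i * y ^ j))"
    unfolding G(2) ev_altdef by (simp add: poly_altdef sum_distrib_right mult.assoc)
  show ?thesis unfolding z
  proof (intro sum)
    fix i j
    have "coeff (coeff G j) i \<in> k" using G(1) by (simp add: poly2_over_def)
    thus "\<exists>n. coeff (coeff G j) i * (x ^ i * y ^ j) \<in> Sp n" using Sp_scale monomial_Sp by blast
  qed
qed

end

locale infinite_place = as_point + valring F V for V +
  assumes k_V: "k \<subseteq> V" and x_V: "x \<notin> V"
begin

lemma k_unit: "c \<in> k \<Longrightarrow> c \<noteq> 0 \<Longrightarrow> c \<in> V - P"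
  using k_V GF_inverse[of c q] unfolding unit_iff by auto

lemma inverse_x: "inverse x \<in> P" using not_V[OF A_F[OF A_x] x_V] by simp

lemma power_x_V: "n > 0 \<Longrightarrow> x ^ n \<notin> V" using V_powerD[OF A_F[OF A_x]] x_V by blast

lemma inverse_x_power: "n > 0 \<Longrightarrow> inverse x ^ n \<in> P"
  using P_mult'[OF inverse_x V_power[OF P_V[OF inverse_x], of "n - 1"]] by (cases n) auto

lemma h_unit: "poly h x / x ^ m \<in> V - P"
proof -
  have "poly h x / x ^ m = coeff h m + (\<Sum>l<m. coeff h l * inverse x ^ (m - l))"
  proof -
    have "poly h x = coeff h m * x ^ m + (\<Sum>l<m. coeff h l * x ^ l)"
      by (simp add: poly_altdef deg_h lessThan_Suc_atMost[symmetric])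
    also have "(\<Sum>l<m. coeff h l * x ^ l) = x ^ m * (\<Sum>l<m. coeff h l * inverse x ^ (m - l))"
      unfolding sum_distrib_left
    proof (rule sum.cong, rule refl)
      fix l assume "l \<in> {..<m}"
      hence "m = (m - l) + l" by simp
      hence "x ^ m = x ^ (m - l) * x ^ l" by (metis power_add)
      thus "coeff h l * x ^ l = x ^ m * (coeff h l * inverse x ^ (m - l))" using x_nz by (simp add: field_simps)
    qed
    finally show ?thesis using x_nz by (simp add: field_simps)
  qed
  also have "\<dots> \<in> V - P"
  proof (intro unit_add k_unit h P_sum P_mult inverse_x_power)
    have "h \<noteq> 0" using deg_h m by auto
    thus "coeff h m \<noteq> 0" using deg_h by (metis leading_coeff_0_iff)
  qed (use h k_V in auto)
  finally show ?thesis .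
qed

lemma y_V: "y \<notin> V"
proof
  assume "y \<in> V"
  hence "poly h x \<in> V" unfolding xy[symmetric] by (intro V_add V_power)
  hence "poly h x * inverse (poly h x / x ^ m) \<in> V"
    using unit_inverse[OF h_unit] V_mult by blast
  moreover have "poly h x \<noteq> 0" using h_unit P_0 by auto
  ultimately show False using power_x_V[of m] m by (simp add: field_simps)
qed

lemma y_nz: "y \<noteq> 0" using y_V V_0 by auto

lemma y_unit: "y ^ p / x ^ m \<in> V - P"
proof -
  have iy: "inverse y \<in> P" using not_V[OF A_F[OF A_y] y_V] by simp
  have "inverse y ^ (p - 1) \<in> P"
    using P_mult'[OF iy V_power[OF P_V[OF iy], of "p - 2"]] p_gt_1
    by (metis Suc_1 Suc_diff_Suc One_nat_def power_Suc numeral_2_eq_2)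
  moreover define U where "U = 1 + inverse y ^ (p - 1)"
  ultimately have u: "U \<in> V - P" using unit_add[OF unit_1] by simp
  hence nz: "U \<noteq> 0" using P_0 by auto
  have "y ^ p * inverse y ^ (p - 1) = y"
    using y_nz p_gt_1 power_add[of y "p - 1" 1] by (simp add: field_simps)
  hence eq: "y ^ p * U = poly h x" unfolding xy[symmetric] U_def by (simp add: distrib_left)
  have "poly h x * inverse U = y ^ p" unfolding eq[symmetric] using nz by simp
  moreover have "(poly h x / x ^ m) * inverse U = (poly h x * inverse U) / x ^ m" by simp
  ultimately have eq2: "y ^ p / x ^ m = (poly h x / x ^ m) * inverse U" by (simp only:)
  show ?thesis unfolding eq2 by (rule unit_mult[OF h_unit unit_inverse[OF u]])
qed

text \<open>Orders at infinity are compared before a uniformizer is known: the \<open>p\<close>-th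
  power of a monomial is a unit times the power of \<open>x\<close> given by its weight.\<close>

lemma monomial_power: "(x ^ i * y ^ j) ^ p = x ^ (p * i + m * j) * (y ^ p / x ^ m) ^ j"
  using x_nz by (simp add: power_mult_distrib power_add power_divide mult.commute flip: power_mult)

lemma monomial_F: "x ^ i * y ^ j \<in> F" by (intro A_F A_mult A_power A_x A_y)

lemma monomial_lt:
  assumes "p * i + m * j < p * i' + m * j'"
  shows "(x ^ i * y ^ j) / (x ^ i' * y ^ j') \<in> P"
proof (rule P_powerD)
  let ?u = "y ^ p / x ^ m"
  obtain d where d: "p * i' + m * j' = (p * i + m * j) + d" "d > 0"
    using assms by (metis less_imp_add_positive)
  have u: "?u ^ j * inverse (?u ^ j') \<in> V - P" by (intro unit_mult unit_inverse unit_power y_unit)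
  have "((x ^ i * y ^ j) / (x ^ i' * y ^ j')) ^ p = inverse x ^ d * (?u ^ j * inverse (?u ^ j'))"
    unfolding power_divide monomial_power d(1) using x_nz by (simp add: power_add field_simps)
  thus "((x ^ i * y ^ j) / (x ^ i' * y ^ j')) ^ p \<in> P"
    using P_mult'[OF inverse_x_power[OF d(2)]] u by simp
qed (intro F_divide monomial_F)

lemma monomial_eq:
  assumes "p * i + m * j = p * i' + m * j'"
  shows "(x ^ i * y ^ j) / (x ^ i' * y ^ j') \<in> V - P"
proof (rule unit_powerD)
  let ?u = "y ^ p / x ^ m"
  have u: "?u ^ j * inverse (?u ^ j') \<in> V - P" by (intro unit_mult unit_inverse unit_power y_unit)
  have "((x ^ i * y ^ j) / (x ^ i' * y ^ j')) ^ p = ?u ^ j * inverse (?u ^ j')"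
    unfolding power_divide monomial_power assms using x_nz by (simp add: field_simps)
  thus "((x ^ i * y ^ j) / (x ^ i' * y ^ j')) ^ p \<in> V - P" using u by simp
qed (use p_gt_1 in \<open>auto intro!: F_divide monomial_F\<close>)

lemma mon_nz: "xymon v \<noteq> 0" using x_nz y_nz by (simp add: xymon_def)
lemma mon_lt: "nongap v \<Longrightarrow> nongap w \<Longrightarrow> v < w \<Longrightarrow> xymon v / xymon w \<in> P"
  unfolding xymon_def by (rule monomial_lt) (simp add: weight_nongap)

lemma lead:
  assumes c: "\<And>v. c v \<in> k" and w: "w < n" "nongap w" and max: "\<And>v. v < n \<Longrightarrow> nongap v \<Longrightarrow> c v \<noteq> 0 \<Longrightarrow> v \<le> w"
  shows "(\<Sum>v | v < n \<and> nongap v. c v * xymon v) / xymon w - c w \<in> P"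
proof -
  have "(\<Sum>v | v < n \<and> nongap v. c v * xymon v) / xymon w = (\<Sum>v | v < n \<and> nongap v. c v * (xymon v / xymon w))"
    by (simp add: sum_divide_distrib)
  also have "\<dots> = c w * (xymon w / xymon w) + (\<Sum>v\<in>{v. v < n \<and> nongap v} - {w}. c v * (xymon v / xymon w))"
    using w by (intro sum.remove) auto
  finally have "(\<Sum>v | v < n \<and> nongap v. c v * xymon v) / xymon w - c w = (\<Sum>v\<in>{v. v < n \<and> nongap v} - {w}. c v * (xymon v / xymon w))"
    using mon_nz by (simp add: add.assoc add.commute[of _ "c w"])
  also have "\<dots> \<in> P"
  proof (rule P_sum)
    fix v assume v: "v \<in> {v. v < n \<and> nongap v} - {w}"
    show "c v * (xymon v / xymon w) \<in> P"
    proof (cases "c v = 0")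
      case False
      hence "xymon v / xymon w \<in> P" using v max[of v] w by (intro mon_lt) auto
      thus ?thesis using c k_V by (intro P_mult) auto
    qed (simp add: P_0)
  qed
  finally show ?thesis .
qed

lemma Sp_coeffs_0:
  assumes c: "\<And>v. c v \<in> k" and z: "(\<Sum>v | v < n \<and> nongap v. c v * xymon v) = 0" and v: "v < n" "nongap v"
  shows "c v = 0"
proof (rule ccontr)
  assume "c v \<noteq> 0"
  let ?S = "{v. v < n \<and> nongap v \<and> c v \<noteq> 0}"
  have S: "finite ?S" "?S \<noteq> {}" using \<open>c v \<noteq> 0\<close> v by auto
  define w where "w = Max ?S"
  have w: "w \<in> ?S" unfolding w_def using S by (rule Max_in)
  have "0 / xymon w - c w \<in> P" unfolding z[symmetric]
    using w S by (intro lead c) (auto simp: w_def)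
  hence "c w \<in> P" by simp
  thus False using k_unit[OF c, of w] w by auto
qed

lemma Sp_lead:
  assumes z: "z \<in> Sp n" "z \<noteq> 0"
  shows "\<exists>w c. w < n \<and> nongap w \<and> c \<in> k \<and> c \<noteq> 0 \<and> z / xymon w - c \<in> P \<and> z \<in> Sp (Suc w)"
proof -
  obtain c where c: "\<And>v. c v \<in> k" "z = (\<Sum>v | v < n \<and> nongap v. c v * xymon v)" using SpE[OF z(1)] by blast
  let ?S = "{v. v < n \<and> nongap v \<and> c v \<noteq> 0}"
  have "z = 0" if "?S = {}" unfolding c(2) by (rule sum.neutral) (use that in auto)
  hence S: "finite ?S" "?S \<noteq> {}" using z(2) by auto
  define w where "w = Max ?S"
  have w: "w \<in> ?S" unfolding w_def using S by (rule Max_in)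
  have max: "v \<le> w" if "v \<in> ?S" for v unfolding w_def using S that by simp
  have "z / xymon w - c w \<in> P" unfolding c(2) using w max by (intro lead c) auto
  moreover have "z \<in> Sp (Suc w)"
  proof -
    have "z = (\<Sum>v | v < Suc w \<and> nongap v. c v * xymon v)" unfolding c(2)
    proof (rule sum.mono_neutral_right)
      show "\<forall>v\<in>{v. v < n \<and> nongap v} - {v. v < Suc w \<and> nongap v}. c v * xymon v = 0"
        using max by fastforce
    qed (use w in auto)
    thus ?thesis using SpI[OF c(1)] by simp
  qed
  ultimately show ?thesis using w c(1) by blast
qed

end

context as_point
begin

text \<open>\<open>x\<close> is transcendental over \<open>k\<close>, so \<open>inverse x\<close> is
  not invertible in the ring \<open>R\<close> of polynomials in it. A valuation ring keeping it a
  non-unit cannot contain \<open>x\<close>.\<close>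

lemma ex_infinite_place: "\<exists>V. infinite_place \<kappa> N p q m M h x y V"
proof -
  define t where "t = inverse x"
  define R where "R = (\<lambda>c. poly c t) ` P1"
  have R: "a - b \<in> R \<and> a * b \<in> R" if ab: "a \<in> R" "b \<in> R" for a b
  proof -
    obtain c d where cd: "c \<in> P1" "d \<in> P1" "a = poly c t" "b = poly d t" using ab unfolding R_def by blast
    have "a - b = poly (c - d) t" "a * b = poly (c * d) t" by (simp_all only: cd poly_diff poly_mult)
    thus ?thesis unfolding R_def using P1_diff[OF cd(1,2)] P1_mult[OF cd(1,2)] by blast
  qed
  have Rk: "c \<in> R" if "c \<in> k" for c unfolding R_def using P1_const[OF that] by (intro image_eqI[of _ _ "[:c:]"]) auto
  have tR: "t \<in> R" unfolding R_def using P1_monom[OF GF_1, of 1] by (intro image_eqI[of _ _ "monom 1 1"]) (auto simp: poly_monom)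
  have "t * b \<noteq> 1" if b: "b \<in> R" for b
  proof
    assume tb: "t * b = 1"
    obtain c where c: "c \<in> P1" "b = poly c t" using b by (auto simp: R_def)
    define G where "G = monom 1 (Suc (degree c)) - reflect_poly c"
    have "poly (reflect_poly c) x = x ^ degree c * b" using x_nz by (simp add: poly_reflect_poly_nz c t_def)
    also have "\<dots> = x ^ Suc (degree c)" using tb x_nz by (simp add: t_def field_simps)
    finally have "poly G x = 0" by (simp add: G_def poly_monom)
    moreover have "G \<in> P1"
    proof -
      have "reflect_poly c \<in> P1" using c(1) k_0 by (auto simp: P1_def coeff_reflect_poly)
      thus ?thesis unfolding G_def by (intro P1_diff P1_monom) auto
    qed
    ultimately have "G = 0" by (rule transc[rotated])
    moreover have "coeff G (Suc (degree c)) = 1" by (simp add: G_def coeff_reflect_poly)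
    ultimately show False by simp
  qed
  then obtain V where V: "R \<subseteq> V" "valring UNIV V" "\<forall>b\<in>V. t * b \<noteq> 1"
    using ex_valuation_ring[of R t] R Rk[OF GF_1] tR by blast
  interpret U: valring UNIV V by fact
  interpret valring F "V \<inter> F"
    by unfold_locales (use F_1 F_diff F_mult F_inverse U.V_1 U.V_diff U.V_mult U.V_total in auto)
  have "x \<notin> V" using V(3) x_nz by (auto simp: t_def)
  moreover have "k \<subseteq> V \<inter> F" using V(1) Rk A_F A_k by auto
  ultimately have "infinite_place \<kappa> N p q m M h x y (V \<inter> F)" by unfold_locales auto
  thus ?thesis by blast
qed

text \<open>The monomials have distinct pole orders at a place at infinity; its mere existence is
  enough.\<close>

lemma Sp_independent:
  assumes "\<And>v. c v \<in> k" "(\<Sum>v | v < n \<and> nongap v. c v * xymon v) = 0" "v < n" "nongap v"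
  shows "c v = 0"
proof -
  obtain V where "infinite_place \<kappa> N p q m M h x y V" using ex_infinite_place by blast
  then interpret infinite_place \<kappa> N p q m M h x y V .
  show ?thesis by (rule Sp_coeffs_0[OF assms])
qed

lemma card_Sp: "card (Sp n) = q ^ card {v. v < n \<and> nongap v}" and finite_Sp: "finite (Sp n)"
proof -
  let ?S = "{v. v < n \<and> nongap v}"
  let ?f = "\<lambda>c. \<Sum>v\<in>?S. c v * xymon v"
  have fin: "finite ?S" by simp
  have "Sp n = ?f ` PiE ?S (\<lambda>_. k)"
  proof (intro equalityI subsetI)
    fix z assume zn: "z \<in> Sp n"
    obtain c where c: "\<And>v. c v \<in> k" "z = ?f c" using SpE[OF zn] by blast
    have "z = ?f (restrict c ?S)" unfolding c(2) by (rule sum.cong) auto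
    thus "z \<in> ?f ` PiE ?S (\<lambda>_. k)" by (intro image_eqI[of z ?f "restrict c ?S"]) (use c(1) in auto)
  next
    fix z assume "z \<in> ?f ` PiE ?S (\<lambda>_. k)"
    then obtain c where c: "c \<in> PiE ?S (\<lambda>_. k)" "z = ?f c" by blast
    define d where "d v = (if v \<in> ?S then c v else 0)" for v
    have "z = ?f d" unfolding c(2) d_def by (rule sum.cong) auto
    moreover have "d v \<in> k" for v using c(1) k_0 by (auto simp: d_def PiE_def Pi_def)
    ultimately show "z \<in> Sp n" using SpI[of d n] by simp
  qed
  moreover have "inj_on ?f (PiE ?S (\<lambda>_. k))"
  proof (rule inj_onI)
    fix c d assume cd: "c \<in> PiE ?S (\<lambda>_. k)" "d \<in> PiE ?S (\<lambda>_. k)" "?f c = ?f d"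
    define a where "a v = (if v \<in> ?S then c v + d v else 0)" for v
    have "?f a = (\<Sum>v\<in>?S. c v * xymon v + d v * xymon v)"
      unfolding a_def by (rule sum.cong) (auto simp: distrib_right)
    also have "\<dots> = ?f c + ?f d" by (rule sum.distrib)
    also have "\<dots> = 0" using cd(3) by simp
    finally have s0: "?f a = 0" .
    have ak: "a v \<in> k" for v using cd(1,2) k_0 k_add by (auto simp: a_def PiE_def Pi_def)
    have "c v = d v" if v: "v \<in> ?S" for v
    proof -
      have "a v = 0" by (rule Sp_independent[OF ak s0]) (use v in auto)
      thus ?thesis using v by (simp add: a_def)
    qed
    thus "c = d" using cd by (intro PiE_ext) auto
  qed
  ultimately show "card (Sp n) = q ^ card ?S" "finite (Sp n)"
    using fin finite_k by (simp_all add: card_image card_PiE card_k finite_PiE)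
qed

text \<open>A remainder modulo \<open>H\<close> is a combination of monomials with distinct weights,
  and these are independent; if it vanishes at \<open>(x, y)\<close> it is the zero
  polynomial.\<close>

lemma generic:
  assumes G: "G \<in> P2" "ev G x y = 0"
  shows "\<exists>B\<in>P2. G = H * B"
proof -
  obtain Q R where QR: "Q \<in> P2" "R \<in> P2" "G = H * Q + R" "\<And>i. i \<ge> p \<Longrightarrow> coeff R i = 0"
    using reduce_mod_H[OF G(1)] by blast
  have "ev R x y = 0" using G(2) xy by (simp add: QR(3) ev_H)
  define D where "D = Max ((\<lambda>j. degree (coeff R j)) ` {..<p})"
  have D: "degree (coeff R j) \<le> D" if "j < p" for j unfolding D_def using that by simp
  define n where "n = p * (D + 1) + m * p"
  define c where "c v = coeff (coeff R (v mod p)) (v div p - M * (v mod p))" for v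
  have weight_lt: "p * i + m * j < n" if "i \<le> D" "j < p" for i j
  proof -
    have "p * i \<le> p * D" "m * j \<le> m * p" using that by (auto intro: mult_le_mono2)
    moreover have "p * (D + 1) = p * D + p" by simp
    ultimately show ?thesis unfolding n_def using p_gt_1 by linarith
  qed
  have ck: "c v \<in> k" for v using QR(2) by (simp add: c_def poly2_over_def)
  have c_weight: "c (p * i + m * j) = coeff (coeff R j) i" if "j < p" for i j
    using weight_div_mod[OF that, of i] unfolding c_def by (elim conjE) (simp only: add_diff_cancel_right')
  have "ev R x y = (\<Sum>j<p. poly (coeff R j) x * y ^ j)"
  proof -
    have "ev R x y = (\<Sum>j\<le>max (degree R) p. poly (coeff R j) x * y ^ j)"
      unfolding ev_altdef by (intro sum.mono_neutral_left) (auto simp: coeff_eq_0)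
    also have "\<dots> = (\<Sum>j<p. poly (coeff R j) x * y ^ j)"
      by (intro sum.mono_neutral_right) (auto simp: QR(4))
    finally show ?thesis .
  qed
  also have "\<dots> = (\<Sum>j<p. \<Sum>i\<le>D. coeff (coeff R j) i * (x ^ i * y ^ j))"
  proof (rule sum.cong, rule refl)
    fix j assume "j \<in> {..<p}"
    hence "poly (coeff R j) x = (\<Sum>i\<le>D. coeff (coeff R j) i * x ^ i)"
      unfolding poly_altdef using D by (intro sum.mono_neutral_left) (auto simp: coeff_eq_0)
    thus "poly (coeff R j) x * y ^ j = (\<Sum>i\<le>D. coeff (coeff R j) i * (x ^ i * y ^ j))"
      by (simp add: sum_distrib_right mult.assoc)
  qed
  also have "\<dots> = (\<Sum>(j, i)\<in>{..<p} \<times> {..D}. coeff (coeff R j) i * (x ^ i * y ^ j))"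
    by (rule sum.cartesian_product)
  also have "\<dots> = (\<Sum>v\<in>(\<lambda>(j, i). p * i + m * j) ` ({..<p} \<times> {..D}). c v * xymon v)"
  proof (subst sum.reindex)
    show "inj_on (\<lambda>(j, i). p * i + m * j) ({..<p} \<times> {..D})"
    proof (rule inj_onI, clarify)
      fix j i j' i' assume "j < p" "j' < p" "p * i + m * j = p * i' + m * j'"
      thus "j = j' \<and> i = i'" using weight_div_mod[of j i] weight_div_mod[of j' i'] by simp
    qed
    show "(\<Sum>(j, i)\<in>{..<p} \<times> {..D}. coeff (coeff R j) i * (x ^ i * y ^ j)) =
      sum ((\<lambda>v. c v * xymon v) \<circ> (\<lambda>(j, i). p * i + m * j)) ({..<p} \<times> {..D})"
      unfolding o_def by (rule sum.cong) (clarsimp simp: c_weight mon_weight)+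
  qed
  also have "\<dots> = (\<Sum>v | v < n \<and> nongap v. c v * xymon v)"
  proof (rule sum.mono_neutral_left)
    show "(\<lambda>(j, i). p * i + m * j) ` ({..<p} \<times> {..D}) \<subseteq> {v. v < n \<and> nongap v}"
    proof clarify
      fix j i assume ji: "j < p" "i \<le> D"
      show "p * i + m * j < n \<and> nongap (p * i + m * j)" using nongap_weight[OF ji(1)] weight_lt[OF ji(2,1)] by simp
    qed
    show "\<forall>v\<in>{v. v < n \<and> nongap v} - (\<lambda>(j, i). p * i + m * j) ` ({..<p} \<times> {..D}). c v * xymon v = 0"
    proof
      fix v assume v: "v \<in> {v. v < n \<and> nongap v} - (\<lambda>(j, i). p * i + m * j) ` ({..<p} \<times> {..D})"
      let ?i = "v div p - M * (v mod p)"
      have "v = (\<lambda>(j, i). p * i + m * j) (v mod p, ?i)" using weight_nongap[of v] v by simp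
      moreover have vp: "v mod p < p" using p_gt_1 by simp
      ultimately have "\<not> ?i \<le> D" using v by (metis (no_types, lifting) DiffD2 SigmaI atMost_iff image_eqI lessThan_iff)
      hence "c v = 0" unfolding c_def using D[OF vp] by (intro coeff_eq_0) simp
      thus "c v * xymon v = 0" by simp
    qed
  qed simp
  finally have sum0: "(\<Sum>v | v < n \<and> nongap v. c v * xymon v) = 0" using \<open>ev R x y = 0\<close> by simp
  have "coeff (coeff R j) i = 0" for i j
  proof (cases "j < p \<and> i \<le> D")
    case True
    hence "c (p * i + m * j) = 0" by (intro Sp_independent[OF ck sum0] nongap_weight weight_lt) auto
    thus ?thesis using True by (simp add: c_weight)
  next
    case False
    show ?thesis
    proof (cases "j < p")
      case True
      thus ?thesis using False D[of j] by (intro coeff_eq_0) auto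
    qed (simp add: QR(4))
  qed
  hence "R = 0" by (intro poly_eqI) (simp add: poly_eq_iff)
  thus ?thesis using QR by auto
qed

definition "t c = poly (T c) x"

lemma t_eq: "t c = x ^ (q ^ c) + x" by (simp add: t_def poly_T)
lemma t_A: "t c \<in> A" unfolding t_def by (intro A_poly P1_T)
lemma t_nz:
  assumes "c \<ge> 1" shows "t c \<noteq> 0"
proof -
  have "T c \<noteq> 0" using lead_T[OF assms] by auto
  thus ?thesis using transc[OF P1_T[of c]] by (auto simp: t_def)
qed

text \<open>The quotient of the coordinate ring by a nonzero element \<open>z\<close> is finite, so two Frobenius powers
  of \<open>x\<close> agree modulo \<open>z\<close>.\<close>

lemma multiple_of_t_power:
  assumes "z \<in> A" "z \<noteq> 0"
  shows "\<exists>w\<in>A. \<exists>c\<ge>1. \<exists>b. z * w = t c ^ b"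
proof -
  obtain a where a: "z \<in> Sp a" using A_Sp assms(1) by blast
  define s where "s = q ^ a"
  define n where "n = p * q ^ s + 1"
  have xn: "x ^ (q ^ i) \<in> Sp n" if "i \<le> s" for i
  proof -
    have "q ^ i \<le> q ^ s" using that q_gt_1 by (intro power_increasing) auto
    hence "p * q ^ i + m * 0 + 1 \<le> n" by (simp add: n_def)
    from Sp_mono[OF monomial_Sp this] show ?thesis by simp
  qed
  \<comment> \<open>Multiplying by \<open>z\<close> raises the filtration by \<open>a\<close>, which
    enlarges the space by a factor of at most \<open>q ^ a = s\<close>; the \<open>s + 1\<close>
    powers of \<open>x\<close> therefore overfill it.\<close>
  let ?D = "{..s} \<times> Sp n" and ?f = "\<lambda>(i, u). x ^ (q ^ i) + z * u"
  have "card {v. v < n + a \<and> nongap v} \<le> card ({v. v < n \<and> nongap v} \<union> {n..<n+a})" by (rule card_mono) auto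
  also have "\<dots> \<le> card {v. v < n \<and> nongap v} + a" using card_Un_le[of "{v. v < n \<and> nongap v}" "{n..<n+a}"] by simp
  finally have "card (Sp (n + a)) \<le> q ^ (card {v. v < n \<and> nongap v} + a)"
    unfolding card_Sp using q_gt_1 by (intro power_increasing) auto
  also have "\<dots> = card (Sp n) * s" by (simp add: card_Sp s_def power_add)
  also have "\<dots> < card ?D"
    using q_gt_1 by (simp add: card_cartesian_product card_Sp)
  finally have "card (Sp (n + a)) < card ?D" .
  moreover have "?f ` ?D \<subseteq> Sp (n + a)"
  proof clarify
    fix i u assume "i \<le> s" "u \<in> Sp n"
    hence "x ^ (q ^ i) \<in> Sp (n + a)" "z * u \<in> Sp (a + n)" using Sp_mono[OF xn, of i "n + a"] Sp_mult[OF a, of u n] by auto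
    thus "x ^ (q ^ i) + z * u \<in> Sp (n + a)" using Sp_add by (simp add: add.commute)
  qed
  hence "card (?f ` ?D) \<le> card (Sp (n + a))" by (rule card_mono[OF finite_Sp])
  ultimately have "card (?f ` ?D) < card ?D" by simp
  hence "\<not> inj_on ?f ?D" by (rule pigeonhole)
  then obtain i u j u' where ij: "u \<in> Sp n" "u' \<in> Sp n" "(i, u) \<noteq> (j, u')" "x ^ (q ^ i) + z * u = x ^ (q ^ j) + z * u'"
    unfolding inj_on_def by auto
  have *: "\<exists>w\<in>A. \<exists>c\<ge>1. \<exists>b. z * w = t c ^ b"
    if "i < j" "u \<in> Sp n" "u' \<in> Sp n" "x ^ (q ^ i) + z * u = x ^ (q ^ j) + z * u'" for i j u u'
  proof -
    have "x ^ (q ^ j) + x ^ (q ^ i) + (z * u + z * u') = (x ^ (q ^ i) + z * u) + (x ^ (q ^ j) + z * u')" by (simp add: add_ac)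
    hence "x ^ (q ^ j) + x ^ (q ^ i) + (z * u + z * u') = 0" by (simp only: that(4) add_self_universe)
    hence "x ^ (q ^ j) + x ^ (q ^ i) = z * u + z * u'" by (simp only: add_eq_0_universe)
    hence "z * (u + u') = x ^ (q ^ j) + x ^ (q ^ i)" by (simp only: distrib_left)
    also have "\<dots> = t (j - i) ^ (q ^ i)"
    proof -
      have "q ^ j = q ^ (j - i) * q ^ i" using that(1) by (simp flip: power_add)
      hence "x ^ (q ^ j) = (x ^ (q ^ (j - i))) ^ (q ^ i)" by (simp only: power_mult)
      moreover have "(z + w) ^ (q ^ i) = z ^ (q ^ i) + w ^ (q ^ i)" for z w :: universe unfolding qc by (rule frob_add)
      ultimately show ?thesis unfolding t_eq by (simp only:)
    qed
    finally have "z * (u + u') = t (j - i) ^ (q ^ i)" .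
    moreover have "u + u' \<in> A" using that Sp_A A_add by blast
    moreover have "j - i \<ge> 1" using that(1) by simp
    ultimately show ?thesis by blast
  qed
  have "i \<noteq> j" using ij assms(2) by auto
  thus ?thesis
  proof (rule linorder_neqE_nat)
    assume "i < j" thus ?thesis by (rule *[OF _ ij(1,2,4)])
  next
    assume "j < i" thus ?thesis by (rule *[OF _ ij(2,1) ij(4)[symmetric]])
  qed
qed

end

section \<open>Affine places\<close>

lemma ev_smult [simp]: "ev (smult c G) a b = poly c a * ev G a b" by (simp add: ev_def)

context as_curve
begin

abbreviation "evp G pt \<equiv> ev G (fst pt) (snd pt)"

lemma ev_GF:
  assumes "d \<ge> 1" "G \<in> P2" "a \<in> GF (q ^ d)" "b \<in> GF (q ^ d)"
  shows "ev G a b \<in> GF (q ^ d)"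
proof -
  have "k \<subseteq> GF (q ^ d)" using GF_mono[of 1 d q] by simp
  hence *: "coeff (coeff G j) i \<in> GF (q ^ d)" for i j using assms(2) unfolding poly2_over_def by blast
  show ?thesis using assms(3,4) * unfolding ev_altdef poly_altdef qc
    by (intro GF_sum GF_mult GF_power)
qed

lemma Xc_mono: assumes "c dvd c'" "pt \<in> Xc c" shows "pt \<in> Xc c'"
  using GF_mono[OF assms(1), of q] assms(2) unfolding Xc_def by blast

text \<open>Both polynomials have derivative 1, hence the cofactor is 1 at every zero of
  \<open>T c\<close>: there the two functions differ by a unit.\<close>

lemma T_dvd:
  assumes c: "c \<ge> 1" "c' \<ge> 1" "c dvd c'"
  shows "\<exists>S\<in>P1. T c' = T c * S \<and> (\<forall>a\<in>GF (q ^ c). poly S a = 1)"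
proof -
  have "\<exists>A S. (\<forall>i. coeff A i \<in> k) \<and> (\<forall>i. coeff S i \<in> k) \<and> T c' = T c * A + S \<and> (\<forall>i\<ge>degree (T c). coeff S i = 0)"
    using P1_T[of c] P1_T[of c'] lead_T[OF c(1)] by (intro monic_division) (auto simp: P1_def k_0 k_add GF_mult)
  then obtain A S where AS: "\<forall>i. coeff A i \<in> k" "T c' = T c * A + S" "\<forall>i\<ge>q ^ c. coeff S i = 0"
    unfolding degree_T[OF c(1)] by blast
  have "S = 0"
  proof (rule poly_eq_0_if_many_roots[of "q ^ c" _ "GF (q ^ c)"])
    fix z :: universe assume z: "z \<in> GF (q ^ c)"
    hence "poly (T c) z = 0" "poly (T c') z = 0" using GF_mono[OF c(3), of q] by (auto simp: poly_T_0_iff)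
    thus "poly S z = 0" by (simp add: AS(2))
  qed (use AS c in \<open>auto simp: finite_GFc card_GFc\<close>)
  hence T: "T c' = T c * A" using AS by simp
  have pd: "pderiv (T d) = 1" if "d \<ge> 1" for d
  proof -
    have "even (q ^ d)" using that N by (simp add: q)
    hence "(of_nat (q ^ d) :: universe) = 0" by (metis evenE of_nat_mult of_nat_numeral two_eq_0_universe mult_zero_left)
    thus ?thesis unfolding T_def pderiv_add pderiv_monom by (simp add: monom_0 one_pCons del: of_nat_power)
  qed
  have "poly A a = 1" if "a \<in> GF (q ^ c)" for a
  proof -
    have "poly (pderiv (T c')) a = poly A a"
      unfolding T pderiv_mult using that by (simp add: pd[OF c(1)] poly_T_0_iff)
    thus ?thesis by (simp add: pd[OF c(2)])
  qed
  thus ?thesis using T AS(1) by (auto simp: P1_def)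
qed

end

context as_point
begin

lemma ev_transfer:
  assumes "G \<in> P2" "ev G x y = 0" "on_curve pt" shows "evp G pt = 0"
  using generic[OF assms(1,2)] ev_H_on_curve[OF assms(3)] by auto

definition "Vp pt = {ev G x y / ev G' x y | G G'. G \<in> P2 \<and> G' \<in> P2 \<and> evp G' pt \<noteq> 0}"
definition "res pt z = (THE r. \<exists>G G'. G \<in> P2 \<and> G' \<in> P2 \<and> evp G' pt \<noteq> 0 \<and> z = ev G x y / ev G' x y \<and> r = evp G pt / evp G' pt)"

lemma VpI: "G \<in> P2 \<Longrightarrow> G' \<in> P2 \<Longrightarrow> evp G' pt \<noteq> 0 \<Longrightarrow> ev G x y / ev G' x y \<in> Vp pt"
  unfolding Vp_def by blast
lemma VpE:
  assumes "z \<in> Vp pt"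
  obtains G G' where "G \<in> P2" "G' \<in> P2" "evp G' pt \<noteq> 0" "z = ev G x y / ev G' x y"
  using assms unfolding Vp_def by blast

text \<open>The values of \<open>G\<close> on \<open>Xc c\<close> lie in the field with
  \<open>q ^ (2 * c)\<close> elements. Where \<open>G\<close> vanishes the second factor is 1, so
  \<open>t c\<close> divides \<open>G\<close> locally.\<close>

lemma power_congruence:
  assumes "c \<ge> 1" "G \<in> P2"
  shows "\<exists>B\<in>P2. ev G x y * (ev G x y ^ (q ^ (2 * c) - 1) + 1) = t c * ev B x y"
proof -
  let ?N = "q ^ (2 * c)"
  have N1: "?N = Suc (?N - 1)" using q_gt_1 by simp
  have van: "evp (G ^ ?N - G) pt = 0" if "pt \<in> Xc c" for pt
    using ev_GF[OF _ assms(2) Xc_coords[OF that]] assms(1) by (simp add: GF_def)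
  obtain A B where AB: "A \<in> P2" "B \<in> P2" "G ^ ?N - G = [:T c:] * A + H * B"
    using vanish_on_Xc[OF assms(1) P2_diff[OF P2_power[OF assms(2)] assms(2)] van] by blast
  have "ev (G ^ ?N - G) x y = t c * ev A x y" unfolding AB(3) using xy by (simp add: ev_H t_def)
  moreover have "ev (G ^ ?N - G) x y = ev G x y * (ev G x y ^ (?N - 1) + 1)"
    by (subst N1) (simp add: distrib_left)
  ultimately have "ev G x y * (ev G x y ^ (?N - 1) + 1) = t c * ev A x y" by (simp only:)
  thus ?thesis using AB(1) by blast
qed

end

locale affine_place = as_point +
  fixes c :: nat and pt :: "universe \<times> universe"
  assumes c: "c \<ge> 1" and pt: "pt \<in> Xc c"
begin

lemma on_curve: "on_curve pt" using pt by (simp add: Xc_def)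
lemma ev_nz: "G \<in> P2 \<Longrightarrow> evp G pt \<noteq> 0 \<Longrightarrow> ev G x y \<noteq> 0" using ev_transfer on_curve by blast
lemma ev_eq:
  assumes "G \<in> P2" "G' \<in> P2" "ev G x y = ev G' x y" shows "evp G pt = evp G' pt"
  using ev_transfer[OF P2_diff[OF assms(1,2)] _ on_curve] assms(3) by simp

lemma frac_eq:
  assumes "G \<in> P2" "G' \<in> P2" "evp G' pt \<noteq> 0" "D \<in> P2" "D' \<in> P2" "evp D' pt \<noteq> 0"
    and "ev G x y / ev G' x y = ev D x y / ev D' x y"
  shows "evp G pt / evp G' pt = evp D pt / evp D' pt"
proof -
  have "ev (G * D') x y = ev (D * G') x y" using assms ev_nz by (simp add: frac_eq_eq)
  hence "evp (G * D') pt = evp (D * G') pt" by (rule ev_eq[rotated 2]) (intro P2_mult assms)+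
  thus ?thesis using assms by (simp add: frac_eq_eq)
qed

lemma res_eq:
  assumes "G \<in> P2" "G' \<in> P2" "evp G' pt \<noteq> 0"
  shows "res pt (ev G x y / ev G' x y) = evp G pt / evp G' pt"
  unfolding res_def
proof (rule the_equality)
  fix r assume "\<exists>D D'. D \<in> P2 \<and> D' \<in> P2 \<and> evp D' pt \<noteq> 0 \<and> ev G x y / ev G' x y = ev D x y / ev D' x y \<and> r = evp D pt / evp D' pt"
  then obtain D D' where "D \<in> P2" "D' \<in> P2" "evp D' pt \<noteq> 0" "ev G x y / ev G' x y = ev D x y / ev D' x y" "r = evp D pt / evp D' pt"
    by blast
  thus "r = evp G pt / evp G' pt" using frac_eq[OF assms] by simp
qed (use assms in blast)

abbreviation "V \<equiv> Vp pt"

lemma V_ring_res: assumes "a \<in> V" "b \<in> V" shows "a - b \<in> V \<and> a * b \<in> V \<and> res pt (a + b) = res pt a + res pt b \<and> res pt (a * b) = res pt a * res pt b"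
proof -
  obtain G G' where G: "G \<in> P2" "G' \<in> P2" "evp G' pt \<noteq> 0" "a = ev G x y / ev G' x y" using VpE[OF assms(1)] by blast
  obtain D D' where D: "D \<in> P2" "D' \<in> P2" "evp D' pt \<noteq> 0" "b = ev D x y / ev D' x y" using VpE[OF assms(2)] by blast
  note nz = ev_nz[OF G(2,3)] ev_nz[OF D(2,3)]
  have GD: "G * D' + D * G' \<in> P2" "G' * D' \<in> P2" "G * D \<in> P2" "evp (G' * D') pt \<noteq> 0"
    using G D by (auto intro!: P2_add P2_mult)
  have sum: "a + b = ev (G * D' + D * G') x y / ev (G' * D') x y"
    unfolding G(4) D(4) using nz by (simp add: add_frac_eq)
  have prod: "a * b = ev (G * D) x y / ev (G' * D') x y" unfolding G(4) D(4) by simp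
  have "a - b \<in> V" unfolding diff_universe sum by (rule VpI) (use GD in auto)
  moreover have "a * b \<in> V" unfolding prod by (rule VpI) (use GD in auto)
  moreover have "res pt (a + b) = res pt a + res pt b"
    unfolding sum res_eq[OF GD(1,2,4)] unfolding G(4) D(4) res_eq[OF G(1-3)] res_eq[OF D(1-3)]
    using G(3) D(3) by (simp add: add_frac_eq)
  moreover have "res pt (a * b) = res pt a * res pt b"
    unfolding prod res_eq[OF GD(3,2,4)] unfolding G(4) D(4) res_eq[OF G(1-3)] res_eq[OF D(1-3)] by simp
  ultimately show ?thesis by blast
qed

lemma V_A: "a \<in> A \<Longrightarrow> a \<in> V" using VpI[OF _ P2_1, of _ pt] by (auto elim: AE)

definition "U = {ev G x y / ev G' x y | G G'. G \<in> P2 \<and> G' \<in> P2 \<and> evp G pt \<noteq> 0 \<and> evp G' pt \<noteq> 0}"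

lemma UI: "G \<in> P2 \<Longrightarrow> G' \<in> P2 \<Longrightarrow> evp G pt \<noteq> 0 \<Longrightarrow> evp G' pt \<noteq> 0 \<Longrightarrow> ev G x y / ev G' x y \<in> U"
  unfolding U_def by blast

lemma U_inverse: "u \<in> U \<Longrightarrow> inverse u \<in> U" unfolding U_def by force
lemma U_V: "u \<in> U \<Longrightarrow> u \<in> V" unfolding U_def Vp_def by blast
lemma U_nz: "u \<in> U \<Longrightarrow> u \<noteq> 0" unfolding U_def using ev_nz by auto
lemma U_mult: assumes "u \<in> U" "w \<in> U" shows "u * w \<in> U"
proof -
  obtain G G' where G: "G \<in> P2" "G' \<in> P2" "evp G pt \<noteq> 0" "evp G' pt \<noteq> 0" "u = ev G x y / ev G' x y" using assms(1) unfolding U_def by blast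
  obtain D D' where D: "D \<in> P2" "D' \<in> P2" "evp D pt \<noteq> 0" "evp D' pt \<noteq> 0" "w = ev D x y / ev D' x y" using assms(2) unfolding U_def by blast
  have "u * w = ev (G * D) x y / ev (G' * D') x y" unfolding G(5) D(5) by simp
  thus ?thesis using G D by (simp only:) (intro UI P2_mult, auto)
qed

lemma T_pt: "poly (T c) (fst pt) = 0" using pt by (simp add: poly_T_0_iff Xc_def)
lemma tc_nz: "t c \<noteq> 0" by (rule t_nz[OF c])

lemma A_dec_step:
  assumes "z \<in> V" shows "z \<in> U \<or> (\<exists>v\<in>V. z = t c * v)"
proof -
  obtain G G' where G: "G \<in> P2" "G' \<in> P2" "evp G' pt \<noteq> 0" "z = ev G x y / ev G' x y" using VpE[OF assms] by blast
  show ?thesis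
  proof (cases "evp G pt = 0")
    case False
    thus ?thesis using UI[OF G(1,2)] G by auto
  next
    case True
    define n where "n = q ^ (2 * c) - 1"
    define E where "E = (G ^ n + 1) * G'"
    have n0: "n > 0" using qc_gt_1[of "2 * c"] c by (simp add: n_def)
    have E: "E \<in> P2" unfolding E_def by (intro P2_mult P2_add P2_power P2_1 G)
    have Ept: "evp E pt \<noteq> 0" using G True n0 by (simp add: E_def power_0_left)
    have nz: "ev G x y ^ n + 1 \<noteq> 0" using ev_nz[OF E Ept] by (auto simp: E_def)
    obtain B where B: "B \<in> P2" "ev G x y * (ev G x y ^ n + 1) = t c * ev B x y" using power_congruence[OF c G(1)] unfolding n_def by blast
    have "z = (ev G x y * (ev G x y ^ n + 1)) / ev E x y" unfolding G(4) E_def using nz by simp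
    hence "z = t c * (ev B x y / ev E x y)" unfolding B(2) by simp
    thus ?thesis using VpI[OF B(1) E Ept] by blast
  qed
qed

text \<open>If \<open>z\<close> were divisible by all powers of \<open>t c\<close>, a bound would be
  violated: \<open>z\<close> divides a power of some \<open>t c'\<close>, and at the point this
  contains \<open>t c\<close> at most to the same power.\<close>

lemma A_dec:
  assumes z: "z \<in> A" "z \<noteq> 0" shows "\<exists>i::nat. \<exists>u\<in>U. z = t c ^ i * u"
proof (rule ccontr)
  assume no: "\<not> ?thesis"
  have all: "\<exists>v\<in>V. z = t c ^ i * v" for i
  proof (induction i)
    case 0 thus ?case using V_A[OF z(1)] by auto
  next
    case (Suc i)
    then obtain v where v: "v \<in> V" "z = t c ^ i * v" by blast
    hence "v \<notin> U" using no by blast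
    then obtain v' where "v' \<in> V" "v = t c * v'" using A_dec_step[OF v(1)] by blast
    thus ?case using v by (intro bexI[of _ v']) (auto simp: mult_ac)
  qed
  obtain w c' b where w: "w \<in> A" "c' \<ge> 1" "z * w = t c' ^ b" using multiple_of_t_power[OF z] by blast
  \<comment> \<open>A common multiple, so that \<open>t ?C\<close> is a multiple of both functions;
    over \<open>t c\<close> its cofactor is 1 at the point.\<close>
  let ?C = "c * c'"
  have C: "?C \<ge> 1" using c w(2) by simp
  obtain S where S: "S \<in> P1" "T ?C = T c * S" "\<forall>a\<in>GF (q ^ c). poly S a = 1" using T_dvd[OF c C] by auto
  obtain S' where S': "S' \<in> P1" "T ?C = T c' * S'" using T_dvd[OF w(2) C] by auto
  obtain W where W: "W \<in> P2" "w = ev W x y" using w(1) by (rule AE)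
  obtain v where v: "v \<in> V" "z = t c ^ Suc b * v" using all by blast
  obtain G G' where G: "G \<in> P2" "G' \<in> P2" "evp G' pt \<noteq> 0" "v = ev G x y / ev G' x y" using VpE[OF v(1)] by blast
  have "z * w * poly S' x ^ b = (t c * poly S x) ^ b"
  proof -
    have "t c' * poly S' x = t c * poly S x" using S(2) S'(2) by (metis t_def poly_mult)
    thus ?thesis unfolding w(3) by (simp flip: power_mult_distrib)
  qed
  hence "t c ^ b * (t c * v * w * poly S' x ^ b) = t c ^ b * poly S x ^ b"
    unfolding v(2) by (simp add: power_mult_distrib mult_ac)
  hence "t c * v * w * poly S' x ^ b = poly S x ^ b" using tc_nz by simp
  hence "t c * ev G x y * w * poly S' x ^ b = poly S x ^ b * ev G' x y"
    unfolding G(4) using ev_nz[OF G(2,3)] by (simp add: field_simps)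
  hence "ev ([:T c:] * G * W * [:S':] ^ b) x y = ev ([:S:] ^ b * G') x y" by (simp add: W t_def mult.assoc)
  hence "evp ([:T c:] * G * W * [:S':] ^ b) pt = evp ([:S:] ^ b * G') pt"
    by (rule ev_eq[rotated 2]) (intro P2_mult P2_power P2_const P1_T S S' G W)+
  hence "poly S (fst pt) ^ b * evp G' pt = 0" by (simp add: T_pt)
  moreover have "poly S (fst pt) = 1" using S(3) pt by (simp add: Xc_def)
  ultimately show False using G(3) by simp
qed

lemma F_dec:
  assumes "z \<in> F" "z \<noteq> 0" shows "\<exists>i. \<exists>u\<in>U. z = t c powi i * u"
proof -
  obtain a b where ab: "z = a / b" "a \<in> A" "b \<in> A" "b \<noteq> 0" using assms(1) unfolding F_def by blast
  hence "a \<noteq> 0" using assms(2) by auto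
  then obtain i u where u: "u \<in> U" "a = t c ^ i * u" using A_dec[OF ab(2)] by blast
  obtain j w where w: "w \<in> U" "b = t c ^ j * w" using A_dec[OF ab(3,4)] by blast
  have "z = t c powi (int i - int j) * (u * inverse w)"
    unfolding ab(1) u(2) w(2) using tc_nz by (simp add: power_int_diff divide_inverse mult_ac)
  thus ?thesis using U_mult[OF u(1) U_inverse[OF w(1)]] by blast
qed

lemma t_V: "t c ^ i \<in> V" by (rule V_A[OF A_power[OF t_A]])

lemma V_ne_inverse_t: "inverse (t c) \<notin> V"
proof
  assume "inverse (t c) \<in> V"
  then obtain G G' where G: "G \<in> P2" "G' \<in> P2" "evp G' pt \<noteq> 0" "inverse (t c) = ev G x y / ev G' x y" by (rule VpE)
  have "t c * inverse (t c) = 1" using tc_nz by simp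
  hence "t c * ev G x y = ev G' x y" unfolding G(4) using ev_nz[OF G(2,3)] by (simp add: field_simps)
  hence "ev ([:T c:] * G) x y = ev G' x y" by (simp add: t_def)
  hence "evp ([:T c:] * G) pt = evp G' pt" by (rule ev_eq[rotated 2]) (intro P2_mult P2_const P1_T G)+
  thus False using G(3) T_pt by simp
qed

sublocale valring F V
proof
  show "V \<subseteq> F"
  proof
    fix z assume "z \<in> V"
    then obtain G G' where "G \<in> P2" "G' \<in> P2" "evp G' pt \<noteq> 0" "z = ev G x y / ev G' x y" by (rule VpE)
    thus "z \<in> F" unfolding F_def using AI ev_nz by blast
  qed
  show "z \<in> V \<or> inverse z \<in> V" if z: "z \<in> F" for z
  proof (cases "z = 0")
    case False
    then obtain i u where u: "u \<in> U" "z = t c powi i * u" using F_dec z by blast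
    show ?thesis
    proof (cases "i \<ge> 0")
      case True
      hence "z = t c ^ nat i * u" using u by (simp add: power_int_def)
      thus ?thesis using V_ring_res[OF t_V U_V[OF u(1)]] by simp
    next
      case False
      hence "inverse z = t c ^ nat (- i) * inverse u" using u by (simp add: power_int_def power_inverse)
      thus ?thesis using V_ring_res[OF t_V U_V[OF U_inverse[OF u(1)]]] by simp
    qed
  qed (use V_A[OF A_0] in simp)
qed (use F_1 F_diff F_mult F_inverse V_A[OF A_1] V_ring_res in auto)

lemma U_unit: "u \<in> U \<Longrightarrow> u \<in> V - P" unfolding unit_iff using U_nz U_V U_inverse by blast

lemma uniformizer_t: "uniformizer (t c)"
  unfolding uniformizer_def
proof (intro conjI ballI impI)
  show "t c \<in> P" using t_V[of 1] V_ne_inverse_t by (simp add: max_ideal_def)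
  fix z assume "z \<in> F" "z \<noteq> 0"
  thus "\<exists>n. \<exists>u\<in>V - P. z = t c powi n * u" using F_dec U_unit by blast
qed (rule tc_nz)

lemma P_iff_res: assumes "z \<in> V" shows "res pt z = 0 \<longleftrightarrow> z \<in> P"
proof -
  obtain G G' where G: "G \<in> P2" "G' \<in> P2" "evp G' pt \<noteq> 0" "z = ev G x y / ev G' x y" using VpE[OF assms] by blast
  have "res pt z = evp G pt / evp G' pt" unfolding G(4) by (rule res_eq[OF G(1-3)])
  moreover have "z \<notin> P" if "evp G pt \<noteq> 0" using U_unit[OF UI[OF G(1,2) that G(3)]] G(4) by simp
  moreover have "z \<in> P" if G0: "evp G pt = 0"
  proof (rule ccontr)
    assume "z \<notin> P"
    hence "z \<in> V - P" using assms by simp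
    hence "z \<noteq> 0" "inverse z \<in> V" unfolding unit_iff by auto
    have "res pt (z * inverse z) = res pt z * res pt (inverse z)" using V_ring_res[OF assms \<open>inverse z \<in> V\<close>] by blast
    also have "res pt z = 0" unfolding G(4) res_eq[OF G(1-3)] by (simp add: G0)
    finally have "res pt 1 = 0" using \<open>z \<noteq> 0\<close> by simp
    moreover have "res pt 1 = 1" using res_eq[OF P2_1 P2_1] by simp
    ultimately show False by simp
  qed
  ultimately show ?thesis using G(3) by auto
qed

lemma res_k: assumes "b \<in> k" shows "res pt b = b"
  using res_eq[OF P2_const[OF P1_const[OF assms]] P2_1] by simp

lemma res_GF:
  assumes "d \<ge> 1" "fst pt \<in> GF (q ^ d)" "snd pt \<in> GF (q ^ d)" shows "res pt ` V \<subseteq> GF (q ^ d)"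
proof clarify
  fix z assume "z \<in> V"
  then obtain G G' where G: "G \<in> P2" "G' \<in> P2" "evp G' pt \<noteq> 0" "z = ev G x y / ev G' x y" by (rule VpE)
  have "res pt z = evp G pt * inverse (evp G' pt)" unfolding G(4) res_eq[OF G(1-3)] by (rule divide_inverse)
  thus "res pt z \<in> GF (q ^ d)" by (simp only:) (intro GF_mult GF_inverse ev_GF assms G)
qed

lemma finite_res: "finite (res pt ` V)"
  using res_GF[OF _ Xc_coords[OF pt]] c by (rule_tac finite_subset[of _ "GF (q ^ (2 * c))"]) (auto simp: finite_GFc)

lemma card_res: "card (res pt ` V) = q ^ place_degree k V"
proof -
  have "card (res pt ` V) = card k ^ dim_quot k V P"
  proof (rule card_image_eq_power_dim_quot)
    show "res pt (a * z) = a * res pt z" if "a \<in> k" "z \<in> V" for a z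
      using V_ring_res[OF V_A[OF A_k[OF that(1)]] that(2)] res_k[OF that(1)] by simp
    show "a * z \<in> V" if "a \<in> k" "z \<in> V" for a z using V_mult[OF V_A[OF A_k[OF that(1)]] that(2)] .
  qed (use finite_k k_0 k_add GF_mult GF_inverse V_0 V_add V_ring_res P_iff_res finite_res in auto)
  thus ?thesis by (simp add: card_k place_degree_def)
qed

lemma place_degree_le:
  assumes "d \<ge> 1" "fst pt \<in> GF (q ^ d)" "snd pt \<in> GF (q ^ d)" shows "place_degree k V \<le> d"
proof -
  have "q ^ place_degree k V \<le> card (GF (q ^ d) :: universe set)"
    unfolding card_res[symmetric] by (intro card_mono res_GF assms finite_GFc)
  thus ?thesis using assms(1) q_gt_1 by (simp add: card_GFc)
qed

text \<open>The residue field contains \<open>k\<close> and both coordinates, and it lies in any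
  field \<open>GF (q ^ d)\<close> that contains them.\<close>

lemma place_degree_eq_1_iff: "place_degree k V = 1 \<longleftrightarrow> fst pt \<in> k \<and> snd pt \<in> k"
proof
  have sub: "k \<subseteq> res pt ` V" using res_k V_A[OF A_k] by (metis image_eqI subsetI)
  {
    assume "place_degree k V = 1"
    hence "k = res pt ` V" using card_subset_eq[OF finite_res sub] by (simp add: card_res card_k)
    moreover have "res pt x = fst pt" using res_eq[OF P2_const[OF P1_monom[OF GF_1, of 1]] P2_1] by (simp add: poly_monom)
    moreover have "res pt y = snd pt" using res_eq[OF P2_monom[OF P1_1, of 1] P2_1] by simp
    ultimately show "fst pt \<in> k \<and> snd pt \<in> k" using V_A[OF A_x] V_A[OF A_y] by (metis imageI)
  }
  assume *: "fst pt \<in> k \<and> snd pt \<in> k"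
  hence "res pt ` V = k" using res_GF[of 1] sub by auto
  hence "q ^ place_degree k V = q ^ 1" using card_res by (simp add: card_k)
  thus "place_degree k V = 1" using q_gt_1 power_inject_exp by blast
qed

lemma V_place: "V \<in> places k F"
proof -
  have "V \<noteq> F" using V_ne_inverse_t F_inverse[OF A_F[OF t_A]] by blast
  thus ?thesis unfolding places_def using V_A[OF A_k] V_F V_diff V_mult V_total by auto
qed

end

section \<open>The place at infinity\<close>

context infinite_place
begin

text \<open>The pole orders \<open>p * M\<close> and \<open>m\<close> of numerator and denominator
  differ by 1.\<close>

definition "tau = x ^ M / y"

lemma tau_P: "tau \<in> P" using monomial_lt[of M 0 0 1] by (simp add: tau_def m)
lemma tau_nz: "tau \<noteq> 0" using x_nz y_nz by (simp add: tau_def)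

lemma xymon_tau: "nongap w \<Longrightarrow> \<exists>u\<in>V - P. xymon w = tau powi (- int w) * u"
proof -
  assume w: "nongap w"
  let ?i = "w div p - M * (w mod p)" and ?j = "w mod p"
  have "p * (?i + M * w) + m * ?j = p * 0 + m * w"
    using weight_nongap[OF w] by (simp add: m algebra_simps)
  hence "(x ^ (?i + M * w) * y ^ ?j) / (x ^ 0 * y ^ w) \<in> V - P" by (rule monomial_eq)
  moreover have "(x ^ (?i + M * w) * y ^ ?j) / (x ^ 0 * y ^ w) = xymon w * tau ^ w"
    by (simp add: xymon_def tau_def power_divide power_add power_mult mult_ac)
  moreover have "xymon w = tau powi (- int w) * (xymon w * tau ^ w)" using tau_nz by (simp add: power_int_minus field_simps)
  ultimately show ?thesis by metis
qed

lemma A_dec: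
  assumes "a \<in> A" "a \<noteq> 0"
  shows "\<exists>w u b. nongap w \<and> b \<in> k \<and> b \<noteq> 0 \<and> u - b \<in> P \<and> a = xymon w * u \<and> a \<in> Sp (Suc w)"
proof -
  obtain n where "a \<in> Sp n" using A_Sp assms(1) by blast
  then obtain w b where "nongap w" "b \<in> k" "b \<noteq> 0" "a / xymon w - b \<in> P" "a \<in> Sp (Suc w)" using Sp_lead assms(2) by blast
  thus ?thesis using mon_nz[of w] by (intro exI[of _ w] exI[of _ "a / xymon w"] exI[of _ b]) simp
qed

lemma near_unit: "b \<in> k \<Longrightarrow> b \<noteq> 0 \<Longrightarrow> u - b \<in> P \<Longrightarrow> u \<in> V - P"
  using unit_add[OF k_unit, of b "u - b"] by (metis add.commute diff_add_cancel)

lemma uniformizer_tau: "uniformizer tau"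
  unfolding uniformizer_def
proof (intro conjI ballI impI)
  have A: "\<exists>i. \<exists>u\<in>V - P. a = tau powi i * u" if a: "a \<in> A" "a \<noteq> 0" for a
  proof -
    obtain w u b where w: "nongap w" "b \<in> k" "b \<noteq> 0" "u - b \<in> P" "a = xymon w * u" using A_dec[OF a] by blast
    obtain u' where u': "u' \<in> V - P" "xymon w = tau powi (- int w) * u'" using xymon_tau[OF w(1)] by blast
    have "a = tau powi (- int w) * (u' * u)" by (simp add: w(5) u'(2))
    thus ?thesis using unit_mult[OF u'(1) near_unit[OF w(2-4)]] by blast
  qed
  fix z assume z: "z \<in> F" "z \<noteq> 0"
  obtain a b where ab: "z = a / b" "a \<in> A" "b \<in> A" "b \<noteq> 0" using z(1) unfolding F_def by blast
  obtain i u where u: "u \<in> V - P" "a = tau powi i * u" using A[of a] ab z(2) by auto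
  obtain j w where w: "w \<in> V - P" "b = tau powi j * w" using A[of b] ab by auto
  have "z = tau powi (i - j) * (u * inverse w)"
    unfolding ab(1) u(2) w(2) using tau_nz by (simp add: power_int_diff divide_inverse mult_ac)
  thus "\<exists>n. \<exists>u\<in>V - P. z = tau powi n * u" using unit_mult[OF u(1) unit_inverse[OF w(1)]] by blast
qed (use tau_P tau_nz in auto)

lemma xymon_le_V: assumes "nongap v" "nongap w" shows "xymon v / xymon w \<in> V \<longleftrightarrow> v \<le> w"
proof (cases v w rule: linorder_cases)
  case less thus ?thesis using mon_lt[OF assms] P_V by auto
next
  case equal thus ?thesis using mon_nz[of w] V_1 by simp
next
  case greater
  hence "xymon w / xymon v \<in> P" using mon_lt assms by blast
  hence "inverse (xymon w / xymon v) \<notin> V" using mon_nz by (auto simp: max_ideal_def)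
  thus ?thesis using greater by (simp add: inverse_eq_divide)
qed

lemma Sp_iff:
  assumes "a \<in> A" shows "a \<in> Sp (Suc n) \<longleftrightarrow> a * tau powi (int n) \<in> V"
proof (cases "a = 0")
  case False
  have *: "a * tau powi (int n) \<in> V \<longleftrightarrow> w \<le> n" if w: "nongap w" "b \<in> k" "b \<noteq> 0" "u - b \<in> P" "a = xymon w * u" for w u b
  proof -
    obtain u' where u': "u' \<in> V - P" "xymon w = tau powi (- int w) * u'" using xymon_tau[OF w(1)] by blast
    have "a * tau powi (int n) = tau powi (int n - int w) * (u' * u)"
      using tau_nz by (simp add: w(5) u'(2) power_int_diff power_int_minus divide_inverse mult_ac)
    thus ?thesis using powi_unit_V_iff[OF uniformizer_tau unit_mult[OF u'(1) near_unit[OF w(2-4)]]] by simp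
  qed
  show ?thesis
  proof
    assume "a \<in> Sp (Suc n)"
    then obtain w b where w: "w < Suc n" "nongap w" "b \<in> k" "b \<noteq> 0" "a / xymon w - b \<in> P" using Sp_lead False by blast
    have "a = xymon w * (a / xymon w)" using mon_nz by simp
    thus "a * tau powi (int n) \<in> V" using *[OF w(2-5)] w(1) by simp
  next
    assume V: "a * tau powi (int n) \<in> V"
    obtain w u b where w: "nongap w" "b \<in> k" "b \<noteq> 0" "u - b \<in> P" "a = xymon w * u" "a \<in> Sp (Suc w)" using A_dec[OF assms False] by blast
    hence "w \<le> n" using *[OF w(1-5)] V by blast
    thus "a \<in> Sp (Suc n)" using w(6) Sp_mono by simp
  qed
qed (simp add: Sp_0 V_0)

text \<open>A unit is a quotient of two functions of equal pole order. That order belongs to a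
  single monomial, which cancels, and the residue is the quotient of the leading
  coefficients.\<close>

lemma residue_ex: assumes "z \<in> V" shows "\<exists>!b. b \<in> k \<and> z - b \<in> P"
proof -
  have uniq: "b = b'" if "b \<in> k" "b' \<in> k" "z - b \<in> P" "z - b' \<in> P" for b b'
  proof (rule ccontr)
    assume "b \<noteq> b'"
    have "(z - b') - (z - b) = b - b'" by (simp add: add_ac)
    hence "b - b' \<in> P" using P_diff[OF that(4,3)] by (simp only:)
    moreover have "b - b' \<in> V - P" unfolding diff_universe using that \<open>b \<noteq> b'\<close> by (intro k_unit k_add) auto
    ultimately show False by blast
  qed
  have "\<exists>b. b \<in> k \<and> z - b \<in> P"
  proof (cases "z \<in> P")
    case True thus ?thesis using k_0 by (intro exI[of _ 0]) simp
  next
    case False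
    hence z0: "z \<noteq> 0" using P_0 by auto
    obtain a b where ab: "z = a / b" "a \<in> A" "b \<in> A" "b \<noteq> 0" using V_F assms unfolding F_def by blast
    hence "a \<noteq> 0" using z0 by auto
    obtain v u d where v: "nongap v" "d \<in> k" "d \<noteq> 0" "u - d \<in> P" "a = xymon v * u" using A_dec[OF ab(2) \<open>a \<noteq> 0\<close>] by blast
    obtain w u' d' where w: "nongap w" "d' \<in> k" "d' \<noteq> 0" "u' - d' \<in> P" "b = xymon w * u'" using A_dec[OF ab(3,4)] by blast
    note uu = near_unit[OF v(2-4)] near_unit[OF w(2-4)]
    have unz: "u \<noteq> 0" "u' \<noteq> 0" using uu P_0 by auto
    have zeq: "z = (xymon v / xymon w) * (u * inverse u')" unfolding ab(1) v(5) w(5) by (simp add: divide_inverse mult_ac)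
    define \<rho> where "\<rho> = xymon v / xymon w"
    have zu: "z \<in> V - P" using assms False by simp
    have one: "(u * inverse u') * (inverse u * u') = 1" using unz by (simp add: field_simps)
    have "z * (inverse u * u') = \<rho> * ((u * inverse u') * (inverse u * u'))"
      unfolding zeq \<rho>_def by (simp only: mult.assoc)
    hence "z * (inverse u * u') = \<rho>" unfolding one by simp
    hence r: "\<rho> \<in> V - P" using unit_mult[OF zu unit_mult[OF unit_inverse[OF uu(1)] uu(2)]] by (simp only:)
    hence "v \<le> w" using xymon_le_V[OF v(1) w(1)] unfolding \<rho>_def by blast
    moreover have "inverse \<rho> = xymon w / xymon v" by (simp add: \<rho>_def)
    hence "w \<le> v" using xymon_le_V[OF w(1) v(1)] unit_inverse[OF r] by auto
    ultimately have "\<rho> = 1" using mon_nz by (simp add: \<rho>_def)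
    hence z: "z = u * inverse u'" using zeq unfolding \<rho>_def by simp
    have dV: "d \<in> V" "inverse d' \<in> V" using v w k_V GF_inverse by auto
    have uV: "inverse u' \<in> V" using unit_inverse[OF uu(2)] by blast
    have "inverse u' - inverse d' = - (inverse u' * (u' - d') * inverse d')"
      by (rule inverse_diff_inverse[OF unz(2) w(3)])
    also have "\<dots> \<in> P" by (intro P_minus P_mult' P_mult uV w dV)
    finally have i: "inverse u' - inverse d' \<in> P" .
    have "z - d * inverse d' = (u - d) * inverse u' + d * (inverse u' - inverse d')" unfolding z by (simp add: distrib_left distrib_right add_ac)
    also have "\<dots> \<in> P" by (intro P_add P_mult'[OF v(4)] P_mult[OF dV(1)] uV i)
    finally show ?thesis using GF_mult[OF v(2) GF_inverse[OF w(2)]] by blast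
  qed
  thus ?thesis using uniq by blast
qed

definition "resI z = (THE b. b \<in> k \<and> z - b \<in> P)"

lemma resI: "z \<in> V \<Longrightarrow> resI z \<in> k \<and> z - resI z \<in> P"
  unfolding resI_def by (rule theI') (rule residue_ex)

lemma resI_eq: "z \<in> V \<Longrightarrow> b \<in> k \<Longrightarrow> z - b \<in> P \<Longrightarrow> resI z = b"
  unfolding resI_def using residue_ex by (intro the1_equality) auto

lemma resI_add: assumes "a \<in> V" "b \<in> V" shows "resI (a + b) = resI a + resI b"
proof (rule resI_eq)
  have "(a + b) - (resI a + resI b) = (a - resI a) + (b - resI b)" by (simp add: add_ac)
  thus "(a + b) - (resI a + resI b) \<in> P"
    by (simp only:) (intro P_add resI[OF assms(1), THEN conjunct2] resI[OF assms(2), THEN conjunct2])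
qed (use resI assms V_add k_add in auto)

lemma resI_scale: assumes "b \<in> k" "a \<in> V" shows "resI (b * a) = b * resI a"
proof (rule resI_eq)
  have "b * a - b * resI a = b * (a - resI a)" by (simp add: distrib_left)
  moreover have bV: "b \<in> V" using assms(1) k_V by blast
  ultimately show "b * a - b * resI a \<in> P" using P_mult[OF bV resI[OF assms(2), THEN conjunct2]] by (simp only:)
  show "b * a \<in> V" by (rule V_mult[OF bV assms(2)])
  show "b * resI a \<in> k" using GF_mult[OF assms(1)] resI[OF assms(2)] by blast
qed

lemma resI_0_iff: "z \<in> V \<Longrightarrow> resI z = 0 \<longleftrightarrow> z \<in> P"
  using resI[of z] resI_eq[of z 0] k_0 by auto

lemma resI_image: "resI ` V = k"
proof (intro equalityI subsetI)
  fix b assume b: "b \<in> k"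
  hence bV: "b \<in> V" using k_V by blast
  have "resI b = b" by (rule resI_eq[OF bV b]) (simp add: P_0)
  thus "b \<in> resI ` V" using bV by (metis imageI)
qed (use resI in auto)

lemma card_resI: "card (resI ` V) = q ^ place_degree k V"
proof -
  have "card (resI ` V) = card k ^ dim_quot k V P"
  proof (rule card_image_eq_power_dim_quot)
    show "a * z \<in> V" if "a \<in> k" "z \<in> V" for a z using V_mult k_V that by blast
  qed (use finite_k k_0 k_add GF_mult GF_inverse V_0 V_add resI_add resI_scale resI_0_iff resI_image in auto)
  thus ?thesis by (simp add: card_k place_degree_def)
qed

lemma place_degree_infinite: "place_degree k V = 1"
proof -
  have "q ^ place_degree k V = q ^ 1" using card_resI unfolding resI_image by (simp add: card_k)
  thus ?thesis using q_gt_1 power_inject_exp by blast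
qed

lemma V_place: "V \<in> places k F"
  unfolding places_def using k_V V_F V_diff V_mult V_total x_V A_F[OF A_x] by auto

end

section \<open>Classification of the places\<close>

context infinite_place
begin

lemma lead_order:
  assumes "a \<in> A" "a \<noteq> 0"
  shows "\<exists>w u. nongap w \<and> u \<in> V - P \<and> a = xymon w * u \<and> (\<forall>n. a \<in> Sp (Suc n) \<longleftrightarrow> w \<le> n)"
proof -
  obtain w u b where w: "nongap w" "b \<in> k" "b \<noteq> 0" "u - b \<in> P" "a = xymon w * u" using A_dec[OF assms] by blast
  note u = near_unit[OF w(2-4)]
  obtain u' where u': "u' \<in> V - P" "xymon w = tau powi (- int w) * u'" using xymon_tau[OF w(1)] by blast
  have "a \<in> Sp (Suc n) \<longleftrightarrow> w \<le> n" for n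
  proof -
    have "a * tau powi (int n) = tau powi (int n - int w) * (u' * u)"
      using tau_nz by (simp add: w(5) u'(2) power_int_diff power_int_minus divide_inverse mult_ac)
    thus ?thesis using powi_unit_V_iff[OF uniformizer_tau unit_mult[OF u'(1) u]] by (simp add: Sp_iff[OF assms(1)])
  qed
  thus ?thesis using w u by blast
qed

text \<open>The right-hand side does not mention \<open>V\<close>, so any two places at infinity
  coincide.\<close>

lemma fraction_V_iff:
  assumes a: "a \<in> A" "a \<noteq> 0" and b: "b \<in> A" "b \<noteq> 0"
  shows "a / b \<in> V \<longleftrightarrow> (\<forall>n. b \<in> Sp (Suc n) \<longrightarrow> a \<in> Sp (Suc n))"
proof -
  obtain v u where v: "nongap v" "u \<in> V - P" "a = xymon v * u" "\<And>n. a \<in> Sp (Suc n) \<longleftrightarrow> v \<le> n" using lead_order[OF a] by blast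
  obtain w u' where w: "nongap w" "u' \<in> V - P" "b = xymon w * u'" "\<And>n. b \<in> Sp (Suc n) \<longleftrightarrow> w \<le> n" using lead_order[OF b] by blast
  define r s where "r = xymon v / xymon w" and "s = u * inverse u'"
  have s: "s \<in> V - P" unfolding s_def using unit_mult v unit_inverse w by blast
  have "a / b = r * s" unfolding v(3) w(3) r_def s_def by (simp add: divide_inverse mult_ac)
  moreover have "r * s \<in> V \<longleftrightarrow> r \<in> V"
  proof
    assume "r * s \<in> V"
    hence "r * s * inverse s \<in> V" using unit_inverse[OF s] V_mult by blast
    moreover have "s \<noteq> 0" using s P_0 by auto
    ultimately show "r \<in> V" by (simp add: mult.assoc)
  qed (use s V_mult in blast)
  moreover have "r \<in> V \<longleftrightarrow> v \<le> w" unfolding r_def by (rule xymon_le_V[OF v(1) w(1)])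
  ultimately show ?thesis unfolding v(4) w(4) by auto
qed

lemma infinite_place_subset:
  assumes "infinite_place \<kappa> N p q m M h x y V'" shows "V' \<subseteq> V"
proof
  interpret V': infinite_place \<kappa> N p q m M h x y V' by fact
  fix z assume z: "z \<in> V'"
  show "z \<in> V"
  proof (cases "z = 0")
    case False
    obtain a b where ab: "z = a / b" "a \<in> A" "b \<in> A" "b \<noteq> 0" using z V'.V_F unfolding F_def by blast
    moreover have "a \<noteq> 0" using ab False by auto
    ultimately show ?thesis using z fraction_V_iff V'.fraction_V_iff by simp
  qed (simp add: V_0)
qed

end

context as_point
begin

definition "Vinf = (SOME V. infinite_place \<kappa> N p q m M h x y V)"

lemma infinite_place_Vinf: "infinite_place \<kappa> N p q m M h x y Vinf"
  unfolding Vinf_def using ex_infinite_place by (rule someI_ex)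

sublocale Inf: infinite_place \<kappa> N p q m M h x y Vinf by (rule infinite_place_Vinf)

lemma places_valring: assumes "V \<in> places k F" shows "valring F V"
  by unfold_locales (use assms F_1 F_diff F_mult F_inverse in \<open>auto simp: places_def\<close>)

text \<open>A place containing \<open>x\<close> contains the coordinate ring, \<open>y\<close> being
  integral over it. Some nonzero function of that ring lies in its maximal ideal and divides a power
  of some \<open>t c\<close>; hence \<open>t c\<close> vanishes there, and the place must sit over
  one of the finitely many points of \<open>Xc c\<close>.\<close>

lemma place_cases:
  assumes V: "V \<in> places k F"
  obtains "V = Vinf" | c pt where "c \<ge> 1" "pt \<in> Xc c" "V = Vp pt"
proof -
  interpret valring F V by (rule places_valring[OF V])
  have kV: "k \<subseteq> V" and VF: "V \<noteq> F" using V by (auto simp: places_def)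
  show thesis
  proof (cases "x \<in> V")
    case False
    have "infinite_place \<kappa> N p q m M h x y V" by unfold_locales (use kV False in auto)
    note inf = this
    have "V \<subseteq> Vinf" by (rule Inf.infinite_place_subset[OF inf])
    moreover have "Vinf \<subseteq> V" by (rule infinite_place.infinite_place_subset[OF inf infinite_place_Vinf])
    ultimately show thesis using that(1) by blast
  next
    case xV: True
    have polyV: "poly b x \<in> V" if "b \<in> P1" for b
      unfolding poly_altdef using that kV xV by (intro V_sum V_mult V_power) (auto simp: P1_def)
    have yV: "y \<in> V"
    proof (rule ccontr)
      assume "y \<notin> V"
      hence y: "y \<noteq> 0" "inverse y \<in> V" using not_V[OF A_F[OF A_y]] P_V by auto
      define p' where "p' = p - 2"
      have p': "p = Suc (Suc p')" using p_gt_1 by (simp add: p'_def)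
      have "(y * inverse y) ^ Suc p' = 1" using y(1) by simp
      hence "y = y * (y * inverse y) ^ Suc p'" by (simp only: mult_1_right)
      also have "\<dots> = y ^ p * inverse y ^ Suc p'" by (simp only: p' power_mult_distrib power_Suc mult_ac)
      also have "\<dots> = (poly h x + y) * inverse y ^ Suc p'" by (simp only: y_p)
      also have "\<dots> = poly h x * inverse y ^ Suc p' + (y * inverse y) * inverse y ^ p'"
        by (simp only: distrib_right power_Suc mult.assoc)
      also have "\<dots> = poly h x * inverse y ^ Suc p' + inverse y ^ p'" using y(1) by simp
      also have "\<dots> \<in> V" by (intro V_add V_mult V_power polyV P1_h y)
      finally show False using \<open>y \<notin> V\<close> by simp
    qed
    have AV: "a \<in> V" if a: "a \<in> A" for a
    proof -
      obtain G where G: "G \<in> P2" "a = ev G x y" using AE[OF a] by blast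
      show ?thesis unfolding G(2) ev_altdef using G(1) by (intro V_sum V_mult V_power polyV yV) (simp add: P2_iff)
    qed
    obtain z where z: "z \<in> F" "z \<notin> V" using VF V_F by blast
    obtain a b where ab: "z = a * inverse b" "a \<in> A" "b \<in> A" "b \<noteq> 0" using z(1) unfolding F_def divide_inverse by blast
    have "inverse b \<notin> V" using ab AV V_mult z(2) by blast
    hence bP: "b \<in> P" using AV[OF ab(3)] by (simp add: max_ideal_def)
    obtain w c j where w: "w \<in> A" "c \<ge> 1" "b * w = t c ^ j" using multiple_of_t_power[OF ab(3,4)] by blast
    have tP: "t c \<in> P" using P_mult'[OF bP AV[OF w(1)]] P_powerD[OF A_F[OF t_A]] unfolding w(3) by blast
    define n where "n = q ^ (2 * c) - 1"
    have n0: "n > 0" using qc_gt_1[of "2 * c"] w(2) by (simp add: n_def)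
    have "\<exists>pt\<in>Xc c. \<forall>G\<in>P2. ev G x y \<in> P \<longrightarrow> evp G pt = 0"
    proof (rule ccontr)
      assume "\<not> ?thesis"
      hence "\<forall>pt\<in>Xc c. \<exists>G. G \<in> P2 \<and> ev G x y \<in> P \<and> evp G pt \<noteq> 0" by blast
      then obtain Gs where Gs: "\<And>pt. pt \<in> Xc c \<Longrightarrow> Gs pt \<in> P2 \<and> ev (Gs pt) x y \<in> P \<and> evp (Gs pt) pt \<noteq> 0" by metis
      \<comment> \<open>If every point were avoided by some function in \<open>P\<close>, this
        product would vanish on \<open>Xc c\<close> and be a multiple of \<open>t c\<close>,
        although each factor is 1 modulo \<open>P\<close>.\<close>
      define K where "K = (\<Prod>pt\<in>Xc c. 1 - Gs pt ^ n)"
      have KP: "K \<in> P2" unfolding K_def using Gs by (intro P2_prod P2_diff P2_power P2_1) auto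
      have "evp K pt = 0" if pt: "pt \<in> Xc c" for pt
      proof -
        define e where "e = evp (Gs pt) pt"
        have "e \<in> GF (q ^ (2 * c))" "e \<noteq> 0"
          using ev_GF[OF _ _ Xc_coords[OF pt]] w(2) Gs[OF pt] by (auto simp: e_def)
        moreover have "q ^ (2 * c) = Suc n" using q_gt_1 by (simp add: n_def)
        ultimately have "e ^ n = 1" by (simp add: GF_def)
        hence "evp (1 - Gs pt ^ n) pt = 0" by (simp add: e_def)
        thus ?thesis unfolding K_def ev_prod using pt finite_Xc[OF w(2)] by (intro prod_zero) auto
      qed
      then obtain B B' where "B \<in> P2" "K = [:T c:] * B + H * B'" using vanish_on_Xc[OF w(2) KP] by blast
      hence "ev K x y = t c * ev B x y" using xy by (simp add: ev_H t_def)
      hence "ev K x y \<in> P" using P_mult'[OF tP AV[OF AI[OF \<open>B \<in> P2\<close>]]] by simp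
      moreover have "ev K x y \<in> V - P"
      proof -
        have "(\<Prod>pt\<in>S. ev (1 - Gs pt ^ n) x y) \<in> V - P" if "finite S" "S \<subseteq> Xc c" for S
          using that
        proof (induction S rule: finite_induct)
          case (insert pt S)
          have "ev (Gs pt) x y ^ n \<in> P" using Gs[of pt] insert.prems n0 P_mult'[OF _ V_power[OF P_V], of "ev (Gs pt) x y" "ev (Gs pt) x y" "n - 1"]
            by (cases n) auto
          hence "1 + ev (Gs pt) x y ^ n \<in> V - P" by (rule unit_add[OF unit_1])
          hence "ev (1 - Gs pt ^ n) x y \<in> V - P" by simp
          moreover have "(\<Prod>pt\<in>S. ev (1 - Gs pt ^ n) x y) \<in> V - P" using insert by blast
          ultimately show ?case unfolding prod.insert[OF insert.hyps] by (rule unit_mult)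
        qed (simp only: prod.empty unit_1)
        thus ?thesis unfolding K_def ev_prod using finite_Xc[OF w(2)] by blast
      qed
      ultimately show False by blast
    qed
    then obtain pt where pt: "pt \<in> Xc c" and down: "\<And>G. G \<in> P2 \<Longrightarrow> ev G x y \<in> P \<Longrightarrow> evp G pt = 0" by blast
    interpret A: affine_place \<kappa> N p q m M h x y c pt by unfold_locales (use w(2) pt in auto)
    \<comment> \<open>Otherwise \<open>G ^ n + 1\<close> would lie in \<open>P\<close> and vanish at
      the point, where its value is 1.\<close>
    have up: "ev G x y \<in> P" if G: "G \<in> P2" "evp G pt = 0" for G
    proof (rule ccontr)
      assume no: "ev G x y \<notin> P"
      obtain B where B: "B \<in> P2" "ev G x y * (ev G x y ^ n + 1) = t c * ev B x y" using power_congruence[OF w(2) G(1)] unfolding n_def by blast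
      have gV: "ev G x y \<in> V" by (rule AV[OF AI[OF G(1)]])
      have "ev G x y * (ev G x y ^ n + 1) \<in> P" unfolding B(2) by (rule P_mult'[OF tP AV[OF AI[OF B(1)]]])
      hence "ev (G ^ n + 1) x y \<in> P" using P_multD[OF gV V_add[OF V_power[OF gV] V_1]] no by simp
      hence "evp (G ^ n + 1) pt = 0" by (intro down P2_add P2_power P2_1 G)
      thus False using G(2) n0 by (simp add: power_0_left)
    qed
    have sub: "Vp pt \<subseteq> V"
    proof
      fix z assume "z \<in> Vp pt"
      then obtain G G' where G: "G \<in> P2" "G' \<in> P2" "evp G' pt \<noteq> 0" "z = ev G x y / ev G' x y" by (rule VpE)
      have "ev G' x y \<in> V - P" using AV[OF AI[OF G(2)]] down[OF G(2)] G(3) by blast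
      thus "z \<in> V" unfolding G(4) divide_inverse using V_mult[OF AV[OF AI[OF G(1)]]] unit_inverse by blast
    qed
    moreover have "V \<subseteq> Vp pt"
    proof
      fix z assume z: "z \<in> V"
      show "z \<in> Vp pt"
      proof (rule ccontr)
        assume "z \<notin> Vp pt"
        hence z0: "z \<noteq> 0" and iz: "inverse z \<in> max_ideal (Vp pt)" using A.not_V z V_F by blast+
        obtain G G' where G: "G \<in> P2" "G' \<in> P2" "evp G' pt \<noteq> 0" "inverse z = ev G x y / ev G' x y"
          using A.P_V[OF iz] by (rule VpE)
        have "res pt (inverse z) = 0" using A.P_iff_res[OF A.P_V[OF iz]] iz by blast
        hence "evp G pt = 0" unfolding G(4) A.res_eq[OF G(1-3)] using G(3) by simp
        hence "ev G x y \<in> P" by (rule up[OF G(1)])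
        moreover have "inverse (ev G' x y) \<in> V" using unit_inverse[of "ev G' x y"] AV[OF AI[OF G(2)]] down[OF G(2)] G(3) by blast
        ultimately have "inverse z \<in> P" unfolding G(4) divide_inverse by (rule P_mult')
        hence "z * inverse z \<in> P" by (rule P_mult[OF z])
        thus False using z0 one_notin_P by simp
      qed
    qed
    ultimately show thesis using that(2)[OF w(2) pt] by blast
  qed
qed

lemma affine_placeI: "c \<ge> 1 \<Longrightarrow> pt \<in> Xc c \<Longrightarrow> affine_place \<kappa> N p q m M h x y c pt" by unfold_locales

lemma Vp_places: "c \<ge> 1 \<Longrightarrow> pt \<in> Xc c \<Longrightarrow> Vp pt \<in> places k F" using affine_place.V_place[OF affine_placeI] .
lemma Vp_ne_Vinf: "c \<ge> 1 \<Longrightarrow> pt \<in> Xc c \<Longrightarrow> Vp pt \<noteq> Vinf" using affine_place.V_A[OF affine_placeI A_x] Inf.x_V by blast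

lemma Vp_inj:
  assumes "fst pt \<in> k" "snd pt \<in> k" "on_curve pt" "fst pt' \<in> k" "snd pt' \<in> k" "on_curve pt'" "Vp pt = Vp pt'"
  shows "pt = pt'"
proof -
  have pts: "pt \<in> Xc 1" "pt' \<in> Xc 1" using assms by (auto simp: Xc_def)
  interpret A: affine_place \<kappa> N p q m M h x y 1 pt by (rule affine_placeI) (use pts in auto)
  interpret A': affine_place \<kappa> N p q m M h x y 1 pt' by (rule affine_placeI) (use pts in auto)
  have "evp G pt' = 0" if G: "G \<in> P2" "evp G pt = 0" for G
  proof -
    have "res pt (ev G x y / ev 1 x y) = 0" using A.res_eq[OF G(1) P2_1] G by simp
    hence "ev G x y \<in> max_ideal (Vp pt')" using A.P_iff_res[OF A.V_A[OF AI[OF G(1)]]] assms(7) by simp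
    hence "res pt' (ev G x y / ev 1 x y) = 0" using A'.P_iff_res[OF A'.V_A[OF AI[OF G(1)]]] by simp
    thus ?thesis using A'.res_eq[OF G(1) P2_1] by simp
  qed
  \<comment> \<open>The linear functions \<open>x - a\<close> and \<open>y - b\<close> through the
    first point recover its coordinates.\<close>
  from this[of "[:monom 1 1 + [:fst pt:]:]"] this[of "monom 1 1 + [:[:snd pt:]:]"] show ?thesis
    using assms(1,2) by (simp add: prod_eq_iff P2_const P2_add P2_monom P1_add P1_monom P1_const P1_1 poly_monom)
qed

lemma rational_places_eq:
  "rational_places k F = insert Vinf (Vp ` {pt. on_curve pt \<and> fst pt \<in> k \<and> snd pt \<in> k})"
proof (intro equalityI subsetI)
  fix V assume "V \<in> rational_places k F"
  hence V: "V \<in> places k F" "place_degree k V = 1" by (auto simp: rational_places_def)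
  show "V \<in> insert Vinf (Vp ` {pt. on_curve pt \<and> fst pt \<in> k \<and> snd pt \<in> k})"
    using V(1)
  proof (cases rule: place_cases)
    case (2 c pt)
    interpret A: affine_place \<kappa> N p q m M h x y c pt by (rule affine_placeI) (use 2 in auto)
    show ?thesis using A.place_degree_eq_1_iff V(2) 2 by (auto simp: Xc_def)
  qed auto
next
  fix V assume "V \<in> insert Vinf (Vp ` {pt. on_curve pt \<and> fst pt \<in> k \<and> snd pt \<in> k})"
  then consider "V = Vinf" | pt where "V = Vp pt" "on_curve pt" "fst pt \<in> k" "snd pt \<in> k" by blast
  thus "V \<in> rational_places k F"
  proof cases
    case 1 thus ?thesis using Inf.V_place Inf.place_degree_infinite by (simp add: rational_places_def)
  next
    case (2 pt)
    hence pt: "pt \<in> Xc 1" by (simp add: Xc_def)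
    interpret A: affine_place \<kappa> N p q m M h x y 1 pt by (rule affine_placeI) (use pt in auto)
    show ?thesis using A.V_place A.place_degree_eq_1_iff 2 by (simp add: rational_places_def)
  qed
qed

lemma card_rational_places:
  "card (rational_places k F) = 1 + card {(a, b). a \<in> k \<and> b \<in> k \<and> b ^ p + b = poly h a}"
proof -
  let ?S = "{pt. on_curve pt \<and> fst pt \<in> k \<and> snd pt \<in> k}"
  have S: "?S = {(a, b). a \<in> k \<and> b \<in> k \<and> b ^ p + b = poly h a}" by (auto simp: on_curve_def)
  have "finite ?S" by (rule finite_subset[of _ "k \<times> k"]) (auto simp: finite_k mem_Times_iff)
  moreover have "inj_on Vp ?S" by (rule inj_onI) (use Vp_inj in blast)
  moreover have "Vinf \<notin> Vp ` ?S"
  proof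
    assume "Vinf \<in> Vp ` ?S"
    then obtain pt where "pt \<in> ?S" "Vinf = Vp pt" by blast
    moreover have "pt \<in> Xc 1" using \<open>pt \<in> ?S\<close> by (simp add: Xc_def)
    ultimately show False using Vp_ne_Vinf[of 1 pt] by simp
  qed
  ultimately show ?thesis unfolding rational_places_eq S[symmetric] by (simp add: card_image)
qed

section \<open>The genus\<close>

abbreviation "L \<equiv> riemann_roch_space k F"
abbreviation "ell D \<equiv> dim_quot k (L D) {0}"
abbreviation "ddeg \<equiv> divisor_degree k"

text \<open>A common interface to the residue fields of affine and infinite places: what counts
  below is only the kernel and the number of values.\<close>

definition "residue_map V \<rho> \<longleftrightarrow> (\<forall>a\<in>V. \<forall>b\<in>V. \<rho> (a + b) = \<rho> a + \<rho> b) \<and> (\<forall>z\<in>V. \<rho> z = 0 \<longleftrightarrow> z \<in> max_ideal V)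
  \<and> finite (\<rho> ` V) \<and> card (\<rho> ` V) = q ^ place_degree k V" for \<rho> :: "universe \<Rightarrow> universe"

lemma place_structure:
  assumes "V \<in> places k F"
  shows "\<exists>t \<rho>. valring.uniformizer F V t \<and> residue_map V \<rho>"
  using assms
proof (cases rule: place_cases)
  case 1
  have "residue_map Vinf Inf.resI" unfolding residue_map_def
    using Inf.resI_add Inf.resI_0_iff Inf.card_resI Inf.resI_image finite_k by simp
  thus ?thesis using Inf.uniformizer_tau unfolding 1 by blast
next
  case (2 c pt)
  interpret A: affine_place \<kappa> N p q m M h x y c pt by (rule affine_placeI) (use 2 in auto)
  have "residue_map (Vp pt) (res pt)" unfolding residue_map_def
    using A.V_ring_res A.P_iff_res A.card_res A.finite_res by simp
  thus ?thesis using A.uniformizer_t unfolding 2(3) by blast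
qed

lemma L_iff:
  assumes t: "\<And>V. V \<in> places k F \<Longrightarrow> valring.uniformizer F V (un V)"
  shows "z \<in> L D \<longleftrightarrow> z \<in> F \<and> (\<forall>V\<in>places k F. z * un V powi (D V) \<in> V)"
proof (cases "z = 0")
  case True
  thus ?thesis using A_F[OF A_0] valring.V_0[OF places_valring] by (auto simp: riemann_roch_space_def)
next
  case False
  thus ?thesis using valring.valuation_ge_iff(1)[OF places_valring t _ False]
    by (auto simp: riemann_roch_space_def)
qed

lemma L_0: "0 \<in> L D" by (simp add: riemann_roch_space_def A_F[OF A_0])

lemma L_add:
  assumes "a \<in> L D" "b \<in> L D" shows "a + b \<in> L D"
proof -
  obtain un where un: "\<And>V. V \<in> places k F \<Longrightarrow> valring.uniformizer F V (un V)" using place_structure by metis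
  note iff = L_iff[OF un]
  show ?thesis
    using assms F_diff[of a b] valring.V_add[OF places_valring] by (simp add: iff distrib_right)
qed

lemma L_scale:
  assumes "b \<in> k" "a \<in> L D" shows "b * a \<in> L D"
proof -
  obtain un where un: "\<And>V. V \<in> places k F \<Longrightarrow> valring.uniformizer F V (un V)" using place_structure by metis
  note iff = L_iff[OF un]
  have "a \<in> F" using assms(2) by (simp add: riemann_roch_space_def)
  hence "b * a \<in> F" using A_F[OF A_k[OF assms(1)]] F_mult by blast
  moreover have "b * a * un V powi D V \<in> V" if V: "V \<in> places k F" for V
  proof -
    have "b \<in> V" using V assms(1) by (auto simp: places_def)
    moreover have "a * un V powi D V \<in> V" using assms(2) V by (simp add: iff)
    ultimately show ?thesis using valring.V_mult[OF places_valring[OF V]] by (simp add: mult.assoc)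
  qed
  ultimately show ?thesis by (simp add: iff)
qed

lemmas L_closed = L_0 L_add L_scale

lemma card_L: "finite (L D) \<Longrightarrow> card (L D) = q ^ ell D"
proof -
  assume fin: "finite (L D)"
  have "card ((\<lambda>z. z) ` L D) = card k ^ ell D"
    by (rule card_image_eq_power_dim_quot)
       (use finite_k k_0 k_add GF_mult[of _ q] GF_inverse[of _ q] L_closed fin in auto)
  thus ?thesis by (simp add: card_k)
qed

text \<open>Allowing one more pole at \<open>V\<close> adds at most the leading coefficient there,
  an element of the residue field.\<close>

lemma L_step:
  assumes V: "V \<in> places k F" and fin: "finite (L D)"
  shows "finite (L (D(V := D V + 1)))" "ell (D(V := D V + 1)) \<le> ell D + place_degree k V"
proof -
  let ?D = "D(V := D V + 1)"
  obtain un where t: "\<And>V. V \<in> places k F \<Longrightarrow> valring.uniformizer F V (un V)" using place_structure by metis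
  obtain \<rho> where \<rho>: "residue_map V \<rho>" using place_structure[OF V] by blast
  have iff: "z \<in> L D \<longleftrightarrow> z \<in> F \<and> (\<forall>V\<in>places k F. z * un V powi (D V) \<in> V)" for z D
    by (rule L_iff) (rule t)
  interpret valring F V by (rule places_valring[OF V])
  define \<phi> where "\<phi> z = \<rho> (z * un V powi (D V + 1))" for z
  have inV: "z * un V powi (D V + 1) \<in> V" if "z \<in> L ?D" for z
  proof -
    have "z * un V powi ?D V \<in> V" using that V unfolding iff by blast
    thus ?thesis by simp
  qed
  have add: "\<phi> (a + b) = \<phi> a + \<phi> b" if "a \<in> L ?D" "b \<in> L ?D" for a b
    using \<rho> inV[OF that(1)] inV[OF that(2)] by (simp add: \<phi>_def residue_map_def distrib_right)
  have ker: "a \<in> L D" if a: "a \<in> L ?D" "\<phi> a = 0" for a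
  proof (cases "a = 0")
    case False
    have "a * un V powi (D V + 1) \<in> max_ideal V" using \<rho> inV[OF a(1)] a(2) by (simp add: \<phi>_def residue_map_def)
    moreover have aF: "a \<in> F" using a(1) by (simp add: riemann_roch_space_def)
    ultimately have aV: "a * un V powi D V \<in> V" using valuation_ge_iff[OF t[OF V] aF False, of "D V"] by blast
    have "a * un W powi D W \<in> W" if W: "W \<in> places k F" for W
    proof (cases "W = V")
      case False
      have "a * un W powi ?D W \<in> W" using a(1) W unfolding iff by blast
      thus ?thesis using False by simp
    qed (use aV in simp)
    thus ?thesis using aF unfolding iff by blast
  qed (simp add: L_closed)
  have sub: "\<phi> ` L ?D \<subseteq> \<rho> ` V" using inV by (auto simp: \<phi>_def)
  have fin\<rho>: "finite (\<rho> ` V)" and card\<rho>: "card (\<rho> ` V) = q ^ place_degree k V" using \<rho> by (auto simp: residue_map_def)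
  \<comment> \<open>A section of \<open>\<phi>\<close>. Recording the leading coefficient together
    with the difference from the chosen representative embeds the larger space into a product whose
    size is known.\<close>
  define z0 where "z0 = inv_into (L ?D) \<phi>"
  let ?f = "\<lambda>z. (\<phi> z, z + z0 (\<phi> z))"
  have z0: "z0 (\<phi> z) \<in> L ?D" "\<phi> (z0 (\<phi> z)) = \<phi> z" if "z \<in> L ?D" for z
    unfolding z0_def using that by (simp_all add: inv_into_into f_inv_into_f)
  have img: "?f ` L ?D \<subseteq> \<rho> ` V \<times> L D"
  proof clarify
    fix z assume z: "z \<in> L ?D"
    have "z + z0 (\<phi> z) \<in> L D"
    proof (rule ker)
      show "z + z0 (\<phi> z) \<in> L ?D" by (rule L_add[OF z z0(1)[OF z]])
      show "\<phi> (z + z0 (\<phi> z)) = 0" unfolding add[OF z z0(1)[OF z]] z0(2)[OF z] by simp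
    qed
    thus "\<phi> z \<in> \<rho> ` V \<and> z + z0 (\<phi> z) \<in> L D" using sub z by blast
  qed
  have inj: "inj_on ?f (L ?D)"
  proof (rule inj_onI)
    fix z w assume "?f z = ?f w"
    hence "\<phi> z = \<phi> w" "z + z0 (\<phi> z) = w + z0 (\<phi> w)" by auto
    thus "z = w" by (metis add_right_cancel)
  qed
  have finP: "finite (\<rho> ` V \<times> L D)" using fin\<rho> fin by simp
  show finD: "finite (L ?D)" using inj_on_finite[OF inj img finP] .
  have "q ^ ell ?D \<le> q ^ place_degree k V * q ^ ell D"
    using card_inj_on_le[OF inj img finP] unfolding card_cartesian_product card\<rho> card_L[OF fin] card_L[OF finD] .
  hence "q ^ ell ?D \<le> q ^ (ell D + place_degree k V)" by (simp add: power_add mult.commute)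
  thus "ell ?D \<le> ell D + place_degree k V" using q_gt_1 power_le_imp_le_exp by blast
qed

lemma deg_eq_sum: "finite S \<Longrightarrow> {V. D V \<noteq> 0} \<subseteq> S \<Longrightarrow> ddeg D = (\<Sum>V\<in>S. D V * int (place_degree k V))"
  unfolding divisor_degree_def by (rule sum.mono_neutral_left) auto

lemma L_mono: assumes "\<And>V. D V \<le> D' V" shows "L D \<subseteq> L D'"
proof
  fix z assume "z \<in> L D"
  thus "z \<in> L D'" unfolding riemann_roch_space_def using assms by (auto) (meson minus_le_iff neg_le_iff_le order.trans)
qed

text \<open>Each added place raises the degree by its own degree and the dimension by no more. The
  induction runs over the number of places still to be added.\<close>

lemma speciality_mono:
  assumes "is_divisor k F D" "is_divisor k F D'" "\<And>V. D V \<le> D' V" "finite (L D)"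
  shows "finite (L D') \<and> ddeg D - int (ell D) \<le> ddeg D' - int (ell D')"
  using assms
proof (induction "\<Sum>V\<in>{V. D V \<noteq> 0} \<union> {V. D' V \<noteq> 0}. nat (D' V - D V)" arbitrary: D rule: less_induct)
  case less
  let ?S = "{V. D V \<noteq> 0} \<union> {V. D' V \<noteq> 0}"
  have finS: "finite ?S" and S: "?S \<subseteq> places k F" using less.prems(1,2) by (auto simp: is_divisor_def)
  show ?case
  proof (cases "D = D'")
    case True thus ?thesis using less.prems(4) by simp
  next
    case False
    then obtain V where "D V \<noteq> D' V" by blast
    hence V: "D V < D' V" using less.prems(3)[of V] by simp
    hence VS: "V \<in> ?S" by auto
    hence Vp: "V \<in> places k F" using S by blast
    define E where "E = D(V := D V + 1)"
    have suppE: "{V. E V \<noteq> 0} \<subseteq> ?S" using VS by (auto simp: E_def)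
    have E: "is_divisor k F E" using suppE finS S unfolding is_divisor_def by (meson finite_subset order.trans)
    have ED: "E W \<le> D' W" for W using less.prems(3)[of W] V by (simp add: E_def)
    have "(\<Sum>V\<in>{V. E V \<noteq> 0} \<union> {V. D' V \<noteq> 0}. nat (D' V - E V)) \<le> (\<Sum>V\<in>?S. nat (D' V - E V))"
      using suppE finS by (intro sum_mono2) auto
    also have "\<dots> < (\<Sum>V\<in>?S. nat (D' V - D V))"
      using finS VS V by (intro sum_strict_mono_ex1) (auto simp: E_def)
    finally have "finite (L D') \<and> ddeg E - int (ell E) \<le> ddeg D' - int (ell D')"
      using L_step(1)[OF Vp less.prems(4)] ED by (intro less.hyps E less.prems(2)) (auto simp: E_def)
    moreover have "ddeg E = ddeg D + int (place_degree k V)"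
    proof -
      have "ddeg E = (\<Sum>W\<in>?S. E W * int (place_degree k W))" by (rule deg_eq_sum[OF finS suppE])
      also have "\<dots> = (\<Sum>W\<in>?S. D W * int (place_degree k W) + (if W = V then int (place_degree k V) else 0))"
        by (rule sum.cong) (auto simp: E_def distrib_right)
      also have "\<dots> = (\<Sum>W\<in>?S. D W * int (place_degree k W)) + int (place_degree k V)"
        using finS VS by (simp add: sum.distrib)
      also have "(\<Sum>W\<in>?S. D W * int (place_degree k W)) = ddeg D" by (rule deg_eq_sum[symmetric, OF finS]) auto
      finally show ?thesis .
    qed
    moreover have "ell E \<le> ell D + place_degree k V" unfolding E_def by (rule L_step(2)[OF Vp less.prems(4)])
    ultimately show ?thesis by linarith
  qed
qed

definition "Dinf n = (\<lambda>V. if V = Vinf then int n else 0)"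

lemma is_divisor_Dinf: "is_divisor k F (Dinf n)"
  using Inf.V_place by (auto simp: is_divisor_def Dinf_def)

lemma deg_Dinf: "ddeg (Dinf n) = int n"
  by (subst deg_eq_sum[of "{Vinf}"]) (auto simp: Dinf_def Inf.place_degree_infinite)

text \<open>A denominator can be taken to be a power of some \<open>t c\<close>. The numerator then
  vanishes on \<open>Xc c\<close>, so one factor \<open>t c\<close> cancels at a time.\<close>

lemma integral_closure:
  assumes z: "z \<in> F" and V: "\<And>c pt. c \<ge> 1 \<Longrightarrow> pt \<in> Xc c \<Longrightarrow> z \<in> Vp pt"
  shows "z \<in> A"
proof -
  obtain a b where ab: "z = a / b" "a \<in> A" "b \<in> A" "b \<noteq> 0" using z unfolding F_def by blast
  obtain w c j where w: "w \<in> A" "c \<ge> 1" "b * w = t c ^ j" using multiple_of_t_power[OF ab(3,4)] by blast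
  have tnz: "t c \<noteq> 0" by (rule t_nz[OF w(2)])
  have "z * t c ^ j \<in> A" unfolding w(3)[symmetric] ab(1) using ab(4) A_mult[OF ab(2) w(1)] by simp
  thus ?thesis
  proof (induction j)
    case (Suc j)
    obtain G where G: "G \<in> P2" "z * t c ^ Suc j = ev G x y" using Suc.prems by (rule AE)
    have "evp G pt = 0" if pt: "pt \<in> Xc c" for pt
    proof -
      interpret A: affine_place \<kappa> N p q m M h x y c pt by (rule affine_placeI[OF w(2) pt])
      have "z * t c ^ Suc j = t c * (z * t c ^ j)" by simp
      also have "\<dots> \<in> max_ideal (Vp pt)"
        using A.t_P[OF A.uniformizer_t] by (intro A.P_mult' A.V_mult V[OF w(2) pt] A.t_V)
      finally have "ev G x y \<in> max_ideal (Vp pt)" unfolding G(2) .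
      hence "res pt (ev G x y / ev 1 x y) = 0" using A.P_iff_res[OF A.V_A[OF AI[OF G(1)]]] by simp
      thus ?thesis using A.res_eq[OF G(1) P2_1] by simp
    qed
    then obtain B B' where B: "B \<in> P2" "G = [:T c:] * B + H * B'" using vanish_on_Xc[OF w(2) G(1)] by blast
    have "z * t c ^ Suc j = t c * ev B x y" unfolding G(2) B(2) using xy by (simp add: ev_H t_def)
    hence "z * t c ^ j = ev B x y" using tnz by (simp add: mult.left_commute)
    thus ?case using Suc.IH AI[OF B(1)] by simp
  qed simp
qed

lemma L_Dinf: "L (Dinf n) = Sp (Suc n)"
proof (intro equalityI subsetI)
  fix z assume z: "z \<in> L (Dinf n)"
  hence zF: "z \<in> F" by (simp add: riemann_roch_space_def)
  show "z \<in> Sp (Suc n)"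
  proof (cases "z = 0")
    case False
    have val: "valuation V z \<ge> - Dinf n V" if "V \<in> places k F" for V
      using z False that by (simp add: riemann_roch_space_def)
    have "z \<in> A"
    proof (rule integral_closure[OF zF])
      fix c pt assume pt: "c \<ge> 1" "pt \<in> Xc c"
      interpret A: affine_place \<kappa> N p q m M h x y c pt by (rule affine_placeI[OF pt])
      show "z \<in> Vp pt"
        using val[OF Vp_places[OF pt]] A.valuation_ge_iff(1)[OF A.uniformizer_t zF False, of 0] Vp_ne_Vinf[OF pt] by (simp add: Dinf_def)
    qed
    moreover have "z * Inf.tau powi int n \<in> Vinf"
      using val[OF Inf.V_place] Inf.valuation_ge_iff(1)[OF Inf.uniformizer_tau zF False, of "int n"] by (simp add: Dinf_def)
    ultimately show ?thesis using Inf.Sp_iff by simp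
  qed (simp add: Sp_0)
next
  fix z assume z: "z \<in> Sp (Suc n)"
  have zA: "z \<in> A" by (rule Sp_A[OF z])
  note zF = A_F[OF zA]
  show "z \<in> L (Dinf n)"
  proof (cases "z = 0")
    case False
    have "valuation V z \<ge> - Dinf n V" if "V \<in> places k F" for V
      using that
    proof (cases rule: place_cases)
      case 1
      have "z * Inf.tau powi int n \<in> Vinf" using Inf.Sp_iff[OF zA] z by simp
      thus ?thesis using Inf.valuation_ge_iff(1)[OF Inf.uniformizer_tau zF False, of "int n"] by (simp add: Dinf_def 1)
    next
      case (2 c pt)
      interpret A: affine_place \<kappa> N p q m M h x y c pt by (rule affine_placeI[OF 2(1,2)])
      show ?thesis
        using A.valuation_ge_iff(1)[OF A.uniformizer_t zF False, of 0] A.V_A[OF zA] Vp_ne_Vinf[OF 2(1,2)] by (simp add: Dinf_def 2(3))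
    qed
    thus ?thesis using zF by (simp add: riemann_roch_space_def)
  qed (simp add: L_closed)
qed

lemma ell_Dinf: "ell (Dinf n) = card {v. v < Suc n \<and> nongap v}"
proof -
  have "q ^ ell (Dinf n) = q ^ card {v. v < Suc n \<and> nongap v}"
    using card_L[of "Dinf n"] finite_Sp card_Sp unfolding L_Dinf by simp
  thus ?thesis using q_gt_1 power_inject_exp by blast
qed

section \<open>Gaps at infinity and Riemann's upper bound\<close>

definition "gaps = {v. \<not> nongap v}"

lemma finite_gaps: "finite gaps" and card_gaps: "2 * card gaps = M * (p * (p - 1))"
proof -
  \<comment> \<open>With residue \<open>j\<close> the gaps are \<open>j + p * l\<close> for
    \<open>l < M * j\<close>, so their number is the sum of the \<open>M * j\<close>.\<close>
  have eq: "gaps = (\<lambda>(j, l). j + p * l) ` (SIGMA j:{..<p}. {..<M * j})"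
  proof (intro equalityI subsetI)
    fix v assume "v \<in> gaps"
    hence "v div p < M * (v mod p)" by (simp add: gaps_def nongap_def)
    moreover have "v = (\<lambda>(j, l). j + p * l) (v mod p, v div p)" by simp
    moreover have "v mod p < p" using p_gt_1 by simp
    ultimately show "v \<in> (\<lambda>(j, l). j + p * l) ` (SIGMA j:{..<p}. {..<M * j})" by (metis (no_types, lifting) SigmaI image_eqI lessThan_iff)
  next
    fix v assume "v \<in> (\<lambda>(j, l). j + p * l) ` (SIGMA j:{..<p}. {..<M * j})"
    then obtain j l where "v = j + p * l" "j < p" "l < M * j" by auto
    thus "v \<in> gaps" by (simp add: gaps_def nongap_def)
  qed
  have inj: "inj_on (\<lambda>(j, l). j + p * l) (SIGMA j:{..<p}. {..<M * j})"
  proof (rule inj_onI, clarify)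
    fix j l j' l' assume "j < p" "j' < p" "j + p * l = j' + p * l'"
    hence "(j + p * l) mod p = (j' + p * l') mod p" "(j + p * l) div p = (j' + p * l') div p" by simp_all
    thus "j = j' \<and> l = l'" using \<open>j < p\<close> \<open>j' < p\<close> by simp
  qed
  show "finite gaps" unfolding eq by simp
  have "card gaps = (\<Sum>j<p. M * j)" unfolding eq card_image[OF inj] by simp
  also have "\<dots> = M * (\<Sum>j<p. j)" by (simp add: sum_distrib_left)
  finally have "2 * card gaps = M * (2 * (\<Sum>j<p. j))" by simp
  also have "2 * (\<Sum>j<n. j) = n * (n - 1)" for n :: nat
  proof (induction n)
    case (Suc n) thus ?case by (cases n) auto
  qed simp
  finally show "2 * card gaps = M * (p * (p - 1))" .
qed

lemma card_nongaps_ge: "n \<le> card {v. v < n \<and> nongap v} + card gaps"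
proof -
  have "card {..<n} \<le> card ({v. v < n \<and> nongap v} \<union> gaps)"
    by (rule card_mono) (auto simp: finite_gaps, auto simp: gaps_def)
  also have "\<dots> \<le> card {v. v < n \<and> nongap v} + card gaps" by (rule card_Un_le)
  finally show ?thesis by simp
qed

lemma card_nongaps_eq: "gaps \<subseteq> {..<n} \<Longrightarrow> card {v. v < n \<and> nongap v} + card gaps = n"
proof -
  assume sub: "gaps \<subseteq> {..<n}"
  have "{..<n} = {v. v < n \<and> nongap v} \<union> gaps" using sub by (auto simp: gaps_def)
  moreover have "{v. v < n \<and> nongap v} \<inter> gaps = {}" by (auto simp: gaps_def)
  ultimately have "card {..<n} = card {v. v < n \<and> nongap v} + card gaps"
    by (simp add: card_Un_disjoint finite_gaps)
  thus ?thesis by simp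
qed

text \<open>A place of degree \<open>d\<close> is a Frobenius orbit of \<open>d\<close> points.\<close>

lemma place_degree_le_fibre:
  assumes c: "c \<ge> 1" and pt: "pt \<in> Xc c"
  shows "place_degree k (Vp pt) \<le> card {P\<in>Xc c. Vp P = Vp pt}"
proof -
  interpret A: affine_place \<kappa> N p q m M h x y c pt by (rule affine_placeI[OF c pt])
  let ?S = "{P\<in>Xc c. Vp P = Vp pt}"
  define Fr where "Fr i = (fst pt ^ (q ^ i), snd pt ^ (q ^ i))" for i
  have frob: "(a + b) ^ (q ^ i) = a ^ (q ^ i) + b ^ (q ^ i)" for a b :: universe and i unfolding qc by (rule frob_add)
  have ck: "b ^ (q ^ i) = b" if "b \<in> k" for b i using that GF_mono[of 1 i q] by (auto simp: GF_def)
  have poly_frob: "poly f (a ^ (q ^ i)) = poly f a ^ (q ^ i)" if "f \<in> P1" for f a i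
    using that unfolding poly_altdef qc frob_sum unfolding qc[symmetric]
    by (simp add: power_mult_distrib P1_def ck mult.commute flip: power_mult)
  have ev_frob: "evp G (Fr i) = evp G pt ^ (q ^ i)" if "G \<in> P2" for G i
    using that unfolding ev_altdef qc frob_sum unfolding qc[symmetric]
    by (simp add: Fr_def power_mult_distrib P2_iff poly_frob mult.commute flip: power_mult)
  have FrS: "Fr i \<in> ?S" for i
  proof -
    have "evp H (Fr i) = 0"
      unfolding ev_frob[OF P2_H] ev_H_on_curve[OF A.on_curve] using q_gt_1 by (simp add: power_0_left)
    hence "on_curve (Fr i)" by (simp add: on_curve_def ev_H)
    moreover have "fst (Fr i) \<in> GF (q ^ c)" using pt GF_power by (auto simp: Fr_def Xc_def)
    moreover have "Vp (Fr i) = Vp pt"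
    proof -
      have "evp G (Fr i) \<noteq> 0 \<longleftrightarrow> evp G pt \<noteq> 0" if "G \<in> P2" for G
        unfolding ev_frob[OF that] using q_gt_1 by simp
      thus ?thesis unfolding Vp_def by (intro Collect_cong) blast
    qed
    ultimately show ?thesis by (simp add: Xc_def)
  qed
  have finS: "finite ?S" using finite_Xc[OF c] by simp
  have "card (Fr ` {..card ?S}) \<le> card ?S" by (rule card_mono[OF finS]) (use FrS in auto)
  hence "card (Fr ` {..card ?S}) < card {..card ?S}" by simp
  \<comment> \<open>Among one more Frobenius images than there are points two coincide; both
    coordinates then lie in a field of degree at most \<open>card ?S\<close>.\<close>
  hence "\<not> inj_on Fr {..card ?S}" by (rule pigeonhole)
  then obtain i' j' where ij': "i' \<le> card ?S" "j' \<le> card ?S" "i' \<noteq> j'" "Fr i' = Fr j'" unfolding inj_on_def by auto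
  define i j where "i = min i' j'" and "j = max i' j'"
  have ij: "i < j" "j \<le> card ?S" "Fr i = Fr j" using ij' by (auto simp: i_def j_def min_def max_def)
  have fixed: "z \<in> GF (q ^ (j - i))" if "z ^ (q ^ i) = z ^ (q ^ j)" for z :: universe
  proof -
    have "q ^ j = q ^ (j - i) * q ^ i" using ij(1) by (simp flip: power_add)
    hence "(z ^ (q ^ (j - i))) ^ (q ^ i) = z ^ (q ^ i)" using that by (simp add: power_mult)
    thus ?thesis unfolding qc[of i] by (simp add: frob_inj GF_def)
  qed
  have "place_degree k (Vp pt) \<le> j - i"
    using ij by (intro A.place_degree_le fixed) (auto simp: Fr_def)
  thus ?thesis using ij(2) by linarith
qed

lemma sum_degrees_le: "c \<ge> 1 \<Longrightarrow> (\<Sum>V\<in>Vp ` Xc c. place_degree k V) \<le> p * q ^ c"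
proof -
  assume c: "c \<ge> 1"
  have "(\<Sum>V\<in>Vp ` Xc c. place_degree k V) \<le> (\<Sum>V\<in>Vp ` Xc c. \<Sum>P | P \<in> Xc c \<and> Vp P = V. 1)"
    using place_degree_le_fibre[OF c] by (intro sum_mono) auto
  also have "\<dots> = (\<Sum>P\<in>Xc c. 1)" by (intro sum.group finite_Xc c finite_imageI) auto
  finally show ?thesis by (simp add: card_Xc[OF c])
qed

lemma t_infinite: assumes "c \<ge> 1" shows "\<exists>u\<in>Vinf - max_ideal Vinf. t c = Inf.tau powi (- int (p * q ^ c)) * u"
proof -
  have "nongap (p * q ^ c)" using nongap_weight[of 0 "q ^ c"] p_gt_1 by simp
  then obtain u where u: "u \<in> Vinf - max_ideal Vinf" "xymon (p * q ^ c) = Inf.tau powi (- int (p * q ^ c)) * u"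
    using Inf.xymon_tau by blast
  have eqx: "xymon (p * q ^ c) = x ^ (q ^ c)" using mon_weight[of 0 "q ^ c"] p_gt_1 by simp
  define n where "n = q ^ c - 1"
  have n: "q ^ c = Suc n" "n > 0" using qc_gt_1[OF assms] by (simp_all add: n_def)
  have "x ^ (q ^ c) * inverse x ^ n = x * (x * inverse x) ^ n"
    by (simp only: n(1) power_Suc power_mult_distrib mult.assoc)
  hence "x ^ (q ^ c) * inverse x ^ n = x" using x_nz by simp
  hence tc: "t c = x ^ (q ^ c) * (1 + inverse x ^ n)" by (simp add: t_eq distrib_left)
  have w: "1 + inverse x ^ n \<in> Vinf - max_ideal Vinf"
    by (intro Inf.unit_add Inf.unit_1 Inf.inverse_x_power n(2))
  have "t c = Inf.tau powi (- int (p * q ^ c)) * (u * (1 + inverse x ^ n))"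
    unfolding tc eqx[symmetric] u(2) by (rule mult.assoc)
  thus ?thesis using Inf.unit_mult[OF u(1) w] by blast
qed

text \<open>\<open>D\<close> is enlarged to \<open>D0\<close>, equal to \<open>n\<close> at infinity
  and at all places over \<open>Xc c\<close>, which does not lower degree minus dimension. Quotients
  by \<open>t c ^ n\<close> of functions with poles only at infinity give enough elements of the
  space of \<open>D0\<close>.\<close>

lemma riemann_inequality:
  assumes D: "is_divisor k F D"
  shows "ddeg D - int (ell D) + 1 \<le> int (card gaps)"
proof -
  let ?supp = "{V. D V \<noteq> 0}"
  have fin: "finite ?supp" and places: "?supp \<subseteq> places k F" using D by (auto simp: is_divisor_def)
  have "\<forall>V\<in>?supp. \<exists>c\<ge>1. V = Vinf \<or> V \<in> Vp ` Xc c"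
  proof
    fix V assume "V \<in> ?supp"
    hence "V \<in> places k F" using places by blast
    thus "\<exists>c\<ge>1. V = Vinf \<or> V \<in> Vp ` Xc c" by (cases rule: place_cases) auto
  qed
  then obtain cc where cc: "\<And>V. V \<in> ?supp \<Longrightarrow> cc V \<ge> 1 \<and> (V = Vinf \<or> V \<in> Vp ` Xc (cc V))" by metis
  \<comment> \<open>A common multiple, so that one \<open>t c\<close> vanishes at all affine places
    of the support.\<close>
  define c where "c = (\<Prod>V\<in>?supp. cc V)"
  have "c > 0" unfolding c_def by (rule prod_pos) (use cc in fastforce)
  hence c: "c \<ge> 1" by simp
  have supp: "V = Vinf \<or> V \<in> Vp ` Xc c" if "V \<in> ?supp" for V
  proof -
    have "cc V dvd c" unfolding c_def using fin that by (rule dvd_prodI)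
    thus ?thesis using cc[OF that] Xc_mono by blast
  qed
  define n where "n = (\<Sum>V\<in>?supp. nat \<bar>D V\<bar>)"
  have Dn: "D V \<le> int n" if "V \<in> ?supp" for V
  proof -
    have "nat \<bar>D V\<bar> \<le> n" unfolding n_def using that fin by (intro member_le_sum) auto
    thus ?thesis by linarith
  qed
  let ?B = "Vp ` Xc c"
  have finB: "finite ?B" using finite_Xc[OF c] by simp
  have VinfB: "Vinf \<notin> ?B" using Vp_ne_Vinf[OF c] by blast
  define D0 where "D0 V = (if V = Vinf \<or> V \<in> ?B then int n else 0)" for V
  have suppD0: "{V. D0 V \<noteq> 0} \<subseteq> insert Vinf ?B" by (auto simp: D0_def)
  have "finite (insert Vinf ?B)" using finB by simp
  moreover have "insert Vinf ?B \<subseteq> places k F" using Inf.V_place Vp_places[OF c] by blast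
  ultimately have D0: "is_divisor k F D0" unfolding is_divisor_def using finite_subset[OF suppD0] suppD0 by blast
  have DD0: "D V \<le> D0 V" for V
    by (cases "D V = 0") (use supp[of V] Dn[of V] in \<open>auto simp: D0_def\<close>)
  have "finite (L (Dinf n))" unfolding L_Dinf by (rule finite_Sp)
  hence finD0: "finite (L D0)"
    using speciality_mono[OF is_divisor_Dinf D0, of n] by (auto simp: Dinf_def D0_def)
  hence "finite (L D)" using L_mono[of D D0] DD0 finite_subset by blast
  hence le: "ddeg D - int (ell D) \<le> ddeg D0 - int (ell D0)" using speciality_mono[OF D D0 DD0] by blast
  have "ddeg D0 = (\<Sum>V\<in>insert Vinf ?B. D0 V * int (place_degree k V))"
    by (rule deg_eq_sum) (use finB in \<open>auto simp: D0_def\<close>)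
  also have "\<dots> = int n + int n * (\<Sum>V\<in>?B. int (place_degree k V))"
    using finB VinfB by (simp add: D0_def Inf.place_degree_infinite sum_distrib_left)
  also have "\<dots> \<le> int n + int n * int (p * q ^ c)"
  proof -
    have "(\<Sum>V\<in>?B. int (place_degree k V)) = int (\<Sum>V\<in>?B. place_degree k V)" by (rule of_nat_sum[symmetric])
    also have "\<dots> \<le> int (p * q ^ c)" using sum_degrees_le[OF c] by (simp only: of_nat_le_iff)
    finally show ?thesis by (intro add_left_mono mult_left_mono) simp_all
  qed
  finally have degD0: "ddeg D0 \<le> int (n + n * (p * q ^ c))" by simp
  \<comment> \<open>The order \<open>n\<close> allowed at infinity plus the pole order of
    \<open>t c ^ n\<close> there; it also bounds the degree of \<open>D0\<close>.\<close>
  let ?n = "n + n * (p * q ^ c)"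
  have tnz: "t c \<noteq> 0" by (rule t_nz[OF c])
  have inL: "a / t c ^ n \<in> L D0" if a: "a \<in> Sp (Suc ?n)" for a
  proof (cases "a = 0")
    case False
    have aA: "a \<in> A" by (rule Sp_A[OF a])
    let ?z = "a / t c ^ n"
    have "t c ^ n \<in> A" "t c ^ n \<noteq> 0" using A_power[OF t_A] tnz by simp_all
    hence zF: "?z \<in> F" unfolding F_def using aA by blast
    have z0: "?z \<noteq> 0" using False tnz by simp
    have "valuation V ?z \<ge> - D0 V" if V: "V \<in> places k F" for V
      using V
    proof (cases rule: place_cases)
      case 1
      obtain u where u: "u \<in> Vinf - max_ideal Vinf" "t c = Inf.tau powi (- int (p * q ^ c)) * u" using t_infinite[OF c] by blast
      have un: "inverse (u ^ n) \<in> Vinf" using Inf.unit_inverse[OF Inf.unit_power[OF u(1)]] by blast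
      have tn: "t c ^ n = Inf.tau powi (- int (n * (p * q ^ c))) * u ^ n"
        unfolding u(2) power_mult_distrib by (simp add: power_int_power' power_int_minus power_inverse mult.commute flip: power_mult)
      have "?z * Inf.tau powi int n = a * Inf.tau powi int ?n * inverse (u ^ n)"
        unfolding tn using Inf.tau_nz by (simp add: power_int_minus power_int_add divide_inverse mult_ac power_add)
      moreover have "a * Inf.tau powi int ?n * inverse (u ^ n) \<in> Vinf"
        by (rule Inf.V_mult[OF Inf.Sp_iff[OF aA, THEN iffD1, OF a] un])
      ultimately have "?z * Inf.tau powi int n \<in> Vinf" by (simp only:)
      thus ?thesis using Inf.valuation_ge_iff(1)[OF Inf.uniformizer_tau zF z0, of "int n"] by (simp add: D0_def 1)
    next
      case (2 c' pt)
      show ?thesis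
      proof (cases "V \<in> ?B")
        case True
        then obtain P where P: "P \<in> Xc c" "V = Vp P" by blast
        interpret A: affine_place \<kappa> N p q m M h x y c P by (rule affine_placeI[OF c P(1)])
        have "?z * t c powi int n = a" using tnz by simp
        hence "?z * t c powi int n \<in> Vp P" using A.V_A[OF aA] by simp
        thus ?thesis using A.valuation_ge_iff(1)[OF A.uniformizer_t zF z0, of "int n"] True by (simp add: D0_def P(2))
      next
        case notB: False
        interpret A: affine_place \<kappa> N p q m M h x y c' pt by (rule affine_placeI[OF 2(1,2)])
        have "pt \<notin> Xc c" using notB 2(3) by blast
        hence "evp [:T c:] pt \<noteq> 0" using A.on_curve by (simp add: Xc_def poly_T_0_iff)
        hence "1 / t c \<in> Vp pt" using VpI[OF P2_1 P2_const[OF P1_T], of c pt] by (simp add: t_def)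
        hence "a * (1 / t c) ^ n \<in> Vp pt" using A.V_mult[OF A.V_A[OF aA] A.V_power] by blast
        hence "?z \<in> Vp pt" by (simp add: power_one_over field_simps)
        thus ?thesis using A.valuation_ge_iff(1)[OF A.uniformizer_t zF z0, of 0] notB Vp_ne_Vinf[OF 2(1,2)] by (simp add: D0_def 2(3))
      qed
    qed
    thus ?thesis using zF by (simp add: riemann_roch_space_def)
  qed (simp add: L_closed)
  have "card ((\<lambda>a. a / t c ^ n) ` Sp (Suc ?n)) \<le> card (L D0)" using inL by (intro card_mono finD0) auto
  moreover have "inj_on (\<lambda>a. a / t c ^ n) (Sp (Suc ?n))" by (rule inj_onI) (use tnz in simp)
  ultimately have "q ^ card {v. v < Suc ?n \<and> nongap v} \<le> q ^ ell D0"
    by (simp add: card_image card_Sp card_L[OF finD0])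
  hence "card {v. v < Suc ?n \<and> nongap v} \<le> ell D0" using q_gt_1 power_le_imp_le_exp by blast
  hence "Suc ?n \<le> ell D0 + card gaps" using card_nongaps_ge[of "Suc ?n"] by linarith
  thus ?thesis using le degD0 by linarith
qed

text \<open>The bound is attained by a multiple of the place at infinity beyond the last
  gap.\<close>

lemma genus_eq: "2 * genus k F = int (M * (p * (p - 1)))"
proof -
  obtain n where n: "gaps \<subseteq> {..<Suc n}"
    using finite_gaps finite_nat_bounded[of gaps] by (meson lessThan_subset_iff lessI order.trans less_imp_le)
  have "genus k F = int (card gaps)" unfolding genus_def
  proof (rule Greatest_equality)
    have "card {v. v < Suc n \<and> nongap v} + card gaps = Suc n" by (rule card_nongaps_eq[OF n])
    hence "int (card gaps) = ddeg (Dinf n) - int (ell (Dinf n)) + 1"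
      unfolding deg_Dinf ell_Dinf by linarith
    thus "\<exists>D. is_divisor k F D \<and> int (card gaps) = ddeg D - int (ell D) + 1" using is_divisor_Dinf by blast
  qed (use riemann_inequality in auto)
  thus ?thesis using card_gaps by (metis of_nat_mult of_nat_numeral)
qed

end

section \<open>Function fields of generic points\<close>

lemma ring_of_type_algebra_simps [simp]:
  "carrier ring_of_type_algebra = UNIV" "\<one>\<^bsub>ring_of_type_algebra\<^esub> = 1" "\<zero>\<^bsub>ring_of_type_algebra\<^esub> = 0"
  "x \<otimes>\<^bsub>ring_of_type_algebra\<^esub> y = x * y" "x \<oplus>\<^bsub>ring_of_type_algebra\<^esub> y = x + y"
  by (simp_all add: ring_of_type_algebra_def)

lemma a_inv_ring_of_type_algebra [simp]: "\<ominus>\<^bsub>ring_of_type_algebra\<^esub> (x :: 'a :: field) = - x"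
proof -
  interpret R: field "ring_of_type_algebra :: 'a ring" by (rule field_from_type_algebra)
  have "x \<oplus>\<^bsub>ring_of_type_algebra\<^esub> (- x) = \<zero>\<^bsub>ring_of_type_algebra\<^esub>" by simp
  thus ?thesis by (intro R.minus_equality[symmetric, THEN sym]) (simp_all add: add.commute)
qed

lemma m_inv_ring_of_type_algebra [simp]: "x \<noteq> 0 \<Longrightarrow> inv\<^bsub>ring_of_type_algebra\<^esub> (x :: 'a :: field) = inverse x"
  unfolding m_inv_def by (rule the_equality) (auto simp: inverse_unique)

context as_point
begin

lemma generate_field_eq: "generate_field ring_of_type_algebra (k \<union> {x, y}) = F"
proof (intro equalityI subsetI)
  fix z assume "z \<in> generate_field ring_of_type_algebra (k \<union> {x, y})"
  thus "z \<in> F"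
  proof (induction rule: generate_field.induct)
    case (incl h) thus ?case using A_F A_k A_x A_y by auto
  next
    case (eng_add h1 h2) thus ?case using F_diff[of h1 h2] by simp
  qed (simp_all add: F_1 F_inverse F_mult)
next
  let ?S = "generate_field ring_of_type_algebra (k \<union> {x, y})"
  have one: "1 \<in> ?S" using generate_field.one[of ring_of_type_algebra] by simp
  have add: "a + b \<in> ?S" if "a \<in> ?S" "b \<in> ?S" for a b
    using generate_field.eng_add[OF that] by simp
  have mult: "a * b \<in> ?S" if "a \<in> ?S" "b \<in> ?S" for a b
    using generate_field.eng_mult[OF that] by simp
  have inv: "inverse a \<in> ?S" if "a \<in> ?S" "a \<noteq> 0" for a
    using generate_field.m_inv[OF that(1)] that(2) by simp
  have k: "a \<in> ?S" if "a \<in> k \<union> {x, y}" for a by (rule generate_field.incl[OF that])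
  have pow: "a ^ n \<in> ?S" if "a \<in> ?S" for a n by (induction n) (use one mult that in auto)
  have sum: "sum f I \<in> ?S" if "\<And>i. i \<in> I \<Longrightarrow> f i \<in> ?S" for f :: "nat \<Rightarrow> universe" and I
    using that by (induction I rule: infinite_finite_induct) (use k k_0 add in auto)
  have A: "a \<in> ?S" if a: "a \<in> A" for a
  proof -
    obtain G where G: "G \<in> P2" "a = ev G x y" using AE[OF a] by blast
    have "coeff (coeff G j) i \<in> ?S" for i j using G(1) k by (simp add: poly2_over_def)
    moreover have "x \<in> ?S" "y \<in> ?S" using k by auto
    ultimately show ?thesis unfolding G(2) ev_altdef poly_altdef by (intro sum mult pow)
  qed
  fix z assume "z \<in> F"
  then obtain a b where "z = a / b" "a \<in> A" "b \<in> A" "b \<noteq> 0" unfolding F_def by blast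
  thus "z \<in> ?S" using A inv mult by (simp add: divide_inverse)
qed

lemma generic_point: "generic_point k H x y"
  unfolding generic_point_def
proof
  fix G assume G: "G \<in> P2"
  show "poly (poly G [:y:]) x = 0 \<longleftrightarrow> (\<exists>Q\<in>P2. G = H * Q)"
  proof
    assume "\<exists>Q\<in>P2. G = H * Q"
    then obtain Q where "G = H * Q" by blast
    hence "ev G x y = 0" using xy by (simp add: ev_H)
    thus "poly (poly G [:y:]) x = 0" by (simp add: ev_def)
  next
    assume "poly (poly G [:y:]) x = 0"
    thus "\<exists>Q\<in>P2. G = H * Q" using generic[OF G] by (simp add: ev_def)
  qed
qed

end

context as_curve
begin

lemma as_point_if_generic:
  assumes "generic_point k H x y" shows "as_point \<kappa> N p q m M h x y"
proof unfold_locales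
  have iff: "ev G x y = 0 \<longleftrightarrow> (\<exists>Q\<in>P2. G = H * Q)" if "G \<in> P2" for G
    using assms that by (simp add: generic_point_def ev_def)
  have "ev H x y = 0" using iff[OF P2_H] P2_1 by (metis mult.right_neutral)
  thus "y ^ p + y = poly h x" by (simp add: ev_H)
  fix c assume c: "c \<in> P1" "poly c x = 0"
  hence "ev [:c:] x y = 0" by simp
  then obtain Q where Q: "[:c:] = H * Q" using iff[OF P2_const[OF c(1)]] by blast
  show "c = 0"
  proof (rule ccontr)
    assume "c \<noteq> 0"
    hence "H * Q \<noteq> 0" using Q by (metis pCons_eq_0_iff)
    hence "degree (H * Q) = p + degree Q" by (subst degree_mult_eq) (auto simp: degree_H)
    thus False using p_gt_1 by (simp flip: Q)
  qed
qed

text \<open>The variable of the rational function field serves as \<open>x\<close>. A nonzero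
  polynomial relation over the finite field \<open>k\<close> would reduce its powers to finitely
  many values, but they are distinct.\<close>

lemma ex_generic: "\<exists>x y. as_point \<kappa> N p q m M h x y"
proof -
  define x :: universe where "x = to_ac (Fract [:0, 1:] 1)"
  obtain y where "poly (monom 1 p + (monom 1 1 + [:poly h x:])) y = 0"
  proof -
    have "degree (monom 1 1 + [:poly h x:]) < p"
      using p_gt_1 by (intro le_less_trans[OF degree_add_le_max]) (simp add: degree_monom_eq)
    hence "degree (monom 1 p + (monom 1 1 + [:poly h x:])) = p" by (subst degree_add_eq_left) (simp_all add: degree_monom_eq)
    thus ?thesis using alg_closed_imp_poly_has_root p_gt_1 that by (metis less_trans zero_less_one)
  qed
  moreover have "poly (monom 1 p + (monom 1 1 + [:poly h x:])) y = (y ^ p + y) + poly h x" by (simp add: poly_monom add.assoc)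
  ultimately have y: "y ^ p + y = poly h x" by (simp only: add_eq_0_universe)
  have inj: "i = j" if eq: "x ^ i = x ^ j" for i j
  proof -
    have "Fract [:0, 1:] 1 ^ i = Fract ([:0, 1:] ^ i) (1 :: bit poly)" for i by (induction i) (simp_all add: One_fract_def)
    hence "to_ac (Fract ([:0, 1:] ^ i) (1 :: bit poly)) = to_ac (Fract ([:0, 1:] ^ j) 1)"
      using eq unfolding x_def by (simp flip: to_ac_power)
    hence "[:0, 1:] ^ i = ([:0, 1:] ^ j :: bit poly)" by (simp add: eq_fract)
    hence "degree ([:0, 1:] ^ i :: bit poly) = degree ([:0, 1:] ^ j :: bit poly)" by simp
    thus ?thesis by (simp add: degree_power_eq)
  qed
  have transc: "c = 0" if c: "c \<in> P1" "poly c x = 0" for c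
  proof (rule ccontr)
    assume c0: "c \<noteq> 0"
    define S where "S = (\<lambda>a. \<Sum>i<degree c. a i * x ^ i) ` PiE {..<degree c} (\<lambda>_. k)"
    have finS: "finite S" unfolding S_def using finite_k by (intro finite_imageI finite_PiE) auto
    define d where "d = smult (inverse (lead_coeff c)) c"
    have lc: "lead_coeff c \<in> k" using c(1) by (simp add: P1_def)
    have d: "d \<in> P1" "lead_coeff d = 1" "degree d = degree c" "poly d x = 0"
      using c c0 lc by (auto simp: d_def P1_def GF_mult GF_inverse)
    have "x ^ j \<in> S" for j
    proof -
      have "\<exists>Q R. (\<forall>i. coeff Q i \<in> k) \<and> (\<forall>i. coeff R i \<in> k) \<and> monom 1 j = d * Q + R \<and> (\<forall>i\<ge>degree d. coeff R i = 0)"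
        using d P1_monom[OF GF_1, of j] by (intro monic_division) (auto simp: P1_def k_0 k_add GF_mult)
      then obtain Q R where R: "\<And>i. coeff R i \<in> k" "monom 1 j = d * Q + R" "\<forall>i\<ge>degree c. coeff R i = 0" unfolding d(3) by blast
      have "poly (monom 1 j) x = poly d x * poly Q x + poly R x" by (simp only: R(2) poly_add poly_mult)
      hence "x ^ j = poly R x" by (simp add: d(4) poly_monom)
      also have "\<dots> = (\<Sum>i\<le>max (degree R) (degree c). coeff R i * x ^ i)"
        unfolding poly_altdef by (intro sum.mono_neutral_left) (auto simp: coeff_eq_0)
      also have "\<dots> = (\<Sum>i<degree c. coeff R i * x ^ i)" using R(3) by (intro sum.mono_neutral_right) auto
      also have "\<dots> = (\<Sum>i<degree c. restrict (coeff R) {..<degree c} i * x ^ i)" by (rule sum.cong) auto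
      finally show ?thesis unfolding S_def using R(1) by (intro image_eqI[of _ _ "restrict (coeff R) {..<degree c}"]) auto
    qed
    hence "range (\<lambda>j. x ^ j) \<subseteq> S" by blast
    hence "finite (range (\<lambda>j. x ^ j))" using finS by (rule finite_subset)
    moreover have "inj (\<lambda>j. x ^ j)" by (rule injI) (rule inj)
    ultimately show False using finite_imageD infinite_UNIV_nat by blast
  qed
  have "as_point \<kappa> N p q m M h x y" by unfold_locales (use y transc in auto)
  thus ?thesis by blast
qed

text \<open>\<open>function_field\<close> selects its generic point by choice, so existence is
  needed first, and the geometry then applies to whichever point is selected.\<close>

lemma function_field_point:
  obtains x y where "as_point \<kappa> N p q m M h x y" "function_field k H = as_point.F q x y"
proof -
  define P where "P = (\<lambda>(x, y). generic_point k H x y)"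
  obtain x0 y0 where "as_point \<kappa> N p q m M h x0 y0" using ex_generic by blast
  hence "P (x0, y0)" unfolding P_def using as_point.generic_point by simp
  hence S: "P (SOME z. P z)" by (rule someI)
  obtain x y where xy: "(SOME z. P z) = (x, y)" by (cases "SOME z. P z")
  have "P (x, y)" using S by (simp only: xy)
  hence pt: "as_point \<kappa> N p q m M h x y" by (simp add: P_def as_point_if_generic)
  have "function_field k H = generate_field ring_of_type_algebra (k \<union> {x, y})"
    unfolding function_field_def P_def[symmetric] xy by simp
  thus thesis using that[OF pt] as_point.generate_field_eq[OF pt] by simp
qed

lemma genus_rational_places:
  "2 * genus k (function_field k H) = int (M * (p * (p - 1)))"
  "card (rational_places k (function_field k H)) = 1 + card {(a, b). a \<in> k \<and> b \<in> k \<and> b ^ p + b = poly h a}"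
proof -
  obtain x y where xy: "as_point \<kappa> N p q m M h x y" "function_field k H = as_point.F q x y" by (rule function_field_point)
  show "2 * genus k (function_field k H) = int (M * (p * (p - 1)))"
    "card (rational_places k (function_field k H)) = 1 + card {(a, b). a \<in> k \<and> b \<in> k \<and> b ^ p + b = poly h a}"
    unfolding xy(2) using as_point.genus_eq[OF xy(1)] as_point.card_rational_places[OF xy(1)] by auto
qed

end

section \<open>Extremal curves\<close>

context quadric
begin

definition "R = (\<Sum>i=1..e. monom (a i) (p ^ i))"

lemma poly_R: "poly R z = Rf z" by (simp add: R_def Rf_def poly_sum poly_monom)

lemma e_ge_1: "e \<ge> 1" using e_eq by simp

lemma as_curve:
  assumes r: "r \<ge> 1" and c: "c \<in> K r"
  shows "as_curve k (k * r) p (p ^ r) (p ^ e + 1) (p ^ (e - 1)) ([:0, 1:] * (R + [:0, c:]))"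
proof
  have pe: "p ^ e > 1" using one_less_power[OF p_gt_1, of e] e_ge_1 by simp
  have coeff_R: "coeff R j \<in> K r" for j
    unfolding R_def coeff_sum using GFp_K[OF r a_GF] K_0[OF r] by (intro K_sum[OF r]) simp
  show "coeff ([:0, 1:] * (R + [:0, c:])) i \<in> K r" for i
    using coeff_R c K_0[OF r] by (auto simp: coeff_pCons intro!: K_add[OF r] split: nat.split)
  have "coeff R (p ^ e) = (\<Sum>i=1..e. if i = e then a e else 0)"
    unfolding R_def coeff_sum using p_gt_1 by (intro sum.cong) auto
  hence R_e: "coeff R (p ^ e) = a e" using e_ge_1 by simp
  have "degree R \<le> p ^ e" unfolding R_def
    using p_gt_1 by (intro degree_sum_le) (auto intro!: order.trans[OF degree_monom_le] power_increasing)
  moreover have "degree R \<ge> p ^ e" by (rule le_degree) (simp add: R_e a_e)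
  ultimately have deg_R: "degree R = p ^ e" by simp
  have "degree [:0, c:] < degree R" using pe unfolding deg_R
    by (intro le_less_trans[OF degree_pCons_le]) simp
  hence "degree (R + [:0, c:]) = p ^ e" by (simp add: degree_add_eq_left deg_R)
  moreover from this have "R + [:0, c:] \<noteq> 0" using pe p_gt_1 by auto
  ultimately show "degree ([:0, 1:] * (R + [:0, c:])) = p ^ e + 1"
    by (subst degree_mult_eq) auto
  show "p ^ e + 1 = p * p ^ (e - 1) + 1" using e_ge_1 by (cases e) auto
  show "1 \<le> p ^ (e - 1)" using p_gt_1 by simp
qed (use k p pr[OF r] kr[OF r] in auto)

text \<open>Twice the genus is \<open>(p - 1) * p ^ e\<close> and the point count deviates from
  \<open>q + 1\<close> by \<open>(p - 1) * S\<close>, so the factor \<open>p - 1\<close>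
  cancels.\<close>

lemma curve_iff:
  assumes r: "r \<ge> 1" and c: "c \<in> K r"
  shows "maximal_curve (p ^ r) (curve_poly p R c) \<longleftrightarrow> real_of_int (S r c) = real (p ^ e) * sqrt (real (p ^ r))"
    and "minimal_curve (p ^ r) (curve_poly p R c) \<longleftrightarrow> real_of_int (S r c) = - (real (p ^ e) * sqrt (real (p ^ r)))"
proof -
  interpret C: as_curve k "k * r" p "p ^ r" "p ^ e + 1" "p ^ (e - 1)" "[:0, 1:] * (R + [:0, c:])"
    by (rule as_curve[OF r c])
  define Fn where "Fn = function_field (K r) (curve_poly p R c)"
  have H: "C.H = curve_poly p R c" unfolding C.H_def curve_poly_def ..
  have "p ^ (e - 1) * (p * (p - 1)) = p ^ e * (p - 1)" using e_ge_1 by (cases e) auto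
  hence "2 * genus (K r) Fn = int (p ^ e * (p - 1))" using C.genus_rational_places(1) by (simp only: H Fn_def)
  hence "real_of_int (2 * genus (K r) Fn) = real_of_int (int (p ^ e * (p - 1)))" by (rule arg_cong)
  hence gen: "2 * real_of_int (genus (K r) Fn) = real (p ^ e) * real (p - 1)" by simp
  have "card (rational_places (K r) Fn) = 1 + card {(x, y). x \<in> K r \<and> y \<in> K r \<and> y ^ p + y = x * (Rf x + c * x)}"
    using C.genus_rational_places(2) unfolding H Fn_def[symmetric] by (simp add: poly_R mult.commute[of c])
  hence "int (card (rational_places (K r) Fn)) = 1 + int (p ^ r) + int (p - 1) * S r c"
    using card_affine_points[OF r c] by simp
  hence "real_of_int (int (card (rational_places (K r) Fn))) = real_of_int (1 + int (p ^ r) + int (p - 1) * S r c)" by (rule arg_cong)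
  hence card: "real (card (rational_places (K r) Fn)) = 1 + real (p ^ r) + real (p - 1) * real_of_int (S r c)" by simp
  have p1: "real (p - 1) > 0" using p_gt_1 by simp
  define w where "w = real (p ^ e) * sqrt (real (p ^ r))"
  have eq: "2 * real_of_int (genus (K r) Fn) * sqrt (real (p ^ r)) = real (p - 1) * w" unfolding gen w_def by simp
  have "maximal_curve (p ^ r) (curve_poly p R c) \<longleftrightarrow> real (p - 1) * real_of_int (S r c) = real (p - 1) * w"
    unfolding maximal_curve_def Let_def Fn_def[symmetric] card eq by auto
  thus "maximal_curve (p ^ r) (curve_poly p R c) \<longleftrightarrow> real_of_int (S r c) = real (p ^ e) * sqrt (real (p ^ r))"
    using p1 unfolding w_def by (simp only: mult_cancel_left) auto
  have "minimal_curve (p ^ r) (curve_poly p R c) \<longleftrightarrow> real (p - 1) * real_of_int (S r c) = real (p - 1) * (- w)"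
    unfolding minimal_curve_def Let_def Fn_def[symmetric] card eq by auto
  thus "minimal_curve (p ^ r) (curve_poly p R c) \<longleftrightarrow> real_of_int (S r c) = - (real (p ^ e) * sqrt (real (p ^ r)))"
    using p1 unfolding w_def by (simp only: mult_cancel_left) auto
qed

lemma extremal_iff:
  assumes r: "r \<ge> 1" and c: "c \<in> K r"
  shows "extremal_curve (p ^ r) (curve_poly p R c) \<longleftrightarrow> n dvd r \<and> (\<forall>z\<in>W r. ch r (z * Rf z + c * z ^ 2) = 1)"
    and "maximal_curve (p ^ r) (curve_poly p R c) \<longleftrightarrow> extremal_curve (p ^ r) (curve_poly p R c) \<and> S r c > 0"
proof -
  define w where "w = real (p ^ e) * sqrt (real (p ^ r))"
  have w: "w > 0" using p_gt_1 by (simp add: w_def)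
  have w2: "w ^ 2 = real (p ^ r * p ^ (2 * e))"
    by (simp add: w_def power_mult_distrib mult.commute flip: power_mult)
  have ext: "extremal_curve (p ^ r) (curve_poly p R c) \<longleftrightarrow> real_of_int (S r c) = w \<or> real_of_int (S r c) = - w"
    unfolding extremal_curve_def curve_iff[OF r c] w_def ..
  also have "\<dots> \<longleftrightarrow> (real_of_int (S r c)) ^ 2 = w ^ 2" by (simp add: power2_eq_iff)
  also have "\<dots> \<longleftrightarrow> real_of_int (S r c ^ 2) = real_of_int (int (p ^ r * p ^ (2 * e)))" unfolding w2 by simp
  also have "\<dots> \<longleftrightarrow> S r c ^ 2 = int (p ^ r * p ^ (2 * e))" by (rule of_int_eq_iff)
  finally show "extremal_curve (p ^ r) (curve_poly p R c) \<longleftrightarrow> n dvd r \<and> (\<forall>z\<in>W r. ch r (z * Rf z + c * z ^ 2) = 1)"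
    unfolding S_square_extremal_iff[OF r c] .
  have "S r c > 0 \<longleftrightarrow> real_of_int (S r c) > 0" by simp
  thus "maximal_curve (p ^ r) (curve_poly p R c) \<longleftrightarrow> extremal_curve (p ^ r) (curve_poly p R c) \<and> S r c > 0"
    using w unfolding ext curve_iff(1)[OF r c] w_def[symmetric] by auto
qed

end

lemma coeff_cofactor_GF:
  assumes "\<And>i. coeff ([:1, 1:] * h) i \<in> GF (2 ^ k)" shows "coeff h i \<in> (GF (2 ^ k) :: universe set)"
proof (induction i)
  case 0 thus ?case using assms[of 0] by simp
next
  case (Suc i)
  have eq: "coeff ([:1, 1:] * h) (Suc i) = coeff h (Suc i) + coeff h i" by simp
  show ?case using GF_add[OF assms[of "Suc i"] Suc] unfolding eq
    by (simp only: add.assoc add_self_universe add_0_right)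
qed

theorem theorem6p12:
  fixes p k e n :: nat
    and f g R :: "universe poly"
    and a :: "nat \<Rightarrow> universe"
    and E \<alpha> :: "universe \<Rightarrow> universe"
    and C :: "universe \<Rightarrow> universe poly poly"
  assumes p: "k \<ge> 1" "p = 2 ^ k"
    and f_coeffs: "\<And>i. coeff f i \<in> GF p"
    and f_degree: "degree f = e"
    and f_ends: "coeff f 0 * coeff f e \<noteq> 0"
    and f_1: "poly f 1 = 0"
    and f_simple: "rsquarefree f"
  defines "g \<equiv> f * reflect_poly f"
    and "a \<equiv> \<lambda>i. coeff g (e + i)"
    and "R \<equiv> \<Sum>i=1..e. monom (a i) (p ^ i)"
    and "E \<equiv> \<lambda>z. poly R z + (\<Sum>i=1..e. inv_frobenius (p ^ i) (a i * z))"
    and "n \<equiv> LEAST n. n \<ge> 1 \<and> g dvd monom 1 n + 1"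
    and "C \<equiv> \<lambda>c. curve_poly p R c"
    and "\<alpha> \<equiv> \<lambda>u. (THE w. w \<in> GF p \<and> w ^ 2 = poly R 1) + poly (pderiv f) 1 + E u"
  shows "\<forall>q r. r \<ge> 1 \<and> q = p ^ r \<longrightarrow>
     ((\<exists>c\<in>GF q. extremal_curve q (C c)) \<longrightarrow> (GF (p ^ n) :: universe set) \<subseteq> GF q) \<and>
     (\<forall>s. (GF (p ^ n) :: universe set) \<subseteq> GF q \<and> q = p ^ (n * s) \<longrightarrow>
       (\<forall>c\<in>GF q.
         (extremal_curve q (C c) \<longleftrightarrow> (\<exists>u\<in>GF q. c = \<alpha> u ^ 2)) \<and>
         (maximal_curve q (C c) \<longleftrightarrow>
            (\<exists>u\<in>GF q. c = \<alpha> u ^ 2 \<and>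
               trace_GF2 q (u * poly R u + \<alpha> 0 * u) = of_nat (s + 1)))))"
proof -
  obtain f1 where "f = [:- 1, 1:] * f1" using f_1 unfolding poly_eq_0_iff_dvd by (rule dvdE)
  hence f: "f = [:1, 1:] * f1" by simp
  have "coeff f1 i \<in> GF p" for i using f_coeffs coeff_cofactor_GF unfolding f p(2) by blast
  then interpret Q: quadric k p e f f1
    by unfold_locales (use p f f_degree f_ends f_simple in auto)
  have g: "g = Q.g" unfolding g_def Q.g_def ..
  have a: "a = Q.a" unfolding a_def g Q.a_def ..
  have R: "R = Q.R" unfolding R_def a Q.R_def ..
  have E: "E = Q.E" unfolding E_def R a Q.E_def Q.poly_R ..
  have n: "n = Q.n" unfolding n_def g Q.n_def ..
  have C: "C c = curve_poly p Q.R c" for c unfolding C_def R ..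
  have \<alpha>: "\<alpha> u = Q.c0 + Q.E u" for u unfolding \<alpha>_def R E Q.poly_R Q.c0_eq ..
  have \<alpha>0: "\<alpha> 0 = Q.c0" unfolding \<alpha> by simp
  show ?thesis
    unfolding C \<alpha>0 unfolding R n \<alpha> Q.poly_R
  proof (intro allI impI)
    fix q r assume "r \<ge> 1 \<and> q = p ^ r"
    hence r: "r \<ge> 1" and q: "q = p ^ r" by auto
    let ?Ext = "\<lambda>c. extremal_curve q (curve_poly p Q.R c)" and ?Max = "\<lambda>c. maximal_curve q (curve_poly p Q.R c)"
    have part1: "(GF (p ^ Q.n) :: universe set) \<subseteq> GF q" if c: "c \<in> GF q" "?Ext c" for c
    proof -
      have "Q.n dvd r" using c Q.extremal_iff(1)[OF r] unfolding q by blast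
      thus ?thesis unfolding q by (rule GF_mono)
    qed
    have part2: "(?Ext c \<longleftrightarrow> (\<exists>u\<in>GF q. c = (Q.c0 + Q.E u) ^ 2)) \<and>
        (?Max c \<longleftrightarrow> (\<exists>u\<in>GF q. c = (Q.c0 + Q.E u) ^ 2 \<and> trace_GF2 q (u * Q.Rf u + Q.c0 * u) = of_nat (s + 1)))"
      if s: "q = p ^ (Q.n * s)" and c: "c \<in> GF q" for s c
    proof -
      have rs: "r = Q.n * s" using s Q.p_gt_1 unfolding q by (simp add: power_inject_exp)
      have nr: "Q.n dvd r" by (simp add: rs)
      \<comment> \<open>Half of \<open>r\<close>; as \<open>Q.n div 2\<close> is odd, its parity is
        that of \<open>s\<close>.\<close>
      define t where "t = Q.n div 2 * s"
      have rt: "r = 2 * t" using Q.n_even by (auto simp: rs t_def)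
      have t_s: "odd t \<longleftrightarrow> odd s" using Q.n_half_odd by (simp add: t_def)
      have cK: "c \<in> Q.K r" using c by (simp add: q)
      have S0: "Q.S r (Q.c0 ^ 2) > 0 \<longleftrightarrow> odd s" "Q.S r (Q.c0 ^ 2) \<noteq> 0"
        using Q.S_c0_odd[OF rt r nr] Q.S_c0_even[OF rt r nr] t_s by (cases "odd s"; fastforce)+
      have Ext: "?Ext c \<longleftrightarrow> (\<exists>u\<in>GF q. c = (Q.c0 + Q.E u) ^ 2)"
        unfolding q using Q.extremal_iff(1)[OF r cK] nr Q.extremal_iff_image[OF r S0(2) cK] by blast
      have sign: "Q.S r c > 0 \<longleftrightarrow> trace_GF2 q (u * Q.Rf u + Q.c0 * u) = of_nat (s + 1)"
        if u: "u \<in> GF q" "c = (Q.c0 + Q.E u) ^ 2" for u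
      proof -
        let ?z = "u * Q.Rf u + Q.c0 * u"
        have uK: "u \<in> Q.K r" using u(1) by (simp add: q)
        have S: "Q.S r c = Q.ch r ?z * Q.S r (Q.c0 ^ 2)" using Q.S_translate[OF r uK] u(2) by simp
        have "?z \<in> GF (2 ^ (k * r))" unfolding Q.pr[OF r, symmetric]
          using uK Q.GFp_K[OF r Q.c0_GF] by (intro Q.K_add[OF r] GF_mult Q.Rf_K[OF r])
        hence tr: "trace_GF2 q ?z = 0 \<and> Q.ch r ?z = 1 \<or> trace_GF2 q ?z = 1 \<and> Q.ch r ?z = - 1"
          using trace_cases[of ?z "k * r"] unfolding q Q.pr[OF r] chi_def by auto
        \<comment> \<open>For odd \<open>s\<close> the sum at \<open>Q.c0 ^ 2\<close> is positive,
          so maximality asks for trace 0; for even \<open>s\<close> it is negative and the trace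
          must be 1.\<close>
        have par: "(of_nat (s + 1) :: universe) = (if odd s then 0 else 1)"
          using two_eq_0_universe by (auto elim!: evenE oddE)
        show ?thesis unfolding S par using tr S0 by (cases "odd s") (auto simp: zero_less_mult_iff)
      qed
      have "?Max c \<longleftrightarrow> (\<exists>u\<in>GF q. c = (Q.c0 + Q.E u) ^ 2 \<and> Q.S r c > 0)"
        using Q.extremal_iff(2)[OF r cK] Ext unfolding q by blast
      also have "\<dots> \<longleftrightarrow> (\<exists>u\<in>GF q. c = (Q.c0 + Q.E u) ^ 2 \<and> trace_GF2 q (u * Q.Rf u + Q.c0 * u) = of_nat (s + 1))"
        using sign by blast
      finally show ?thesis using Ext by blast
    qed
    show "((\<exists>c\<in>GF q. ?Ext c) \<longrightarrow> (GF (p ^ Q.n) :: universe set) \<subseteq> GF q) \<and>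
     (\<forall>s. (GF (p ^ Q.n) :: universe set) \<subseteq> GF q \<and> q = p ^ (Q.n * s) \<longrightarrow>
       (\<forall>c\<in>GF q. (?Ext c \<longleftrightarrow> (\<exists>u\<in>GF q. c = (Q.c0 + Q.E u) ^ 2)) \<and>
         (?Max c \<longleftrightarrow> (\<exists>u\<in>GF q. c = (Q.c0 + Q.E u) ^ 2 \<and> trace_GF2 q (u * Q.Rf u + Q.c0 * u) = of_nat (s + 1)))))"
      using part1 part2 by blast
  qed
qed

end
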